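(* Let $(\bar\rho,\bar\phi)$ be a smooth Euler solution on $[0,T]$: $$\partial_t\bar\rho+\{\bar\phi,\bar\rho\}=0,\qquad\Delta\bar\phi=\bar\rho,\qquad\int_{\mathbb{T}^2}\bar\rho\,dx=\int_{\mathbb{T}^2}\bar\phi\,dx=0.$$ Let $\varepsilon>0$ and let $(\rho^\varepsilon,\psi^\varepsilon)$ be a smooth solution of $$\partial_t\rho^\varepsilon+\{\psi^\varepsilon,\rho^\varepsilon\}=0,\qquad\det(I+\varepsilon D^2\psi^\varepsilon)=1+\varepsilon\rho^\varepsilon,\qquad\int_{\mathbb{T}^2}\rho^\varepsilon dx=\int_{\mathbb{T}^2}\psi^\varepsilon dx=0,$$ with $\rho^\varepsilon(0)=\bar\rho(0)=\rho_0$, and assume $\varepsilon\|D^2\psi^\varepsilon(t)\|_{L^\infty}\le\eta_0$ on $[0,T]$. Define the physical densities $m^\varepsilon=1+\varepsilon\rho^\varepsilon$, $\bar m^\varepsilon=1+\varepsilon\bar\rho$, and assume that $m^\varepsilon,\bar m^\varepsilon\ge c_0>0$ on $[0,T]$. Then $$\sup_{0\le t\le T}W_2(m^\varepsilon(t),\bar m^\varepsilon(t))\le C_T\,\varepsilon^2.$$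
   Context: $\mathbb{T}^2=\mathbb{R}^2/\mathbb{Z}^2$ with unit volume; $\nabla^\perp f=(-\partial_2f,\partial_1f)$ and $\{f,g\}=\nabla^\perp f\cdot\nabla g$. $W_2$ is the quadratic Wasserstein distance on $\mathbb{T}^2$ for the flat-torus distance, between probability measures identified with their densities. $\eta_0>0$ is a fixed, sufficiently small universal constant. $C_T$ is independent of $\varepsilon$: it depends on $T$, $c_0$, $\|\rho_0\|_{L^\infty\cap L^2}$, and $\bar u=\nabla^\perp\bar\phi$ through $\|\nabla\bar u\|_{L^1(0,T;L^\infty)}$. *)

theory Defs
  imports "HOL-Analysis.Analysis" "HOL-Probability.Essential_Supremum"
begin

text \<open>
  Functions on the flat torus are represented by functions on the plane that are periodic
  with respect to the integer lattice; as a measure space, the torus is the half-open unit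
  square with the restriction of Lebesgue measure.
\<close>

definition int_lattice :: "(real^2) set" where
  "int_lattice = {k. \<forall>i. k $ i \<in> \<int>}"

definition periodic :: "(real^2 \<Rightarrow> 'b) \<Rightarrow> bool" where
  "periodic f \<longleftrightarrow> (\<forall>x. \<forall>k\<in>int_lattice. f (x + k) = f x)"

definition unit_cell :: "(real^2) set" where
  "unit_cell = {x. \<forall>i. 0 \<le> x $ i \<and> x $ i < 1}"

definition torus :: "(real^2) measure" where
  "torus = restrict_space lborel unit_cell"

definition torus_dist :: "real^2 \<Rightarrow> real^2 \<Rightarrow> real" where
  "torus_dist x y = (INF k\<in>int_lattice. dist x (y + k))"


text \<open>
  A function is smooth on \<open>S\<close> if it is differentiable within \<open>S\<close> and all its directional
  derivatives are again smooth on \<open>S\<close>. The definition is coinductive, so it asks for derivatives of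
  every order. It is applied to the closed slab \<open>{0..T} \<times> UNIV\<close>, where derivatives within the set
  are unique if \<open>0 < T\<close>; this is smoothness up to the times \<open>0\<close> and \<open>T\<close>.
\<close>

coinductive smooth_on :: "'a::real_normed_vector set \<Rightarrow> ('a \<Rightarrow> 'b::real_normed_vector) \<Rightarrow> bool"
  for S where
  "(\<And>x. x \<in> S \<Longrightarrow> (f has_derivative D x) (at x within S)) \<Longrightarrow>
   (\<And>v. smooth_on S (\<lambda>x. D x v)) \<Longrightarrow> smooth_on S f"

definition smooth_torus_evolution :: "real \<Rightarrow> (real \<Rightarrow> real^2 \<Rightarrow> real) \<Rightarrow> bool" where
  "smooth_torus_evolution T f \<longleftrightarrow>
     (\<forall>t\<in>{0..T}. periodic (f t)) \<and> smooth_on ({0..T} \<times> UNIV) (\<lambda>(t, x). f t x)"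


definition gradient :: "(real^2 \<Rightarrow> real) \<Rightarrow> real^2 \<Rightarrow> real^2" where
  "gradient f x = (\<chi> i. frechet_derivative f (at x) (axis i 1))"

definition perp_gradient :: "(real^2 \<Rightarrow> real) \<Rightarrow> real^2 \<Rightarrow> real^2" where
  "perp_gradient f x = vector [- gradient f x $ 2, gradient f x $ 1]"

definition bracket :: "(real^2 \<Rightarrow> real) \<Rightarrow> (real^2 \<Rightarrow> real) \<Rightarrow> real^2 \<Rightarrow> real" where
  "bracket f g x = perp_gradient f x \<bullet> gradient g x"

definition hessian :: "(real^2 \<Rightarrow> real) \<Rightarrow> real^2 \<Rightarrow> real^2^2" where
  "hessian f x = jacobian (gradient f) (at x)"

definition laplacian :: "(real^2 \<Rightarrow> real) \<Rightarrow> real^2 \<Rightarrow> real" where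
  "laplacian f x = trace (hessian f x)"


text \<open>For matrix-valued functions, the pointwise norm is the Frobenius norm.\<close>

definition Linf_norm :: "(real^2 \<Rightarrow> 'b::real_normed_vector) \<Rightarrow> real" where
  "Linf_norm f = real_of_ereal (esssup torus (\<lambda>x. ereal (norm (f x))))"

definition L2_norm :: "(real^2 \<Rightarrow> real) \<Rightarrow> real" where
  "L2_norm f = sqrt (\<integral>x. (f x)\<^sup>2 \<partial>torus)"


definition couplings :: "'a measure \<Rightarrow> 'b measure \<Rightarrow> ('a \<times> 'b) measure set" where
  "couplings M N =
     {P. sets P = sets (M \<Otimes>\<^sub>M N) \<and> distr P M fst = M \<and> distr P N snd = N}"

definition W2 :: "(real^2) measure \<Rightarrow> (real^2) measure \<Rightarrow> real" where
  "W2 M N =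
     sqrt (enn2real (INF P\<in>couplings M N. \<integral>\<^sup>+ (x, y). ennreal ((torus_dist x y)\<^sup>2) \<partial>P))"

definition torus_density :: "(real^2 \<Rightarrow> real) \<Rightarrow> (real^2) measure" where
  "torus_density m = density torus (\<lambda>x. ennreal (m x))"


definition mean_zero :: "(real^2 \<Rightarrow> real) \<Rightarrow> bool" where
  "mean_zero f \<longleftrightarrow> (\<integral>x. f x \<partial>torus) = 0"

definition transported :: "real \<Rightarrow> (real \<Rightarrow> real^2 \<Rightarrow> real) \<Rightarrow> (real \<Rightarrow> real^2 \<Rightarrow> real) \<Rightarrow> bool" where
  "transported T \<psi> \<rho> \<longleftrightarrow>
     (\<forall>t\<in>{0..T}. \<forall>x.
        ((\<lambda>s. \<rho> s x) has_real_derivative - bracket (\<psi> t) (\<rho> t) x) (at t within {0..T}))"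

definition smooth_Euler_solution ::
    "real \<Rightarrow> (real \<Rightarrow> real^2 \<Rightarrow> real) \<Rightarrow> (real \<Rightarrow> real^2 \<Rightarrow> real) \<Rightarrow> bool" where
  "smooth_Euler_solution T \<rho> \<phi> \<longleftrightarrow>
     smooth_torus_evolution T \<rho> \<and> smooth_torus_evolution T \<phi> \<and>
     transported T \<phi> \<rho> \<and>
     (\<forall>t\<in>{0..T}. (\<forall>x. laplacian (\<phi> t) x = \<rho> t x) \<and> mean_zero (\<rho> t) \<and> mean_zero (\<phi> t))"

definition smooth_Monge_Ampere_solution ::
    "real \<Rightarrow> real \<Rightarrow> (real \<Rightarrow> real^2 \<Rightarrow> real) \<Rightarrow> (real \<Rightarrow> real^2 \<Rightarrow> real) \<Rightarrow> bool" where
  "smooth_Monge_Ampere_solution T \<epsilon> \<rho> \<psi> \<longleftrightarrow>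
     smooth_torus_evolution T \<rho> \<and> smooth_torus_evolution T \<psi> \<and>
     transported T \<psi> \<rho> \<and>
     (\<forall>t\<in>{0..T}. (\<forall>x. det (mat 1 + \<epsilon> *\<^sub>R hessian (\<psi> t) x) = 1 + \<epsilon> * \<rho> t x) \<and>
        mean_zero (\<rho> t) \<and> mean_zero (\<psi> t))"

end

theory Submission
  imports Defs "HOL-Probability.Probability"
begin

text \<open>
  Let \<open>w = \<rho> - \<rho>bar\<close>, solve \<open>\<Delta>h = w\<close> on the torus and put \<open>g = (h - (\<psi> - \<phi>bar)) / \<epsilon>\<close>. The Monge-Ampere
  equation becomes \<open>\<Delta>g = det D\<^sup>2\<psi>\<close>, and since \<open>{h, \<rho>}\<close> is orthogonal to \<open>h\<close>, the energy satisfies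
  \<open>d/dt \<parallel>\<nabla>h\<parallel>\<^sup>2 / 2 \<le> \<parallel>\<nabla>ubar\<parallel>\<^sub>\<infinity> \<parallel>\<nabla>h\<parallel>\<^sup>2 + \<epsilon> \<parallel>\<rho>\<parallel>\<^sub>\<infinity> \<parallel>\<nabla>g\<parallel> \<parallel>\<nabla>h\<parallel>\<close>.
  The norms of \<open>\<rho>\<close> are conserved, Wente's inequality bounds \<open>\<parallel>\<nabla>g\<parallel>\<close> by \<open>\<parallel>D\<^sup>2\<psi>\<parallel>\<^sup>2 = \<parallel>\<Delta>\<psi>\<parallel>\<^sup>2\<close>, and
  \<open>\<parallel>\<Delta>\<psi>\<parallel> \<le> 2 \<parallel>\<rho>\<parallel>\<close> follows from the smallness of \<open>\<epsilon> D\<^sup>2\<psi>\<close>. Gronwall gives \<open>\<parallel>\<nabla>h\<parallel> = O(\<epsilon>)\<close>, so the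
  densities differ by \<open>O(\<epsilon>\<^sup>2)\<close> in \<open>H\<^sup>-\<^sup>1\<close>.

  The distance \<open>W\<^sub>2\<close> is bounded by this norm through Moser's flow along the linear interpolation of the
  densities. No ordinary differential equation is solved: \<open>N\<close> Euler steps of size \<open>1 / N\<close> transport one
  density to the other up to a factor \<open>(1 + K / N\<^sup>2)\<^sup>N\<close>, and the defect vanishes as \<open>N\<close> grows.
\<close>

section \<open>Integration on the torus\<close>

text \<open>The assumption bounds \<open>\<epsilon> D^2 \<psi>\<close>, so a crude estimate of
  \<open>det D^2 \<psi>\<close> in \<open>L^2\<close> costs \<open>1 / \<epsilon>\<close> and loses
  the rate. Uniformly in \<open>\<epsilon>\<close> only \<open>D^2 \<psi>\<close> in
  \<open>L^2\<close> is controlled; the determinant is then merely in \<open>L^1\<close>, which in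
  two dimensions just fails to embed in \<open>H^-1\<close>. Its Jacobian structure, exploited by
  Wente's inequality, closes this gap. The compared quantity is \<open>h\<close> and not
  \<open>\<psi> - \<phi>bar\<close>, because \<open>h\<close> depends linearly on the density
  difference, and pairing with \<open>h\<close> moves every derivative off \<open>\<rho>\<close>,
  whose gradient is not controlled. Three choices keep the tools elementary. Parseval supplies
  uniqueness, symmetry of second derivatives, the \<open>L^2\<close> Hessian identity and Wente's
  inequality. The sup norm of \<open>\<rho>\<close> is propagated by conserved integrals instead of
  characteristics. The potential \<open>h\<close> is chosen separately at each time; the energy is
  nevertheless differentiable, because it is a quadratic form in \<open>w\<close> alone.\<close>

definition lattice_point :: "int \<times> int \<Rightarrow> real^2" where
  "lattice_point k = vector [of_int (fst k), of_int (snd k)]"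

lemma lattice_point_nth [simp]:
  "lattice_point k $ 1 = of_int (fst k)" "lattice_point k $ 2 = of_int (snd k)"
  by (simp_all add: lattice_point_def)

lemma int_lattice_eq: "int_lattice = range lattice_point"
proof (intro equalityI subsetI)
  fix x :: "real^2" assume "x \<in> int_lattice"
  then have "x $ 1 \<in> \<int>" "x $ 2 \<in> \<int>" by (auto simp: int_lattice_def)
  then obtain a b where "x $ 1 = of_int a" "x $ 2 = of_int b" by (meson Ints_cases)
  then have "x = lattice_point (a, b)" by (simp add: vec_eq_iff forall_2)
  then show "x \<in> range lattice_point" by blast
qed (auto simp: int_lattice_def forall_2)

lemma lattice_point_in [simp]: "lattice_point k \<in> int_lattice"
  by (auto simp: int_lattice_eq)

lemma periodicD: "periodic f \<Longrightarrow> f (x + lattice_point k) = f x"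
  by (simp add: periodic_def)

lemma periodic_iff: "periodic f \<longleftrightarrow> (\<forall>x k. f (x + lattice_point k) = f x)"
  by (auto simp: periodic_def int_lattice_eq)

lemma unit_cell_iff: "x \<in> unit_cell \<longleftrightarrow> 0 \<le> x $ 1 \<and> x $ 1 < 1 \<and> 0 \<le> x $ 2 \<and> x $ 2 < 1"
  by (auto simp: unit_cell_def forall_2)

lemma unit_cell_borel [measurable]: "unit_cell \<in> sets borel"
proof -
  have "unit_cell = {x. 0 \<le> x $ 1 \<and> x $ 1 < 1 \<and> 0 \<le> x $ 2 \<and> (x :: real^2) $ 2 < 1}"
    by (auto simp: unit_cell_iff)
  also have "\<dots> \<in> sets borel" by measurable
  finally show ?thesis .
qed

lemma unit_cell_bounds: "box 0 1 \<subseteq> unit_cell" "unit_cell \<subseteq> cbox 0 (1 :: real^2)"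
  by (auto simp: unit_cell_iff mem_box_cart forall_2)

lemma emeasure_unit_cell [simp]: "emeasure lborel unit_cell = 1"
proof (rule antisym)
  have one: "(1 :: real^2) \<bullet> b = 1" if "b \<in> Basis" for b
    using that by (auto simp: Basis_vec_def inner_axis)
  have "emeasure lborel unit_cell \<le> emeasure lborel (cbox 0 (1 :: real^2))"
    by (intro emeasure_mono unit_cell_bounds) auto
  also have "\<dots> = 1" by (subst emeasure_lborel_cbox) (auto simp: one)
  finally show "emeasure lborel unit_cell \<le> 1" .
  have "1 = emeasure lborel (box 0 (1 :: real^2))"
    by (subst emeasure_lborel_box) (auto simp: one)
  also have "\<dots> \<le> emeasure lborel unit_cell"
    by (intro emeasure_mono unit_cell_bounds) auto
  finally show "1 \<le> emeasure lborel unit_cell" .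
qed

lemma space_torus [simp]: "space torus = unit_cell"
  by (simp add: torus_def space_restrict_space)

lemma prob_space_torus: "prob_space torus"
  by (rule prob_spaceI) (simp add: torus_def emeasure_restrict_space space_restrict_space)

interpretation torus: prob_space torus by (rule prob_space_torus)

lemma measurable_torus [measurable (raw)]:
  "f \<in> borel_measurable borel \<Longrightarrow> f \<in> measurable torus N" if "sets N = sets borel" for f
  using that unfolding torus_def by (intro measurable_restrict_space1) (simp cong: measurable_cong_sets)

lemma continuous_borel: "continuous_on UNIV f \<Longrightarrow> f \<in> borel_measurable borel"
  by (rule borel_measurable_continuous_onI)

lemma ex1_lattice_point: "\<exists>!k. x + lattice_point k \<in> unit_cell"
proof
  show "x + lattice_point (- \<lfloor>x $ 1\<rfloor>, - \<lfloor>x $ 2\<rfloor>) \<in> unit_cell"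
    by (simp add: unit_cell_iff) linarith
  fix k assume "x + lattice_point k \<in> unit_cell"
  then show "k = (- \<lfloor>x $ 1\<rfloor>, - \<lfloor>x $ 2\<rfloor>)"
    by (cases k) (simp add: unit_cell_iff, linarith)
qed

lemma nn_integral_torus:
  "f \<in> borel_measurable borel \<Longrightarrow> (\<integral>\<^sup>+x. f x \<partial>torus) = (\<integral>\<^sup>+x. f x * indicator unit_cell x \<partial>lborel)"
  unfolding torus_def by (subst nn_integral_restrict_space) auto

lemma nn_integral_lborel_translate:
  fixes f :: "real^2 \<Rightarrow> ennreal"
  assumes [measurable]: "f \<in> borel_measurable borel"
  shows "(\<integral>\<^sup>+x. f (x + a) \<partial>lborel) = (\<integral>\<^sup>+x. f x \<partial>lborel)"
proof -
  have "(\<integral>\<^sup>+x. f x \<partial>lborel) = (\<integral>\<^sup>+x. f x \<partial>distr lborel borel ((+) a))"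
    by (simp add: lborel_distr_plus)
  also have "\<dots> = (\<integral>\<^sup>+x. f (a + x) \<partial>lborel)"
    by (subst nn_integral_distr) auto
  finally show ?thesis by (simp add: add.commute)
qed

text \<open>Serves to insert a sum over all lattice translates under an integral: exactly one
  translate lands in a fundamental domain.\<close>

lemma nn_integral_ex1:
  assumes "\<exists>!k. P k"
  shows "(\<integral>\<^sup>+k. indicator {k. P k} k \<partial>count_space UNIV) = 1"
proof -
  from assms obtain k where "{k. P k} = {k}" by (auto simp: Ex1_def)
  then show ?thesis by simp
qed

text \<open>Unfolding and folding: the indicators of the translated unit cells sum to 1 and may be
  inserted; Tonelli and a lattice translation move the sum onto \<open>D\<close>, and the tiling
  property of \<open>D\<close> removes it again. Periodicity makes \<open>F\<close> insensitive to
  the shift.\<close>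

lemma nn_integral_fundamental_domain:
  fixes F :: "real^2 \<Rightarrow> ennreal"
  assumes D [measurable]: "D \<in> sets borel" and D1: "\<And>x. \<exists>!k. x + lattice_point k \<in> D"
    and F [measurable]: "F \<in> borel_measurable borel" and per: "periodic F"
  shows "(\<integral>\<^sup>+x. F x * indicator D x \<partial>lborel) = (\<integral>\<^sup>+x. F x \<partial>torus)"
proof -
  have shift: "indicator D y * F y * indicator unit_cell (y + lattice_point k) =
      (\<lambda>x. indicator D (x - lattice_point k) * F x * indicator unit_cell x) (y + lattice_point k)" for y k
    by (simp add: periodicD[OF per])
  have [measurable]: "(\<lambda>x. x - lattice_point k) \<in> borel_measurable borel" for k by measurable
  have neg: "- lattice_point k = lattice_point (- fst k, - snd k)" for k
    by (simp add: vec_eq_iff forall_2)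
  have "(\<integral>\<^sup>+x. F x * indicator D x \<partial>lborel) =
      (\<integral>\<^sup>+x. (\<integral>\<^sup>+k. indicator D x * F x * indicator unit_cell (x + lattice_point k) \<partial>count_space UNIV) \<partial>lborel)"
  proof (rule nn_integral_cong)
    fix x
    have "(\<integral>\<^sup>+k. indicator {k. x + lattice_point k \<in> unit_cell} k \<partial>count_space UNIV) = (1::ennreal)"
      by (rule nn_integral_ex1[OF ex1_lattice_point])
    then show "F x * indicator D x =
      (\<integral>\<^sup>+k. indicator D x * F x * indicator unit_cell (x + lattice_point k) \<partial>count_space UNIV)"
      by (subst nn_integral_cmult) (auto simp: indicator_def mult.commute)
  qed
  also have "\<dots> = (\<integral>\<^sup>+k. (\<integral>\<^sup>+x. indicator D x * F x * indicator unit_cell (x + lattice_point k) \<partial>lborel) \<partial>count_space UNIV)"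
    by (rule nn_integral_count_space_nn_integral) auto
  also have "\<dots> = (\<integral>\<^sup>+k. (\<integral>\<^sup>+x. indicator D (x - lattice_point k) * F x * indicator unit_cell x \<partial>lborel) \<partial>count_space UNIV)"
    unfolding shift by (intro nn_integral_cong nn_integral_lborel_translate) measurable
  also have "\<dots> = (\<integral>\<^sup>+x. (\<integral>\<^sup>+k. indicator D (x - lattice_point k) * F x * indicator unit_cell x \<partial>count_space UNIV) \<partial>lborel)"
    by (rule nn_integral_count_space_nn_integral[symmetric]) auto
  also have "\<dots> = (\<integral>\<^sup>+x. F x * indicator unit_cell x \<partial>lborel)"
  proof (rule nn_integral_cong)
    fix x
    have "\<exists>!k. x - lattice_point k \<in> D"
    proof -
      from D1[of x] obtain k where k: "x + lattice_point k \<in> D"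
        and u: "\<And>j. x + lattice_point j \<in> D \<Longrightarrow> j = k" by blast
      show ?thesis
      proof
        show "x - lattice_point (- fst k, - snd k) \<in> D" using k neg[of k] by (simp flip: neg)
        fix j assume "x - lattice_point j \<in> D"
        then have "x + lattice_point (- fst j, - snd j) \<in> D" by (simp flip: neg)
        from u[OF this] show "j = (- fst k, - snd k)" by (cases j) auto
      qed
    qed
    then have "(\<integral>\<^sup>+k. indicator {k. x - lattice_point k \<in> D} k \<partial>count_space UNIV) = (1::ennreal)"
      by (rule nn_integral_ex1)
    then show "(\<integral>\<^sup>+k. indicator D (x - lattice_point k) * F x * indicator unit_cell x \<partial>count_space UNIV)
       = F x * indicator unit_cell x"
      by (subst mult.assoc, subst nn_integral_multc) (auto simp: indicator_def)
  qed
  finally show ?thesis by (simp add: nn_integral_torus)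
qed

lemma torus_integrable_bounded:
  fixes f :: "real^2 \<Rightarrow> 'b::{banach, second_countable_topology}"
  assumes "f \<in> borel_measurable borel" and "\<And>x. x \<in> unit_cell \<Longrightarrow> norm (f x) \<le> B"
  shows "integrable torus f"
  using assms by (intro torus.integrable_const_bound[where B = B]) auto

lemma torus_integrable_continuous:
  fixes f :: "real^2 \<Rightarrow> 'b::{banach, second_countable_topology}"
  assumes "continuous_on UNIV f"
  shows "integrable torus f"
proof -
  have "compact (f ` cbox 0 1)"
    by (intro compact_continuous_image continuous_on_subset[OF assms]) auto
  from compact_imp_bounded[OF this] obtain B where "\<forall>y\<in>f ` cbox 0 1. norm y \<le> B"
    unfolding bounded_iff ..
  then have "norm (f x) \<le> B" if "x \<in> unit_cell" for x
    using that unit_cell_bounds(2) by blast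
  then show ?thesis
    by (intro torus_integrable_bounded[where B = B] continuous_borel assms)
qed

text \<open>Bridge to the gauge integral, where the Leibniz rule and the vanishing criterion for
  continuous integrands are taken from; the cell and the closed square differ only by a part of the
  boundary.\<close>

lemma integral_torus_eq_integral:
  fixes f :: "real^2 \<Rightarrow> real"
  assumes "continuous_on UNIV f"
  shows "(\<integral>x. f x \<partial>torus) = integral (cbox 0 1) f"
proof -
  have "integrable torus f" by (rule torus_integrable_continuous[OF assms])
  then have *: "set_integrable lborel unit_cell f"
    unfolding torus_def set_integrable_def by (subst (asm) integrable_restrict_space) auto
  have "(\<integral>x. f x \<partial>torus) = (LINT x:unit_cell|lborel. f x)"
    unfolding torus_def set_lebesgue_integral_def by (subst integral_restrict_space) auto
  also have "\<dots> = integral unit_cell f"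
    by (rule set_borel_integral_eq_integral(2)[OF *])
  also have "\<dots> = integral (cbox 0 1) f"
    using unit_cell_bounds
    by (intro integral_subset_negligible[symmetric] negligible_subset[OF negligible_frontier_interval[of 0 1]]
          integral_spike_set negligible_subset[OF negligible_frontier_interval[of 0 1]]) auto
  finally show ?thesis .
qed

text \<open>A homeomorphism that commutes with lattice translations carries the unit cell to another
  fundamental domain, so the classical theorem on the cell combines with
  \<open>nn_integral_fundamental_domain\<close>.\<close>

lemma torus_change_of_variables:
  fixes G :: "real^2 \<Rightarrow> real^2" and F :: "real^2 \<Rightarrow> real"
  assumes der: "\<And>x. (G has_derivative G' x) (at x)"
    and H: "\<And>x. H (G x) = x" "\<And>x. G (H x) = x" "continuous_on UNIV H"
    and G: "\<And>x k. G (x + lattice_point k) = G x + lattice_point k"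
    and F: "F \<in> borel_measurable borel" "periodic F" "\<And>x. 0 \<le> F x" "\<And>x. F x \<le> B"
    and D [measurable]: "(\<lambda>x. det (matrix (G' x))) \<in> borel_measurable borel"
  shows "(\<integral>x. \<bar>det (matrix (G' x))\<bar> * F (G x) \<partial>torus) = (\<integral>x. F x \<partial>torus)"
    and "integrable torus (\<lambda>x. \<bar>det (matrix (G' x))\<bar> * F (G x))"
proof -
  note F(1)[measurable]
  have contG: "continuous_on UNIV G"
    using der by (meson continuous_at_imp_continuous_on has_derivative_continuous)
  have [measurable]: "G \<in> borel_measurable borel" by (rule continuous_borel[OF contG])
  \<comment> \<open>As a preimage under the continuous inverse the image is Borel, and its tiling
    property at \<open>x\<close> becomes that of the unit cell at \<open>H x\<close>.\<close>
  have img: "G ` unit_cell = H -` unit_cell" using H(1,2) by (auto simp: image_iff) metis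
  have Db: "G ` unit_cell \<in> sets borel"
    unfolding img using measurable_sets[OF continuous_borel[OF H(3)] unit_cell_borel] by simp
  have HG: "H (y + lattice_point k) = H y + lattice_point k" for y k
    by (metis G H(1,2))
  have D1: "\<exists>!k. x + lattice_point k \<in> G ` unit_cell" for x
    unfolding img using ex1_lattice_point[of "H x"] by (simp add: HG)
  have FI: "integrable torus F"
    using F(3,4) by (intro torus_integrable_bounded[where B = B] F) auto
  have bdd: "bounded (G ` unit_cell)"
    using bounded_subset[OF compact_imp_bounded[OF compact_continuous_image[OF continuous_on_subset[OF contG] compact_cbox]]]
      unit_cell_bounds(2) by (metis image_mono subset_UNIV)
  have fin: "emeasure lborel (G ` unit_cell) < \<infinity>"
    using emeasure_bounded_finite[OF bdd] by simp
  have SI: "set_integrable lborel (G ` unit_cell) F"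
    unfolding set_integrable_def using F(3,4) fin Db
    by (intro integrableI_bounded_set[where A = "G ` unit_cell" and B = B]) (auto simp: indicator_def)
  have nnF: "(\<integral>\<^sup>+x. ennreal (F x) * indicator (G ` unit_cell) x \<partial>lborel) = (\<integral>\<^sup>+x. ennreal (F x) \<partial>torus)"
    using F(2) by (intro nn_integral_fundamental_domain Db D1) (auto simp: periodic_def)
  have "(LINT x:G ` unit_cell|lborel. F x) = enn2real (\<integral>\<^sup>+x. ennreal (F x) * indicator (G ` unit_cell) x \<partial>lborel)"
    unfolding set_lebesgue_integral_def using F(3) Db
    by (subst integral_eq_nn_integral) (auto intro!: arg_cong[where f = enn2real] nn_integral_cong simp: indicator_def)
  also have "\<dots> = (\<integral>x. F x \<partial>torus)"
    unfolding nnF using F(3) by (subst integral_eq_nn_integral) auto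
  finally have eq1: "(LINT x:G ` unit_cell|lborel. F x) = (\<integral>x. F x \<partial>torus)" .
  \<comment> \<open>\<open>has_absolute_integral_change_of_variables\<close> is stated for
    integrands with values in \<open>real^'n\<close>, so \<open>F\<close> is carried through
    \<open>real^1\<close>.\<close>
  define f :: "real^2 \<Rightarrow> real^1" where "f = (\<lambda>x. vec (F x))"
  have fb: "bounded_linear (vec :: real \<Rightarrow> real^1)"
    by (intro linear_conv_bounded_linear[THEN iffD1] linearI) (auto simp: vec_eq_iff)
  have vec_sc: "vec (c * d) = (c::real) *\<^sub>R (vec d :: real^1)" for c d
    by (simp add: vec_eq_iff)
  have SIf: "set_integrable lborel (G ` unit_cell) f"
    unfolding f_def using integrable_bounded_linear[OF fb SI[unfolded set_integrable_def]]
    by (simp add: set_integrable_def vec_sc)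
  have If: "f absolutely_integrable_on (G ` unit_cell)" and
    intf: "integral (G ` unit_cell) f = vec (\<integral>x. F x \<partial>torus)"
  proof -
    show "f absolutely_integrable_on (G ` unit_cell)"
      using SIf unfolding set_integrable_def by (rule integrable_completion[THEN iffD2, rotated]) (use SIf in \<open>auto simp: set_integrable_def dest: borel_measurable_integrable\<close>)
    have "integral (G ` unit_cell) f = (LINT x:G ` unit_cell|lborel. f x)"
      by (rule set_borel_integral_eq_integral(2)[OF SIf, symmetric])
    also have "\<dots> = vec (LINT x:G ` unit_cell|lborel. F x)"
      unfolding set_lebesgue_integral_def f_def
      using integral_bounded_linear[OF fb SI[unfolded set_integrable_def]]
      by (simp add: vec_sc)
    finally show "integral (G ` unit_cell) f = vec (\<integral>x. F x \<partial>torus)" by (simp add: eq1)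
  qed
  have inj: "inj_on G unit_cell" by (metis H(1) inj_on_inverseI)
  have "(\<lambda>x. \<bar>det (matrix (G' x))\<bar> *\<^sub>R f (G x)) absolutely_integrable_on unit_cell \<and>
     integral unit_cell (\<lambda>x. \<bar>det (matrix (G' x))\<bar> *\<^sub>R f (G x)) = vec (\<integral>x. F x \<partial>torus)"
    using has_absolute_integral_change_of_variables[of unit_cell G G' f "vec (\<integral>x. F x \<partial>torus)"] If intf inj der
    by (auto simp: has_derivative_at_withinI)
  then have A: "(\<lambda>x. \<bar>det (matrix (G' x))\<bar> *\<^sub>R f (G x)) absolutely_integrable_on unit_cell"
    and I: "integral unit_cell (\<lambda>x. \<bar>det (matrix (G' x))\<bar> *\<^sub>R f (G x)) = vec (\<integral>x. F x \<partial>torus)" by auto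
  have bn: "bounded_linear (\<lambda>x::real^1. x $ 1)" by (rule bounded_linear_vec_nth)
  define p where "p = (\<lambda>x. \<bar>det (matrix (G' x))\<bar> * F (G x))"
  have pm [measurable]: "p \<in> borel_measurable borel" unfolding p_def by measurable
  have A1: "p absolutely_integrable_on unit_cell"
    using absolutely_integrable_linear[OF A bn] by (simp add: o_def f_def p_def)
  have I1: "integral unit_cell p = (\<integral>x. F x \<partial>torus)"
    using integral_linear[OF set_lebesgue_integral_eq_integral(1)[OF A] bn] I by (simp add: o_def f_def p_def)
  have SIp: "set_integrable lborel unit_cell p"
    using A1 unfolding set_integrable_def by (subst (asm) integrable_completion) auto
  then show "integrable torus (\<lambda>x. \<bar>det (matrix (G' x))\<bar> * F (G x))"
    unfolding torus_def set_integrable_def p_def by (subst integrable_restrict_space) auto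
  have "(\<integral>x. p x \<partial>torus) = (LINT x:unit_cell|lborel. p x)"
    unfolding torus_def set_lebesgue_integral_def by (subst integral_restrict_space) auto
  also have "\<dots> = integral unit_cell p"
    by (rule set_borel_integral_eq_integral(2)[OF SIp])
  finally show "(\<integral>x. \<bar>det (matrix (G' x))\<bar> * F (G x) \<partial>torus) = (\<integral>x. F x \<partial>torus)"
    using I1 by (simp add: p_def)
qed

lemma bounded_continuous_periodic:
  fixes f :: "real^2 \<Rightarrow> 'b::real_normed_vector"
  assumes "continuous_on UNIV f" "periodic f"
  obtains B where "B > 0" "\<And>x. norm (f x) \<le> B"
proof -
  have "compact (f ` cbox 0 1)"
    by (intro compact_continuous_image continuous_on_subset[OF assms(1)]) auto
  from compact_imp_bounded[OF this] obtain B where B: "B > 0" "\<forall>y\<in>f ` cbox 0 1. norm y \<le> B"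
    unfolding bounded_pos by (elim exE conjE)
  have "norm (f x) \<le> B" for x
  proof -
    obtain k where "x + lattice_point k \<in> unit_cell" using ex1_lattice_point by blast
    then have "norm (f (x + lattice_point k)) \<le> B" using B(2) unit_cell_bounds(2) by blast
    then show ?thesis by (simp add: periodicD[OF assms(2)])
  qed
  with B(1) show thesis by (rule that)
qed

lemma torus_integral_translate:
  fixes f :: "real^2 \<Rightarrow> real"
  assumes c: "continuous_on UNIV f" and p: "periodic f"
  shows "(\<integral>x. f (x + a) \<partial>torus) = (\<integral>x. f x \<partial>torus)"
proof -
  obtain B where B: "\<And>x. norm (f x) \<le> B" using bounded_continuous_periodic[OF assms] by blast
  have fm: "f \<in> borel_measurable borel" by (rule continuous_borel[OF c])
  have m1: "det (matrix (\<lambda>h::real^2. h)) = 1"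
    using matrix_id_mat_1 det_I unfolding id_def by (rule ssubst)
  \<comment> \<open>Adding \<open>B\<close> makes the integrand nonnegative, as the change of
    variables requires; it cancels because the torus has mass 1.\<close>
  have "(\<integral>x. \<bar>det (matrix (\<lambda>h::real^2. h))\<bar> * (f (x + a) + B) \<partial>torus) = (\<integral>x. f x + B \<partial>torus)"
  proof (rule torus_change_of_variables(1)[where G = "\<lambda>x. x + a" and G' = "\<lambda>x h. h" and F = "\<lambda>x. f x + B"
        and H = "\<lambda>x. x - a" and B = "2 * B"])
    show "f x + B \<le> 2 * B" "0 \<le> f x + B" for x using B[of x] by auto
    show "periodic (\<lambda>x. f x + B)" using p by (auto simp: periodic_def)
  qed (auto intro!: derivative_eq_intros continuous_intros borel_measurable_add simp: fm)
  moreover have "integrable torus (\<lambda>x. f (x + a))"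
    by (intro torus_integrable_continuous continuous_on_compose2[OF c] continuous_intros) auto
  moreover have "integrable torus f" by (rule torus_integrable_continuous[OF c])
  ultimately show ?thesis by (simp add: m1 torus.prob_space[simplified])
qed

section \<open>Periodic functions with continuous derivatives\<close>

definition pd :: "2 \<Rightarrow> (real^2 \<Rightarrow> real) \<Rightarrow> real^2 \<Rightarrow> real" where
  "pd i f x = gradient f x $ i"

text \<open>Periodic functions of class \<open>C^n\<close>. Continuity is demanded only at the
  bottom level; above it, differentiability provides it. The recursion through \<open>pd\<close>
  lets closure properties follow by one induction on \<open>n\<close>.\<close>

primrec Ck :: "nat \<Rightarrow> (real^2 \<Rightarrow> real) \<Rightarrow> bool" where
  "Ck 0 f \<longleftrightarrow> periodic f \<and> continuous_on UNIV f"
| "Ck (Suc n) f \<longleftrightarrow> periodic f \<and> (\<forall>x. f differentiable at x) \<and> (\<forall>i. Ck n (pd i f))"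

lemma gradient_nth: "gradient f x $ i = pd i f x"
  by (simp add: pd_def)

lemma pd_eq: "(f has_derivative f') (at x) \<Longrightarrow> pd i f x = f' (axis i 1)"
  by (simp add: pd_def gradient_def frechet_derivative_at[symmetric])

lemma vec2_eq: "(v :: real^2) = v $ 1 *\<^sub>R axis 1 1 + v $ 2 *\<^sub>R axis 2 1"
  by (simp add: vec_eq_iff forall_2 axis_def)

lemma has_derivative_pd:
  assumes "f differentiable at x"
  shows "(f has_derivative (\<lambda>v. v $ 1 * pd 1 f x + v $ 2 * pd 2 f x)) (at x)"
proof -
  have D: "(f has_derivative frechet_derivative f (at x)) (at x)"
    using assms by (simp add: frechet_derivative_works)
  then interpret linear "frechet_derivative f (at x)"
    by (rule has_derivative_linear)
  have "frechet_derivative f (at x) = (\<lambda>v. v $ 1 * pd 1 f x + v $ 2 * pd 2 f x)"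
  proof
    fix v :: "real^2"
    have "frechet_derivative f (at x) v = frechet_derivative f (at x) (v $ 1 *\<^sub>R axis 1 1 + v $ 2 *\<^sub>R axis 2 1)"
      using vec2_eq[of v] by simp
    then show "frechet_derivative f (at x) v = v $ 1 * pd 1 f x + v $ 2 * pd 2 f x"
      by (simp add: add scale pd_def gradient_def)
  qed
  with D show ?thesis by simp
qed

lemma differentiable_if_pd:
  assumes "(f has_derivative (\<lambda>v. v $ 1 * a + v $ 2 * b)) (at x)"
  shows "pd 1 f x = a" "pd 2 f x = b" "f differentiable at x"
  using pd_eq[OF assms, of 1] pd_eq[OF assms, of 2] assms
  by (auto simp: axis_def differentiable_def)

lemma pd_const [simp]: "pd i (\<lambda>x. c) = (\<lambda>x. 0)"
  using pd_eq[of "\<lambda>x. c" "\<lambda>x. 0"] by (simp add: fun_eq_iff)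

lemma frechet_pd: "f differentiable at x \<Longrightarrow> (f has_derivative frechet_derivative f (at x)) (at x)"
  by (simp flip: frechet_derivative_works)

lemma pd_add: "f differentiable at x \<Longrightarrow> g differentiable at x \<Longrightarrow> pd i (\<lambda>x. f x + g x) x = pd i f x + pd i g x"
  by (subst pd_eq[OF has_derivative_add[OF frechet_pd frechet_pd]]) (auto simp: pd_def gradient_def)

lemma pd_diff: "f differentiable at x \<Longrightarrow> g differentiable at x \<Longrightarrow> pd i (\<lambda>x. f x - g x) x = pd i f x - pd i g x"
  by (subst pd_eq[OF has_derivative_diff[OF frechet_pd frechet_pd]]) (auto simp: pd_def gradient_def)

lemma pd_cmult: "f differentiable at x \<Longrightarrow> pd i (\<lambda>x. c * f x) x = c * pd i f x"
  by (subst pd_eq[OF has_derivative_mult_right[OF frechet_pd]]) (auto simp: pd_def gradient_def)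

lemma pd_mult: "f differentiable at x \<Longrightarrow> g differentiable at x \<Longrightarrow>
    pd i (\<lambda>x. f x * g x) x = f x * pd i g x + pd i f x * g x"
  by (subst pd_eq[OF has_derivative_mult[OF frechet_pd frechet_pd]]) (auto simp: pd_def gradient_def)

lemma pd_compose:
  assumes "f differentiable at x" "(F has_real_derivative d) (at (f x))"
  shows "pd i (\<lambda>x. F (f x)) x = d * pd i f x" "(\<lambda>x. F (f x)) differentiable at x"
proof -
  have D: "(f has_derivative frechet_derivative f (at x)) (at x)"
    using assms(1) by (simp add: frechet_derivative_works)
  have *: "((\<lambda>x. F (f x)) has_derivative (\<lambda>v. d * frechet_derivative f (at x) v)) (at x)"
    using has_derivative_compose[OF D assms(2)[unfolded has_field_derivative_def]] by simp
  from pd_eq[OF this] pd_eq[OF D] show "pd i (\<lambda>x. F (f x)) x = d * pd i f x" by simp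
  from * show "(\<lambda>x. F (f x)) differentiable at x" by (auto simp: differentiable_def)
qed

lemma Ck_differentiable: "Ck (Suc n) f \<Longrightarrow> f differentiable at x" by simp
lemma Ck_periodic: "Ck n f \<Longrightarrow> periodic f" by (cases n) auto
lemma Ck_pd: "Ck (Suc n) f \<Longrightarrow> Ck n (pd i f)" by simp

lemma Ck_continuous: "Ck n f \<Longrightarrow> continuous_on UNIV f"
  by (cases n) (auto intro!: continuous_at_imp_continuous_on intro: differentiable_imp_continuous_within)

lemma Ck_Suc_imp: "Ck (Suc n) f \<Longrightarrow> Ck n f"
proof (induction n arbitrary: f)
  case 0 then show ?case using Ck_continuous[OF 0] by simp
next
  case (Suc n)
  have "Ck n (pd i f)" for i using Suc.IH[of "pd i f"] Suc.prems by auto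
  then show ?case using Suc.prems by auto
qed

lemma Ck_le: "m \<le> n \<Longrightarrow> Ck n f \<Longrightarrow> Ck m f"
  by (induction n rule: dec_induct) (auto dest: Ck_Suc_imp simp del: Ck.simps)

lemma Ck_const [simp]: "Ck n (\<lambda>x. c)"
  by (induction n arbitrary: c) (auto simp: periodic_def)

lemma Ck_add: "Ck n f \<Longrightarrow> Ck n g \<Longrightarrow> Ck n (\<lambda>x. f x + g x)"
proof (induction n arbitrary: f g)
  case 0 then show ?case by (auto simp: periodic_def intro: continuous_intros)
next
  case (Suc n)
  have "pd i (\<lambda>x. f x + g x) = (\<lambda>x. pd i f x + pd i g x)" for i
    using Suc.prems by (auto simp: pd_add)
  then show ?case using Suc by (auto simp: periodic_def)
qed

lemma Ck_mult: "Ck n f \<Longrightarrow> Ck n g \<Longrightarrow> Ck n (\<lambda>x. f x * g x)"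
proof (induction n arbitrary: f g)
  case 0 then show ?case by (auto simp: periodic_def intro: continuous_intros)
next
  case (Suc n)
  have "pd i (\<lambda>x. f x * g x) = (\<lambda>x. f x * pd i g x + pd i f x * g x)" for i
    using Suc.prems by (auto simp: pd_mult)
  moreover have "Ck n (\<lambda>x. f x * pd i g x + pd i f x * g x)" for i
    using Suc.prems by (intro Ck_add Suc.IH) (auto intro: Ck_Suc_imp simp del: Ck.simps dest: Ck_pd)
  ultimately show ?case using Suc.prems by (auto simp: periodic_def)
qed

lemma Ck_cmult: "Ck n f \<Longrightarrow> Ck n (\<lambda>x. c * f x)"
  by (rule Ck_mult) auto

lemma Ck_minus: "Ck n f \<Longrightarrow> Ck n (\<lambda>x. - f x)"
  using Ck_cmult[of n f "-1"] by simp

lemma Ck_diff: "Ck n f \<Longrightarrow> Ck n g \<Longrightarrow> Ck n (\<lambda>x. f x - g x)"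
  using Ck_add[of n f "\<lambda>x. - g x"] Ck_minus by simp

lemma Ck_power: "Ck n f \<Longrightarrow> Ck n (\<lambda>x. f x ^ m)"
  by (induction m) (auto intro: Ck_mult)

lemmas Ck_intros = Ck_const Ck_add Ck_mult Ck_minus Ck_diff Ck_power

lemma Ck_compose:
  assumes "Ck 1 f" "\<And>y. (F has_real_derivative F' y) (at y)" "continuous_on UNIV F'"
  shows "Ck 1 (\<lambda>x. F (f x))" "pd i (\<lambda>x. F (f x)) x = F' (f x) * pd i f x"
proof -
  have *: "pd i (\<lambda>x. F (f x)) = (\<lambda>x. F' (f x) * pd i f x)" for i
    using assms(1) by (intro ext pd_compose(1)[OF _ assms(2)]) simp
  then show "pd i (\<lambda>x. F (f x)) x = F' (f x) * pd i f x" by simp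
  have "continuous_on UNIV (\<lambda>x. F' (f x) * pd i f x)" for i
    using assms(1) Ck_continuous[OF assms(1)]
    by (intro continuous_intros continuous_on_compose2[OF assms(3)]) auto
  moreover have "periodic (\<lambda>x. F' (f x) * pd i f x)" for i
    using assms(1) by (auto simp: periodic_def)
  ultimately show "Ck 1 (\<lambda>x. F (f x))"
    using assms(1) pd_compose(2)[OF _ assms(2)] by (simp add: * periodic_def)
qed

lemma Ck_numeral_Suc: "Ck 1 f \<longleftrightarrow> Ck (Suc 0) f" "Ck 2 f \<longleftrightarrow> Ck (Suc (Suc 0)) f"
  by (simp_all only: One_nat_def numeral_2_eq_2)

lemma Ck_1D: "Ck 1 f \<Longrightarrow> f differentiable at x" "Ck 1 f \<Longrightarrow> Ck 0 (pd i f)" "Ck 1 f \<Longrightarrow> Ck 0 f"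
  by (auto simp only: Ck_numeral_Suc intro: Ck_differentiable Ck_pd Ck_Suc_imp)

lemma Ck_2D: "Ck 2 f \<Longrightarrow> f differentiable at x" "Ck 2 f \<Longrightarrow> Ck 1 (pd i f)" "Ck 2 f \<Longrightarrow> Ck 1 f" "Ck 2 f \<Longrightarrow> Ck 0 f"
    "Ck 2 f \<Longrightarrow> Ck 0 (pd i f)" "Ck 2 f \<Longrightarrow> Ck 0 (pd j (pd i f))" "Ck 2 f \<Longrightarrow> pd i f differentiable at x"
  by (auto simp only: Ck_numeral_Suc intro: Ck_differentiable Ck_pd Ck_Suc_imp)

declare Ck.simps [simp del]

lemma Ck_integrable: "Ck n f \<Longrightarrow> integrable torus f"
  by (rule torus_integrable_continuous) (rule Ck_continuous)

section \<open>Differentiation under the integral, integration by parts and Cauchy-Schwarz\<close>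

lemma torus_leibniz:
  fixes F F' :: "real \<Rightarrow> real^2 \<Rightarrow> real"
  assumes D: "\<And>s x. s \<in> {a..b} \<Longrightarrow> ((\<lambda>s. F s x) has_real_derivative F' s x) (at s within {a..b})"
    and F': "continuous_on ({a..b} \<times> UNIV) (\<lambda>(s, x). F' s x)"
    and F: "\<And>s. s \<in> {a..b} \<Longrightarrow> continuous_on UNIV (F s)" and t: "t \<in> {a..b}"
  shows "((\<lambda>s. \<integral>x. F s x \<partial>torus) has_real_derivative (\<integral>x. F' t x \<partial>torus)) (at t within {a..b})"
proof -
  have cF': "continuous_on UNIV (F' t)"
    using continuous_on_compose2[OF F' continuous_on_Pair[OF continuous_on_const continuous_on_id], of t UNIV] t by (auto simp: image_subset_iff)
  have "((\<lambda>s. integral (cbox 0 1) (F s)) has_real_derivative (integral (cbox 0 1) (F' t))) (at t within {a..b})"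
    by (intro leibniz_rule_field_derivative D t integrable_continuous continuous_on_subset[OF F'] continuous_on_subset[OF F]) auto
  then show ?thesis
    unfolding integral_torus_eq_integral[OF cF']
    by (rule has_field_derivative_transform_within[OF _ zero_less_one t])
       (simp add: integral_torus_eq_integral F)
qed

text \<open>This is the derivative of the translation invariance of the integral.\<close>

lemma integral_pd:
  assumes "Ck 1 f"
  shows "(\<integral>x. pd i f x \<partial>torus) = 0"
proof -
  have cont: "continuous_on UNIV f" "continuous_on UNIV (pd i f)" and per: "periodic f"
    and diff: "f differentiable at x" for x
    using Ck_continuous[OF assms] Ck_periodic[OF assms] Ck_1D[OF assms] Ck_continuous[of 0 "pd i f"] by auto
  have D: "((\<lambda>s. f (x + s *\<^sub>R axis i 1)) has_real_derivative pd i f (x + s *\<^sub>R axis i 1)) (at s within {-1..1})" for s x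
  proof -
    have a: "((\<lambda>s. x + s *\<^sub>R axis i 1) has_derivative (\<lambda>h. h *\<^sub>R axis i 1)) (at s within {-1..1})"
      by (auto intro!: derivative_eq_intros)
    from has_derivative_compose[OF a frechet_pd[OF diff]]
    have "((\<lambda>s. f (x + s *\<^sub>R axis i 1)) has_derivative (\<lambda>h. frechet_derivative f (at (x + s *\<^sub>R axis i 1)) (h *\<^sub>R axis i 1))) (at s within {-1..1})" .
    moreover have "frechet_derivative f (at (x + s *\<^sub>R axis i 1)) (h *\<^sub>R axis i 1) = pd i f (x + s *\<^sub>R axis i 1) * h" for h
      using linear_scale[OF linear_frechet_derivative, of f "at (x + s *\<^sub>R axis i 1)" h "axis i 1"] diff
      by (simp add: pd_def gradient_def)
    ultimately show ?thesis by (simp add: has_field_derivative_def)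
  qed
  have "((\<lambda>s. \<integral>x. f (x + s *\<^sub>R axis i 1) \<partial>torus) has_real_derivative (\<integral>x. pd i f (x + 0 *\<^sub>R axis i 1) \<partial>torus)) (at 0 within {-1..1})"
    by (rule torus_leibniz[OF D]) (auto intro!: continuous_intros continuous_on_compose2[OF cont(1)] continuous_on_compose2[OF cont(2)] simp: case_prod_beta)
  then have "((\<lambda>s. \<integral>x. f x \<partial>torus) has_real_derivative (\<integral>x. pd i f x \<partial>torus)) (at 0 within {-1..1})"
    by (simp add: torus_integral_translate[OF cont(1) per])
  then have "((\<lambda>s. \<integral>x. f x \<partial>torus) has_real_derivative (\<integral>x. pd i f x \<partial>torus)) (at 0)"
    by (subst (asm) at_within_interior) auto
  then show ?thesis by (metis DERIV_const DERIV_unique)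
qed

lemma integral_pd_mult:
  assumes "Ck 1 f" "Ck 1 g"
  shows "(\<integral>x. pd i f x * g x \<partial>torus) = - (\<integral>x. f x * pd i g x \<partial>torus)"
proof -
  have "pd i (\<lambda>x. f x * g x) = (\<lambda>x. f x * pd i g x + pd i f x * g x)"
    using assms Ck_1D by (auto simp: pd_mult)
  moreover have "(\<integral>x. pd i (\<lambda>x. f x * g x) x \<partial>torus) = 0"
    by (rule integral_pd) (rule Ck_mult[OF assms])
  ultimately have "(\<integral>x. f x * pd i g x + pd i f x * g x \<partial>torus) = 0" by simp
  moreover have "Ck 0 (\<lambda>x. f x * pd i g x)" "Ck 0 (\<lambda>x. pd i f x * g x)"
    using Ck_1D(2,3)[OF assms(1)] Ck_1D(2,3)[OF assms(2)] by (blast intro: Ck_mult)+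
  ultimately show ?thesis
    by (subst (asm) Bochner_Integration.integral_add) (auto intro: Ck_integrable)
qed

lemma torus_Cauchy_Schwarz:
  fixes f g :: "real^2 \<Rightarrow> real"
  assumes f: "continuous_on UNIV f" and g: "continuous_on UNIV g"
  shows "(\<integral>x. f x * g x \<partial>torus) \<le> sqrt (\<integral>x. (f x)\<^sup>2 \<partial>torus) * sqrt (\<integral>x. (g x)\<^sup>2 \<partial>torus)"
proof -
  let ?A = "\<integral>x. (f x)\<^sup>2 \<partial>torus" and ?B = "\<integral>x. (g x)\<^sup>2 \<partial>torus" and ?C = "\<integral>x. f x * g x \<partial>torus"
  have [simp]: "integrable torus (\<lambda>x. (f x)\<^sup>2)" "integrable torus (\<lambda>x. (g x)\<^sup>2)" "integrable torus (\<lambda>x. f x * g x)"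
    by (auto intro!: torus_integrable_continuous continuous_intros f g)
  have ab: "2 * a * b * ?C \<le> a\<^sup>2 * ?A + b\<^sup>2 * ?B" for a b
  proof -
    have "0 \<le> (\<integral>x. (a * f x - b * g x)\<^sup>2 \<partial>torus)" by (rule integral_nonneg_AE) auto
    also have "\<dots> = (\<integral>x. a\<^sup>2 * (f x)\<^sup>2 + b\<^sup>2 * (g x)\<^sup>2 - 2 * a * b * (f x * g x) \<partial>torus)"
      by (intro Bochner_Integration.integral_cong) (auto simp: power2_eq_square algebra_simps)
    also have "\<dots> = a\<^sup>2 * ?A + b\<^sup>2 * ?B - 2 * a * b * ?C" by simp
    finally show ?thesis by simp
  qed
  have A0: "0 \<le> ?A" and B0: "0 \<le> ?B" by (auto intro!: integral_nonneg_AE)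
  show ?thesis
  proof (cases "?C \<le> 0")
    case True
    have "0 \<le> sqrt ?A * sqrt ?B" using A0 B0 by simp
    with True show ?thesis by linarith
  next
    case False
    have "?C\<^sup>2 \<le> ?A * ?B"
    proof (cases "?B = 0")
      case True
      \<comment> \<open>For \<open>?B = 0\<close> this choice of \<open>b\<close> turns
        \<open>ab\<close> into \<open>2 (?A + 1) <= ?A\<close>, which is absurd, so the case is
        vacuous.\<close>
      have "?A * (2 * ?C) \<le> ?A * 0 \<or> ?A = 0" using ab[of "1" "(?A + 1) / ?C"] True False by (simp add: field_simps)
      moreover have "?A \<noteq> 0 \<Longrightarrow> ?A > 0" using A0 by linarith
      ultimately have "?A = 0" using False A0 by (auto simp: mult_le_0_iff)
      then show ?thesis using ab[of 1 1] True False by simp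
    next
      case False
      then have "?B > 0" using B0 by linarith
      \<comment> \<open>Up to scale these weights minimise the quadratic form:
        \<open>(?C / ?B) g\<close> is the projection of \<open>f\<close> onto
        \<open>g\<close>.\<close>
      have "2 * ?B * ?C * ?C \<le> ?B * (?B * ?A) + ?C * ?C * ?B" using ab[of "?B" "?C"] by (simp add: power2_eq_square algebra_simps)
      then have "?B * (?C * ?C) \<le> ?B * (?A * ?B)" by (simp add: algebra_simps)
      then show ?thesis using \<open>?B > 0\<close> by (simp add: power2_eq_square)
    qed
    then have "sqrt (?C\<^sup>2) \<le> sqrt (?A * ?B)" by (rule real_sqrt_le_mono)
    then show ?thesis using False by (simp add: real_sqrt_mult)
  qed
qed

text \<open>Continuity turns vanishing almost everywhere into vanishing everywhere. Uniqueness of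
  Fourier coefficients, the maximum principle and the pointwise meaning of \<open>Linf_norm\<close>
  all rest on it.\<close>

lemma torus_integral_nonneg_eq_0:
  fixes f :: "real^2 \<Rightarrow> real"
  assumes f: "continuous_on UNIV f" "periodic f" "\<And>x. 0 \<le> f x" and 0: "(\<integral>x. f x \<partial>torus) = 0"
  shows "f x = 0"
proof -
  have "(f has_integral 0) (cbox 0 1)"
    using integrable_integral[OF integrable_continuous[OF continuous_on_subset[OF f(1)]], of 0 1]
      integral_torus_eq_integral[OF f(1)] 0 by simp
  then have *: "f x = 0" if "x \<in> cbox 0 1" for x
    using has_integral_0_cbox_imp_0[of 0 1 f x] that f continuous_on_subset[OF f(1)]
    by (auto simp: mem_box_cart box_ne_empty Basis_vec_def inner_axis)
  obtain k where "x + lattice_point k \<in> unit_cell" using ex1_lattice_point by blast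
  then have "f (x + lattice_point k) = 0" using * unit_cell_bounds(2) by blast
  then show ?thesis by (simp add: periodicD[OF f(2)])
qed

section \<open>Fourier series and the Parseval identity\<close>

definition cper :: "(real^2 \<Rightarrow> 'a::topological_space) \<Rightarrow> bool" where
  "cper f \<longleftrightarrow> continuous_on UNIV f \<and> periodic f"

lemma cper_intros [intro]:
  "cper (\<lambda>x. c)"
  "cper f \<Longrightarrow> cper g \<Longrightarrow> cper (\<lambda>x. f x + g x :: 'a :: real_normed_field)"
  "cper f \<Longrightarrow> cper g \<Longrightarrow> cper (\<lambda>x. f x * g x)"
  "cper f \<Longrightarrow> cper g \<Longrightarrow> cper (\<lambda>x. f x - g x)"
  by (auto simp: cper_def periodic_def intro: continuous_intros)

lemma cper_sum: "(\<And>k. k \<in> K \<Longrightarrow> cper (f k)) \<Longrightarrow> cper (\<lambda>x. \<Sum>k\<in>K. f k x :: 'a :: real_normed_field)"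
  by (auto simp: cper_def periodic_def intro: continuous_intros)

lemma cper_of_real: "Ck n f \<Longrightarrow> cper (\<lambda>x. complex_of_real (f x))"
  using Ck_continuous[of n f] Ck_periodic[of n f] by (auto simp: cper_def periodic_def intro: continuous_intros)

lemma cper_integrable: "cper f \<Longrightarrow> integrable torus f" for f :: "real^2 \<Rightarrow> 'b::{banach, second_countable_topology}"
  by (simp add: cper_def torus_integrable_continuous)

definition phase :: "int \<times> int \<Rightarrow> real^2 \<Rightarrow> real" where
  "phase k x = 2 * pi * (of_int (fst k) * x $ 1 + of_int (snd k) * x $ 2)"

definition character :: "int \<times> int \<Rightarrow> real^2 \<Rightarrow> complex" where
  "character k x = cis (phase k x)"

lemma character_simps [simp]:
  "character 0 x = 1" "norm (character k x) = 1"
  "cnj (character k x) = character (- k) x" "cnj (character k x) * character k x = 1"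
  "character k x * character (- k) x = 1" "character (- k) x * character k x = 1"
  by (simp_all add: character_def phase_def cis_cnj cis_mult algebra_simps)

lemma character_add: "character (j + k) x = character j x * character k x"
  by (simp add: character_def phase_def cis_mult algebra_simps)

lemma character_translate: "character k (x + a) = character k x * character k a"
  by (simp add: character_def phase_def cis_mult algebra_simps)

lemma character_lattice: "character k (lattice_point j) = 1"
proof -
  have "phase k (lattice_point j) = 2 * pi * of_int (fst k * fst j + snd k * snd j)"
    by (simp add: phase_def)
  then show ?thesis using cis_multiple_2pi[OF Ints_of_int] by (simp add: character_def)
qed

lemma cper_character [intro, simp]: "cper (character k)"
  unfolding cper_def
proof
  show "continuous_on UNIV (character k)"
    unfolding character_def phase_def by (intro continuous_intros)
  show "periodic (character k)"
    by (simp add: periodic_iff character_translate character_lattice)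
qed

text \<open>Translating by half a period in a coordinate of nonzero frequency flips the sign of the
  character, while the integral is invariant. Real and imaginary parts are separated because the
  invariance was proved for real functions.\<close>

lemma integral_character: "(\<integral>x. character k x \<partial>torus) = (if k = 0 then 1 else 0)"
proof (cases "k = 0")
  case True
  then show ?thesis by (simp add: torus.prob_space[simplified])
next
  case False
  define a where "a = (vector [if fst k = 0 then 0 else 1 / (2 * of_int (fst k)), if fst k \<noteq> 0 then 0 else 1 / (2 * of_int (snd k))] :: real^2)"
  have "phase k a = pi"
    using False by (cases "fst k = 0"; cases k) (auto simp: phase_def a_def zero_prod_def)
  then have a: "character k a = -1" by (simp add: character_def)
  have re: "Re (character k x) = - Re (character k (x + a))" "Im (character k x) = - Im (character k (x + a))" for x
    by (simp_all add: character_translate a)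
  have cont: "continuous_on UNIV (\<lambda>x. Re (character k x))" "continuous_on UNIV (\<lambda>x. Im (character k x))"
    and per: "periodic (\<lambda>x. Re (character k x))" "periodic (\<lambda>x. Im (character k x))"
    using cper_character[of k] by (auto simp: cper_def periodic_def intro!: continuous_intros)
  have "(\<integral>x. Re (character k x) \<partial>torus) = - (\<integral>x. Re (character k x) \<partial>torus)"
    using torus_integral_translate[OF cont(1) per(1), of a] by (simp add: re(1)[symmetric] character_translate a)
  moreover have "(\<integral>x. Im (character k x) \<partial>torus) = - (\<integral>x. Im (character k x) \<partial>torus)"
    using torus_integral_translate[OF cont(2) per(2), of a] by (simp add: re(2)[symmetric] character_translate a)
  moreover have "integrable torus (character k)" by (intro cper_integrable cper_character)
  ultimately show ?thesis using False
    by (intro complex_eqI) (simp_all flip: integral_Re integral_Im)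
qed

definition fc :: "(real^2 \<Rightarrow> complex) \<Rightarrow> int \<times> int \<Rightarrow> complex" where
  "fc f k = (\<integral>x. f x * character (- k) x \<partial>torus)"

lemma fc_add: "cper f \<Longrightarrow> cper g \<Longrightarrow> fc (\<lambda>x. f x + g x) k = fc f k + fc g k"
  unfolding fc_def
  by (subst Bochner_Integration.integral_add[symmetric]) (auto intro!: cper_integrable simp: ring_distribs)

lemma fc_diff: "cper f \<Longrightarrow> cper g \<Longrightarrow> fc (\<lambda>x. f x - g x) k = fc f k - fc g k"
  unfolding fc_def
  by (subst Bochner_Integration.integral_diff[symmetric]) (auto intro!: cper_integrable simp: ring_distribs)

lemma fc_cmult: "fc (\<lambda>x. c * f x) k = c * fc f k"
  by (simp add: fc_def mult.assoc)

lemma fc_character: "fc (character j) k = (if k = j then 1 else 0)"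
  by (simp add: fc_def character_add[symmetric] integral_character)

lemma fc_0: "fc f 0 = (\<integral>x. f x \<partial>torus)" by (simp add: fc_def)

definition fsum :: "(real^2 \<Rightarrow> complex) \<Rightarrow> (int \<times> int) set \<Rightarrow> real^2 \<Rightarrow> complex" where
  "fsum f K x = (\<Sum>k\<in>K. fc f k * character k x)"

lemma cper_fsum: "cper (fsum f K)"
  unfolding fsum_def by (intro cper_sum cper_intros cper_character)

lemma fc_fsum: "finite K \<Longrightarrow> fc (fsum f K) k = (if k \<in> K then fc f k else 0)"
proof (induction K rule: finite_induct)
  case empty then show ?case by (simp add: fsum_def fc_def)
next
  case (insert j K)
  then have "fsum f (insert j K) = (\<lambda>x. fc f j * character j x + fsum f K x)"
    by (auto simp: fsum_def)
  then show ?case using insert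
    by (auto simp: fc_add fc_cmult fc_character cper_fsum cper_intros)
qed

text \<open>One application of Pythagoras. Removing modes one at a time gives the Bessel identity
  below by induction, without expanding a double sum: the coefficient at a new mode is not affected
  by the earlier removals.\<close>

lemma remove_character:
  assumes "cper g"
  shows "(\<integral>x. (cmod (g x - fc g j * character j x))\<^sup>2 \<partial>torus) = (\<integral>x. (cmod (g x))\<^sup>2 \<partial>torus) - (cmod (fc g j))\<^sup>2"
proof -
  let ?c = "fc g j"
  have [simp]: "integrable torus (\<lambda>x. (cmod (g x))\<^sup>2)"
    using assms by (intro torus_integrable_continuous) (auto simp: cper_def intro!: continuous_intros)
  have i: "integrable torus (\<lambda>x. g x * character (- j) x)"
    using assms by (intro cper_integrable) auto
  have i2 [simp]: "integrable torus (\<lambda>x. Re (cnj ?c * (g x * character (- j) x)))"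
    by (intro integrable_Re integrable_mult_right i)
  have expand: "(cmod (g x - ?c * character j x))\<^sup>2 = (cmod (g x))\<^sup>2 - 2 * Re (cnj ?c * (g x * character (- j) x)) + (cmod ?c)\<^sup>2" for x
  proof -
    have "complex_of_real ((cmod (g x - ?c * character j x))\<^sup>2) = (g x - ?c * character j x) * cnj (g x - ?c * character j x)"
      by (rule complex_norm_square)
    also have "\<dots> = g x * cnj (g x) - (cnj ?c * (g x * character (- j) x) + cnj (cnj ?c * (g x * character (- j) x))) + ?c * cnj ?c * (character j x * character (- j) x)"
      by (simp add: algebra_simps del: character_simps(4-6))
    also have "\<dots> = of_real ((cmod (g x))\<^sup>2) - of_real (2 * Re (cnj ?c * (g x * character (- j) x))) + of_real ((cmod ?c)\<^sup>2)"
      by (simp only: complex_add_cnj complex_norm_square character_simps(5) mult_1_right)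
    finally show ?thesis by (simp only: of_real_add[symmetric] of_real_diff[symmetric] of_real_eq_iff)
  qed
  have "(\<integral>x. (cmod (g x - ?c * character j x))\<^sup>2 \<partial>torus) =
      (\<integral>x. (cmod (g x))\<^sup>2 \<partial>torus) - 2 * (\<integral>x. Re (cnj ?c * (g x * character (- j) x)) \<partial>torus) + (cmod ?c)\<^sup>2"
    unfolding expand by (simp add: torus.prob_space[simplified] del: times_complex.sel)
  also have "(\<integral>x. Re (cnj ?c * (g x * character (- j) x)) \<partial>torus) = Re (cnj ?c * ?c)"
    by (subst integral_Re) (auto simp: fc_def intro!: integrable_mult_right[OF i])
  also have "\<dots> = (cmod ?c)\<^sup>2"
    by (metis Re_complex_of_real complex_norm_square mult.commute)
  finally show ?thesis by simp
qed

lemma integral_norm_remainder: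
  assumes "finite K" "cper f"
  shows "(\<integral>x. (cmod (f x - fsum f K x))\<^sup>2 \<partial>torus) = (\<integral>x. (cmod (f x))\<^sup>2 \<partial>torus) - (\<Sum>k\<in>K. (cmod (fc f k))\<^sup>2)"
  using assms(1)
proof (induction K rule: finite_induct)
  case empty then show ?case by (simp add: fsum_def)
next
  case (insert j K)
  have cp: "cper (\<lambda>x. f x - fsum f K x)" using assms(2) cper_fsum by auto
  have fcj: "fc (\<lambda>x. f x - fsum f K x) j = fc f j"
    using insert assms(2) by (simp add: fc_diff cper_fsum fc_fsum)
  have eq: "f x - fsum f (insert j K) x = f x - fsum f K x - fc f j * character j x" for x
    using insert by (simp add: fsum_def)
  show ?case unfolding eq using remove_character[OF cp, of j] insert by (simp add: fcj)
qed

section \<open>Trigonometric approximation and Parseval's identity\<close>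

inductive trig :: "(real^2 \<Rightarrow> complex) \<Rightarrow> bool" where
  char: "trig (\<lambda>x. c * character k x)"
| add: "trig f \<Longrightarrow> trig g \<Longrightarrow> trig (\<lambda>x. f x + g x)"

lemma trig_const: "trig (\<lambda>x. c)"
  using trig.char[of c 0] by simp

lemma trig_mult: "trig f \<Longrightarrow> trig g \<Longrightarrow> trig (\<lambda>x. f x * g x)"
proof (induction rule: trig.induct)
  case (char c k)
  from char(1) show ?case
  proof (induction rule: trig.induct)
    case (char d j)
    then show ?case using trig.char[of "c * d" "k + j"] by (simp add: character_add algebra_simps)
  qed (simp add: trig.add distrib_left)
qed (simp add: trig.add distrib_right)

lemma trig_cmult: "trig f \<Longrightarrow> trig (\<lambda>x. c * f x)"
  by (rule trig_mult[OF trig_const])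

lemma trig_cper: "trig f \<Longrightarrow> cper f"
  by (induction rule: trig.induct) auto

text \<open>Exact reproduction from some finite set of frequencies on is what turns uniform
  approximation into convergence along the net of finite sets.\<close>

lemma trig_fsum:
  "trig f \<Longrightarrow> \<exists>K. finite K \<and> (\<forall>L. finite L \<longrightarrow> K \<subseteq> L \<longrightarrow> (\<forall>x. fsum f L x = f x))"
proof (induction rule: trig.induct)
  case (char c k)
  have "fsum (\<lambda>x. c * character k x) L x = (\<Sum>j\<in>L. if j = k then c * character k x else 0)" for L x
    unfolding fsum_def by (intro sum.cong) (auto simp: fc_cmult fc_character)
  then show ?case by (intro exI[of _ "{k}"]) auto
next
  case (add f g)
  then obtain K L where K: "finite K" "\<And>M. finite M \<Longrightarrow> K \<subseteq> M \<Longrightarrow> (\<forall>x. fsum f M x = f x)"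
    and L: "finite L" "\<And>M. finite M \<Longrightarrow> L \<subseteq> M \<Longrightarrow> (\<forall>x. fsum g M x = g x)" by metis
  have "fsum (\<lambda>x. f x + g x) M x = fsum f M x + fsum g M x" for M x
    using add.hyps by (simp add: fsum_def fc_add trig_cper distrib_right sum.distrib)
  then show ?case using K L by (intro exI[of _ "K \<union> L"]) auto
qed

text \<open>The torus as a compact subset of a Euclidean space, where Stone-Weierstrass applies;
  polynomials in the coordinates pull back to trigonometric polynomials.\<close>

definition torus_map :: "real^2 \<Rightarrow> complex \<times> complex" where
  "torus_map x = (cis (2 * pi * x $ 1), cis (2 * pi * x $ 2))"

lemma torus_map_eq_imp:
  assumes "torus_map x = torus_map y"
  obtains k where "x = y + lattice_point k"
proof -
  have *: "\<exists>n::int. a = b + of_int n" if "cis (2 * pi * a) = cis (2 * pi * b)" for a b :: real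
  proof -
    have "sin (2 * pi * a) = sin (2 * pi * b)" "cos (2 * pi * a) = cos (2 * pi * b)"
      using that by (auto simp: complex_eq_iff)
    then obtain n :: int where "2 * pi * a = 2 * pi * b + 2 * pi * of_int n"
      using sin_cos_eq_iff by metis
    then have "2 * pi * a = 2 * pi * (b + of_int n)" by (simp add: algebra_simps)
    then have "a = b + of_int n" by simp
    then show ?thesis ..
  qed
  obtain m n :: int where "x $ 1 = y $ 1 + of_int m" "x $ 2 = y $ 2 + of_int n"
    using assms *[of "x $ 1" "y $ 1"] *[of "x $ 2" "y $ 2"] by (auto simp: torus_map_def)
  then have "x = y + lattice_point (m, n)" by (simp add: vec_eq_iff forall_2)
  then show thesis by (rule that)
qed

lemma torus_map_image: "torus_map ` cbox 0 1 = sphere 0 1 \<times> sphere 0 1"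
proof (intro equalityI subsetI)
  fix z assume "z \<in> sphere (0 :: complex) 1 \<times> sphere (0 :: complex) 1"
  then obtain u v where z: "z = (u, v)" "cmod u = 1" "cmod v = 1" by auto
  have *: "\<exists>a. 0 \<le> a \<and> a \<le> 1 \<and> cis (2 * pi * a) = w" if "cmod w = 1" for w
  proof -
    have "w = cis (Arg2pi w)" using that Arg2pi_eq[of w] by (simp add: cis_conv_exp mult.commute)
    then show ?thesis using Arg2pi_ge_0[of w] Arg2pi_lt_2pi[of w]
      by (intro exI[of _ "Arg2pi w / (2 * pi)"]) (auto simp: field_simps)
  qed
  obtain a b where ab: "0 \<le> a" "a \<le> 1" "cis (2 * pi * a) = u" "0 \<le> b" "b \<le> 1" "cis (2 * pi * b) = v"
    using *[OF z(2)] *[OF z(3)] by auto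
  then show "z \<in> torus_map ` cbox 0 1"
    by (intro image_eqI[of _ _ "vector [a, b]"]) (auto simp: torus_map_def z mem_box_cart forall_2)
qed (auto simp: torus_map_def)

lemma continuous_torus_map: "continuous_on A torus_map"
  unfolding torus_map_def by (intro continuous_intros)

lemma trig_torus_map:
  assumes "real_polynomial_function g"
  shows "trig (\<lambda>x. complex_of_real (g (torus_map x)))"
  using assms
proof (induction rule: real_polynomial_function.induct)
  case (linear f)
  interpret bounded_linear f by (rule linear)
  \<comment> \<open>Euler's formulas for the cosine and sine of each coordinate. As \<open>f\<close>
    is only real linear, its values at \<open>1\<close> and at \<open>\<i>\<close> enter
    separately.\<close>
  have eq: "complex_of_real (f (torus_map x)) =
     ((f (1, 0) - \<i> * f (\<i>, 0)) / 2 * character (1, 0) x + (f (1, 0) + \<i> * f (\<i>, 0)) / 2 * character (-1, 0) x) +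
     ((f (0, 1) - \<i> * f (0, \<i>)) / 2 * character (0, 1) x + (f (0, 1) + \<i> * f (0, \<i>)) / 2 * character (0, -1) x)" for x
  proof -
    have "torus_map x = cos (2 * pi * x $ 1) *\<^sub>R (1, 0) + sin (2 * pi * x $ 1) *\<^sub>R (\<i>, 0) +
       cos (2 * pi * x $ 2) *\<^sub>R (0, 1) + sin (2 * pi * x $ 2) *\<^sub>R (0, \<i>)"
      by (simp add: torus_map_def complex_eq_iff)
    then have "f (torus_map x) = cos (2 * pi * x $ 1) * f (1, 0) + sin (2 * pi * x $ 1) * f (\<i>, 0) +
       cos (2 * pi * x $ 2) * f (0, 1) + sin (2 * pi * x $ 2) * f (0, \<i>)"
      by (simp only: add scaleR real_scaleR_def)
    then show ?thesis
      by (simp add: complex_eq_iff character_def phase_def) (simp add: field_simps)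
  qed
  show ?case unfolding eq by (intro trig.intros)
next
  case (const c) then show ?case by (rule trig_const)
qed (simp_all add: trig.add trig_mult)

lemma trig_approximation_real:
  fixes f :: "real^2 \<Rightarrow> real"
  assumes f: "continuous_on UNIV f" "periodic f" and "e > 0"
  obtains p where "trig p" "\<And>x. cmod (of_real (f x) - p x) < e"
proof -
  define S where "S = sphere (0::complex) 1 \<times> sphere (0::complex) 1"
  define F where "F z = f (SOME x. torus_map x = z)" for z
  have F: "F (torus_map x) = f x" for x
  proof -
    have "torus_map (SOME y. torus_map y = torus_map x) = torus_map x" by (rule someI[of _ x]) simp
    then show ?thesis unfolding F_def by (metis torus_map_eq_imp periodicD[OF f(2)])
  qed
  have "compact S" unfolding S_def by (intro compact_Times) auto
  moreover have "continuous_on S F"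
    \<comment> \<open>\<open>torus_map\<close> on the closed square is a quotient map: the preimage
      of a closed set under \<open>F\<close> is the image of a compact set, hence closed.\<close>
    unfolding continuous_on_closed_invariant
  proof (intro allI impI)
    fix B :: "real set" assume "closed B"
    have "compact (cbox 0 1 \<inter> f -` B)"
      using f(1) \<open>closed B\<close> by (intro compact_Int_closed compact_cbox closed_vimage) auto
    then have "compact (torus_map ` (cbox 0 1 \<inter> f -` B))"
      by (intro compact_continuous_image continuous_torus_map)
    moreover have "torus_map ` (cbox 0 1 \<inter> f -` B) \<inter> S = F -` B \<inter> S"
      unfolding S_def torus_map_image[symmetric] by (auto simp: F)
    ultimately show "\<exists>A. closed A \<and> A \<inter> S = F -` B \<inter> S" using compact_imp_closed by blast
  qed
  ultimately obtain g where g: "real_polynomial_function g" "\<And>z. z \<in> S \<Longrightarrow> \<bar>F z - g z\<bar> < e"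
    using Stone_Weierstrass_real_polynomial_function \<open>e > 0\<close> by blast
  have "cmod (of_real (f x) - of_real (g (torus_map x))) < e" for x
    using g(2)[of "torus_map x", unfolded F] by (simp add: S_def torus_map_def flip: of_real_diff)
  then show thesis using that[OF trig_torus_map[OF g(1)]] by blast
qed

lemma trig_approximation:
  assumes f: "cper f" and "e > 0"
  obtains p where "trig p" "\<And>x. cmod (f x - p x) < e"
proof -
  have "continuous_on UNIV (\<lambda>x. Re (f x))" "periodic (\<lambda>x. Re (f x))"
    "continuous_on UNIV (\<lambda>x. Im (f x))" "periodic (\<lambda>x. Im (f x))"
    using f by (auto simp: cper_def periodic_def intro: continuous_intros)
  then obtain p q where p: "trig p" "\<And>x. cmod (of_real (Re (f x)) - p x) < e / 2"
    and q: "trig q" "\<And>x. cmod (of_real (Im (f x)) - q x) < e / 2"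
    using trig_approximation_real \<open>e > 0\<close> half_gt_zero by metis
  have "cmod (f x - (p x + \<i> * q x)) < e" for x
  proof -
    have "f x - (p x + \<i> * q x) = (of_real (Re (f x)) - p x) + \<i> * (of_real (Im (f x)) - q x)"
      by (simp add: complex_eq_iff)
    also have "cmod \<dots> \<le> cmod (of_real (Re (f x)) - p x) + cmod (of_real (Im (f x)) - q x)"
      by (metis norm_triangle_ineq norm_mult norm_ii mult_1)
    finally show ?thesis using p(2)[of x] q(2)[of x] by simp
  qed
  moreover have "trig (\<lambda>x. p x + \<i> * q x)" by (intro trig.add trig_cmult p q)
  ultimately show thesis using that by blast
qed

text \<open>A partial sum containing the frequencies of a uniform approximation \<open>p\<close>
  reproduces \<open>p\<close>, so the remainder of \<open>f\<close> is the remainder of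
  \<open>f - p\<close>, and by the Bessel identity its norm does not exceed that of
  \<open>f - p\<close>.\<close>

theorem Parseval_norm:
  assumes f: "cper f"
  shows "((\<lambda>k. (cmod (fc f k))\<^sup>2) has_sum (\<integral>x. (cmod (f x))\<^sup>2 \<partial>torus)) UNIV"
  unfolding has_sum_def
proof (rule tendstoI)
  fix e :: real assume "e > 0"
  define d where "d = sqrt (e / 2)"
  have d: "d > 0" "d\<^sup>2 < e" using \<open>e > 0\<close> by (auto simp: d_def)
  obtain p where p: "trig p" "\<And>x. cmod (f x - p x) < d" using trig_approximation[OF f d(1)] by blast
  obtain K where K: "finite K" "\<And>L x. finite L \<Longrightarrow> K \<subseteq> L \<Longrightarrow> fsum p L x = p x"
    using trig_fsum[OF p(1)] by (elim exE conjE) (rule that, assumption, simp)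
  have cp: "cper (\<lambda>x. f x - p x)" using f trig_cper[OF p(1)] by auto
  have "\<bar>(\<Sum>k\<in>L. (cmod (fc f k))\<^sup>2) - (\<integral>x. (cmod (f x))\<^sup>2 \<partial>torus)\<bar> < e" if L: "finite L" "K \<subseteq> L" for L
  proof -
    have "fsum (\<lambda>x. f x - p x) L x = fsum f L x - p x" for x
      using f trig_cper[OF p(1)] K(2)[OF L, of x]
      by (simp add: fsum_def fc_diff left_diff_distrib sum_subtractf)
    then have eq: "f x - fsum f L x = (f x - p x) - fsum (\<lambda>x. f x - p x) L x" for x by simp
    have "(\<integral>x. (cmod (f x))\<^sup>2 \<partial>torus) - (\<Sum>k\<in>L. (cmod (fc f k))\<^sup>2) = (\<integral>x. (cmod (f x - fsum f L x))\<^sup>2 \<partial>torus)"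
      by (simp add: integral_norm_remainder L f)
    also have "\<dots> = (\<integral>x. (cmod (f x - p x))\<^sup>2 \<partial>torus) - (\<Sum>k\<in>L. (cmod (fc (\<lambda>x. f x - p x) k))\<^sup>2)"
      unfolding eq by (rule integral_norm_remainder[OF L(1) cp])
    also have "\<dots> \<le> (\<integral>x. (cmod (f x - p x))\<^sup>2 \<partial>torus)" by (simp add: sum_nonneg)
    also have "\<dots> \<le> (\<integral>x. d\<^sup>2 \<partial>torus)"
      using cp p(2) by (intro integral_mono torus_integrable_continuous)
        (auto simp: cper_def less_imp_le intro!: continuous_intros power_mono)
    also have "\<dots> < e" using d by (simp add: torus.prob_space[simplified])
    finally have "(\<integral>x. (cmod (f x))\<^sup>2 \<partial>torus) - (\<Sum>k\<in>L. (cmod (fc f k))\<^sup>2) < e" .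
    moreover have "0 \<le> (\<integral>x. (cmod (f x - fsum f L x))\<^sup>2 \<partial>torus)" by (intro integral_nonneg_AE) auto
    ultimately show ?thesis using integral_norm_remainder[OF L(1) f] by simp
  qed
  then show "\<forall>\<^sub>F L in finite_subsets_at_top UNIV. dist (\<Sum>k\<in>L. (cmod (fc f k))\<^sup>2) (\<integral>x. (cmod (f x))\<^sup>2 \<partial>torus) < e"
    using K(1) by (auto simp: eventually_finite_subsets_at_top dist_real_def)
qed

text \<open>Each square has the uniform shape \<open>a + c * b\<close> with its weight in front, so
  that \<open>Parseval_norm\<close> for \<open>f + c * g\<close> applies term by term both to the
  integrals and to the coefficients.\<close>

lemma polarization:
  "4 * (a * cnj b) = of_real ((cmod (a + 1 * b))\<^sup>2) + (-1) * of_real ((cmod (a + (-1) * b))\<^sup>2)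
     + \<i> * of_real ((cmod (a + \<i> * b))\<^sup>2) + (- \<i>) * of_real ((cmod (a + (- \<i>) * b))\<^sup>2)"
  unfolding complex_norm_square by (simp add: algebra_simps)

theorem Parseval:
  assumes f: "cper f" and g: "cper g"
  shows "((\<lambda>k. fc f k * cnj (fc g k)) has_sum (\<integral>x. f x * cnj (g x) \<partial>torus)) UNIV"
proof -
  have *: "((\<lambda>k. complex_of_real ((cmod (fc f k + c * fc g k))\<^sup>2)) has_sum (\<integral>x. complex_of_real ((cmod (f x + c * g x))\<^sup>2) \<partial>torus)) UNIV" for c
  proof -
    have "cper (\<lambda>x. f x + c * g x)" by (intro cper_intros f g)
    from has_sum_of_real[OF Parseval_norm[OF this]] show ?thesis
      using f g by (simp add: fc_add fc_cmult cper_intros flip: of_real_power)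
  qed
  have ig: "integrable torus (\<lambda>x. complex_of_real ((cmod (f x + c * g x))\<^sup>2))" for c
    using f g by (intro torus_integrable_continuous) (auto simp: cper_def intro!: continuous_intros)
  have "((\<lambda>k. 4 * (fc f k * cnj (fc g k))) has_sum (\<integral>x. 4 * (f x * cnj (g x)) \<partial>torus)) UNIV"
  proof -
    have "(\<integral>x. 4 * (f x * cnj (g x)) \<partial>torus) = (\<integral>x. complex_of_real ((cmod (f x + 1 * g x))\<^sup>2) \<partial>torus) + (-1) * (\<integral>x. complex_of_real ((cmod (f x + (-1) * g x))\<^sup>2) \<partial>torus)
       + \<i> * (\<integral>x. complex_of_real ((cmod (f x + \<i> * g x))\<^sup>2) \<partial>torus) + (- \<i>) * (\<integral>x. complex_of_real ((cmod (f x + (- \<i>) * g x))\<^sup>2) \<partial>torus)"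
      unfolding polarization integral_mult_right_zero[symmetric]
      by (subst Bochner_Integration.integral_add[symmetric]; (intro Bochner_Integration.integrable_add integrable_mult_right ig)?)+ (rule refl)
    then show ?thesis unfolding polarization
      by (simp only:) (intro has_sum_add has_sum_cmult_right *)
  qed
  from has_sum_cmult_right[OF this, of "1/4"] show ?thesis by simp
qed

section \<open>Fourier coefficients of real functions, their derivatives and their Laplacian\<close>

definition rfc :: "(real^2 \<Rightarrow> real) \<Rightarrow> int \<times> int \<Rightarrow> complex" where
  "rfc f = fc (\<lambda>x. of_real (f x))"

lemma Parseval_real:
  assumes "Ck 0 f"
  shows "((\<lambda>k. (cmod (rfc f k))\<^sup>2) has_sum (\<integral>x. (f x)\<^sup>2 \<partial>torus)) UNIV"
  using Parseval_norm[OF cper_of_real[OF assms]] by (simp add: rfc_def)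

lemma rfc_add: "Ck 0 f \<Longrightarrow> Ck 0 g \<Longrightarrow> rfc (\<lambda>x. f x + g x) k = rfc f k + rfc g k"
  unfolding rfc_def by (simp add: fc_add cper_of_real)

lemma rfc_diff: "Ck 0 f \<Longrightarrow> Ck 0 g \<Longrightarrow> rfc (\<lambda>x. f x - g x) k = rfc f k - rfc g k"
  unfolding rfc_def by (simp add: fc_diff cper_of_real)

lemma rfc_0: "rfc f 0 = of_real (\<integral>x. f x \<partial>torus)" by (simp add: rfc_def fc_0)

text \<open>By Parseval the difference has norm zero, and it is continuous.\<close>

lemma fc_unique:
  assumes f: "cper f" and g: "cper g" and eq: "\<And>k. fc f k = fc g k"
  shows "f x = g x"
proof -
  have c: "cper (\<lambda>x. f x - g x)" by (intro cper_intros f g)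
  have "((\<lambda>k::int \<times> int. 0) has_sum (\<integral>x. (cmod (f x - g x))\<^sup>2 \<partial>torus)) UNIV"
    using Parseval_norm[OF c] by (simp add: fc_diff f g eq)
  then have "(\<integral>x. (cmod (f x - g x))\<^sup>2 \<partial>torus) = 0" using has_sum_unique[OF _ has_sum_0] by blast
  moreover have "continuous_on UNIV (\<lambda>x. (cmod (f x - g x))\<^sup>2)" "periodic (\<lambda>x. (cmod (f x - g x))\<^sup>2)"
    using c by (auto simp: cper_def periodic_def intro!: continuous_intros)
  ultimately have "(cmod (f x - g x))\<^sup>2 = 0"
    by (intro torus_integral_nonneg_eq_0[of "\<lambda>x. (cmod (f x - g x))\<^sup>2"]) auto
  then show ?thesis by simp
qed

lemma rfc_unique:
  assumes "Ck 0 f" "Ck 0 g" "\<And>k. rfc f k = rfc g k"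
  shows "f x = g x"
  using fc_unique[OF cper_of_real[OF assms(1)] cper_of_real[OF assms(2)], of x] assms(3)
  by (simp add: rfc_def)

definition freq :: "2 \<Rightarrow> int \<times> int \<Rightarrow> real" where
  "freq i k = of_int (if i = 1 then fst k else snd k)"

lemma freq_simps [simp]: "freq 1 k = of_int (fst k)" "freq 2 k = of_int (snd k)"
  by (simp_all add: freq_def)

lemma trig_functions:
  "Ck n (\<lambda>x. cos (phase k x)) \<and> Ck n (\<lambda>x. sin (phase k x))"
  "pd i (\<lambda>x. cos (phase k x)) x = - 2 * pi * freq i k * sin (phase k x)"
  "pd i (\<lambda>x. sin (phase k x)) x = 2 * pi * freq i k * cos (phase k x)"
proof -
  have D: "((\<lambda>x. cos (phase k x)) has_derivative (\<lambda>v. v $ 1 * (- 2 * pi * freq 1 k * sin (phase k x)) + v $ 2 * (- 2 * pi * freq 2 k * sin (phase k x)))) (at x)"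
    "((\<lambda>x. sin (phase k x)) has_derivative (\<lambda>v. v $ 1 * (2 * pi * freq 1 k * cos (phase k x)) + v $ 2 * (2 * pi * freq 2 k * cos (phase k x)))) (at x)" for x
    unfolding phase_def by (auto intro!: derivative_eq_intros bounded_linear.has_derivative[OF bounded_linear_vec_nth] simp: fun_eq_iff algebra_simps)
  have pds: "pd i (\<lambda>x. cos (phase k x)) = (\<lambda>x. (- 2 * pi * freq i k) * sin (phase k x))"
    "pd i (\<lambda>x. sin (phase k x)) = (\<lambda>x. (2 * pi * freq i k) * cos (phase k x))" for i
    using differentiable_if_pd(1,2)[OF D(1)] differentiable_if_pd(1,2)[OF D(2)] exhaust_2[of i] by (auto simp: fun_eq_iff)
  show "pd i (\<lambda>x. cos (phase k x)) x = - 2 * pi * freq i k * sin (phase k x)"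
    "pd i (\<lambda>x. sin (phase k x)) x = 2 * pi * freq i k * cos (phase k x)"
    by (simp_all add: pds)
  have per: "periodic (\<lambda>x. cos (phase k x))" "periodic (\<lambda>x. sin (phase k x))"
    using cper_character[of k] by (auto simp: cper_def periodic_def character_def complex_eq_iff)
  show "Ck n (\<lambda>x. cos (phase k x)) \<and> Ck n (\<lambda>x. sin (phase k x))"
  proof (induction n)
    case 0 then show ?case using per by (auto simp: Ck.simps phase_def intro!: continuous_intros)
  next
    case (Suc n)
    then have "Ck n (pd i (\<lambda>x. cos (phase k x)))" "Ck n (pd i (\<lambda>x. sin (phase k x)))" for i
      unfolding pds using Ck_cmult[of n "\<lambda>x. cos (phase k x)"] Ck_cmult[of n "\<lambda>x. sin (phase k x)"] by blast+
    then show ?case using per differentiable_if_pd(3)[OF D(1)] differentiable_if_pd(3)[OF D(2)]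
      by (simp add: Ck.simps)
  qed
qed

text \<open>The split into cosine and sine integrals lets the real integration by parts compute the
  coefficients of a derivative.\<close>

lemma rfc_eq:
  assumes "Ck 0 f"
  shows "rfc f k = Complex (\<integral>x. f x * cos (phase k x) \<partial>torus) (- (\<integral>x. f x * sin (phase k x) \<partial>torus))"
proof -
  have i: "integrable torus (\<lambda>x. complex_of_real (f x) * character (- k) x)"
    by (intro cper_integrable cper_intros cper_of_real[OF assms] cper_character)
  have "phase (- k) x = - phase k x" for x by (simp add: phase_def algebra_simps)
  then have "Re (character (- k) x) = cos (phase k x)" "Im (character (- k) x) = - sin (phase k x)" for x
    by (simp_all add: character_def)
  then show ?thesis using i
    by (intro complex_eqI) (simp_all add: rfc_def fc_def flip: integral_Re integral_Im)
qed

lemma rfc_pd: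
  assumes "Ck 1 f"
  shows "rfc (pd i f) k = 2 * pi * \<i> * freq i k * rfc f k"
proof -
  note T = trig_functions(1)[of 1 k, THEN conjunct1] trig_functions(1)[of 1 k, THEN conjunct2]
  show ?thesis
    unfolding rfc_eq[OF Ck_1D(2)[OF assms]] rfc_eq[OF Ck_1D(3)[OF assms]]
      integral_pd_mult[OF assms T(1)] integral_pd_mult[OF assms T(2)] trig_functions(2,3)
    by (simp add: complex_eq_iff mult.left_commute[of "f _"] mult.assoc)
qed

lemma rfc_pd2: "Ck 2 f \<Longrightarrow> rfc (pd i (pd j f)) k = of_real (- (4 * pi\<^sup>2 * freq i k * freq j k)) * rfc f k"
proof -
  assume f: "Ck 2 f"
  have "rfc (pd i (pd j f)) k = (\<i> * \<i>) * (4 * (of_real pi * of_real pi) * freq i k * freq j k * rfc f k)"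
    by (simp only: rfc_pd[OF Ck_2D(2)[OF f]] rfc_pd[OF Ck_2D(3)[OF f]]) (simp add: mult_ac)
  then show ?thesis by (simp add: power2_eq_square)
qed

text \<open>Both mixed derivatives have the same Fourier multiplier, so uniqueness of coefficients
  gives their symmetry.\<close>

lemma pd_commute: "Ck 2 f \<Longrightarrow> pd i (pd j f) x = pd j (pd i f) x"
  by (rule rfc_unique) (auto simp: Ck_2D rfc_pd2)

definition lap :: "(real^2 \<Rightarrow> real) \<Rightarrow> real^2 \<Rightarrow> real" where
  "lap f x = pd 1 (pd 1 f) x + pd 2 (pd 2 f) x"

lemma Ck_lap: "Ck 2 f \<Longrightarrow> Ck 0 (lap f)"
  unfolding lap_def by (intro Ck_add Ck_2D)

definition ksq :: "int \<times> int \<Rightarrow> real" where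
  "ksq k = (freq 1 k)\<^sup>2 + (freq 2 k)\<^sup>2"

lemma rfc_lap: "Ck 2 f \<Longrightarrow> rfc (lap f) k = of_real (- (4 * pi\<^sup>2 * ksq k)) * rfc f k"
  unfolding lap_def by (subst rfc_add) (simp_all add: Ck_2D rfc_pd2 ksq_def algebra_simps power2_eq_square)

lemma ksq_ge_1: "k \<noteq> 0 \<Longrightarrow> 1 \<le> ksq k"
proof -
  assume "k \<noteq> 0"
  then have "1 \<le> (fst k)\<^sup>2 + (snd k)\<^sup>2"
    by (metis add_nonneg_eq_0_iff add_nonneg_nonneg linorder_not_less prod_eqI zero_eq_power2 zero_le_power2 zero_prod_def fst_conv snd_conv int_one_le_iff_zero_less less_le)
  then have "real_of_int 1 \<le> of_int ((fst k)\<^sup>2 + (snd k)\<^sup>2)" by (simp only: of_int_le_iff)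
  then show ?thesis by (simp add: ksq_def)
qed

text \<open>Spectral gap: mean zero removes the zero mode, and on every other mode the multiplier
  \<open>4 pi^2 ksq k\<close> of the Laplacian is at least 1 in absolute value.\<close>

lemma Poincare_lap:
  assumes f: "Ck 2 f" and z: "(\<integral>x. f x \<partial>torus) = 0"
  shows "(\<integral>x. (f x)\<^sup>2 \<partial>torus) \<le> (\<integral>x. (lap f x)\<^sup>2 \<partial>torus)"
proof (rule has_sum_mono[OF Parseval_real[OF Ck_2D(4)[OF f]] Parseval_real[OF Ck_lap[OF f]]])
  fix k :: "int \<times> int"
  show "(cmod (rfc f k))\<^sup>2 \<le> (cmod (rfc (lap f) k))\<^sup>2"
  proof (cases "k = 0")
    case True then show ?thesis by (simp add: rfc_0 z)
  next
    case False
    have "1 \<le> pi\<^sup>2" using pi_ge_two by (intro one_le_power) simp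
    then have "1 \<le> 4 * pi\<^sup>2" by simp
    then have "1 * 1 \<le> 4 * pi\<^sup>2 * ksq k" using ksq_ge_1[OF False] by (intro mult_mono) auto
    then have "cmod (rfc f k) \<le> cmod (rfc (lap f) k)"
      unfolding rfc_lap[OF f] norm_mult norm_of_real abs_minus_cancel
      using abs_ge_self[of "4 * pi\<^sup>2 * ksq k"] mult_right_mono[of 1 "\<bar>4 * pi\<^sup>2 * ksq k\<bar>" "cmod (rfc f k)"] by simp
    then show ?thesis by (intro power_mono) auto
  qed
qed

text \<open>The squared symbols of the four second derivatives add up to the square of the symbol of
  the Laplacian. In \<open>L^2\<close> this identity takes the place of an elliptic regularity
  estimate.\<close>

lemma integral_hessian_sq:
  assumes f: "Ck 2 f"
  shows "(\<integral>x. (pd 1 (pd 1 f) x)\<^sup>2 \<partial>torus) + (\<integral>x. (pd 2 (pd 1 f) x)\<^sup>2 \<partial>torus) +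
    ((\<integral>x. (pd 1 (pd 2 f) x)\<^sup>2 \<partial>torus) + (\<integral>x. (pd 2 (pd 2 f) x)\<^sup>2 \<partial>torus)) = (\<integral>x. (lap f x)\<^sup>2 \<partial>torus)"
proof -
  have P: "((\<lambda>k. (cmod (rfc (pd i (pd j f)) k))\<^sup>2) has_sum (\<integral>x. (pd i (pd j f) x)\<^sup>2 \<partial>torus)) UNIV" for i j
    by (rule Parseval_real) (simp add: Ck_2D f)
  have "((\<lambda>k. (cmod (rfc (pd 1 (pd 1 f)) k))\<^sup>2 + (cmod (rfc (pd 2 (pd 1 f)) k))\<^sup>2 +
     ((cmod (rfc (pd 1 (pd 2 f)) k))\<^sup>2 + (cmod (rfc (pd 2 (pd 2 f)) k))\<^sup>2)) has_sum
     ((\<integral>x. (pd 1 (pd 1 f) x)\<^sup>2 \<partial>torus) + (\<integral>x. (pd 2 (pd 1 f) x)\<^sup>2 \<partial>torus) +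
    ((\<integral>x. (pd 1 (pd 2 f) x)\<^sup>2 \<partial>torus) + (\<integral>x. (pd 2 (pd 2 f) x)\<^sup>2 \<partial>torus)))) UNIV"
    by (intro has_sum_add P)
  also have "(\<lambda>k. (cmod (rfc (pd 1 (pd 1 f)) k))\<^sup>2 + (cmod (rfc (pd 2 (pd 1 f)) k))\<^sup>2 +
     ((cmod (rfc (pd 1 (pd 2 f)) k))\<^sup>2 + (cmod (rfc (pd 2 (pd 2 f)) k))\<^sup>2)) = (\<lambda>k. (cmod (rfc (lap f) k))\<^sup>2)"
    unfolding rfc_pd2[OF f] rfc_lap[OF f] norm_mult norm_of_real abs_minus_cancel power_mult_distrib power2_abs ksq_def
    by (intro ext) algebra
  finally show ?thesis using has_sum_unique Parseval_real[OF Ck_lap[OF f]] by blast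
qed

section \<open>The Poisson equation\<close>

text \<open>An enumeration of the frequencies turns lattice sums into ordinary series, to which the
  Weierstrass test and termwise differentiation apply.\<close>

definition idx :: "nat \<Rightarrow> int \<times> int" where
  "idx = from_nat_into UNIV"

lemma bij_idx: "bij idx"
  unfolding idx_def
proof (rule bij_betw_from_nat_into)
  show "infinite (UNIV :: (int \<times> int) set)" using finite_prod infinite_UNIV_int by blast
qed auto

definition asum :: "(int \<times> int \<Rightarrow> complex) \<Rightarrow> bool" where
  "asum a \<longleftrightarrow> summable (\<lambda>n. cmod (a (idx n)))"

definition fser :: "(int \<times> int \<Rightarrow> complex) \<Rightarrow> real^2 \<Rightarrow> complex" where
  "fser a x = (\<Sum>n. a (idx n) * character (idx n) x)"

lemma asum_le:
  assumes "asum a" "\<And>k. cmod (b k) \<le> C * cmod (a k)"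
  shows "asum b"
  unfolding asum_def
  by (rule summable_comparison_test'[OF summable_mult[OF assms(1)[unfolded asum_def], of C], of 0]) (use assms(2) in auto)

lemma fser_summable: "asum a \<Longrightarrow> summable (\<lambda>n. a (idx n) * character (idx n) x)"
  by (rule summable_norm_cancel) (simp add: norm_mult asum_def)

lemma fser_uniform_limit:
  assumes "asum a"
  shows "uniform_limit UNIV (\<lambda>n x. \<Sum>i<n. a (idx i) * character (idx i) x) (fser a) sequentially"
  unfolding fser_def
  by (rule Weierstrass_m_test[OF _ assms[unfolded asum_def]]) (simp add: norm_mult)

lemma fser_cper:
  assumes "asum a"
  shows "cper (fser a)"
  unfolding cper_def
proof
  have c: "continuous_on UNIV (\<lambda>x. \<Sum>i<n. a (idx i) * character (idx i) x)" for n
    using cper_character by (intro continuous_intros) (simp add: cper_def)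
  show "continuous_on UNIV (fser a)"
    by (rule uniform_limit_theorem[OF _ fser_uniform_limit[OF assms]]) (simp_all add: c)
  show "periodic (fser a)"
    by (simp add: periodic_iff fser_def character_translate character_lattice)
qed

lemma fc_fser:
  assumes a: "asum a"
  shows "fc (fser a) k = a k"
proof -
  obtain m where m: "idx m = k" using bij_idx by (metis bij_pointE)
  have fcn: "fc (\<lambda>x. \<Sum>i<n. a (idx i) * character (idx i) x) k = (if m < n then a k else 0)" for n
  proof (induction n)
    case 0 then show ?case by (simp add: fc_def)
  next
    case (Suc n)
    have "idx n = k \<longleftrightarrow> n = m" using m bij_idx by (metis bij_def inj_eq)
    then show ?case using Suc
      by (auto simp: fc_add fc_cmult fc_character cper_sum cper_intros)
  qed
  have "cmod (fc (fser a) k - a k) \<le> e" if "e > 0" for e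
  proof -
    have "\<forall>\<^sub>F n in sequentially. (\<forall>x\<in>UNIV. dist (\<Sum>i<n. a (idx i) * character (idx i) x) (fser a x) < e) \<and> m < n"
      using uniform_limitD[OF fser_uniform_limit[OF a] that] eventually_gt_at_top by (rule eventually_conj)
    then obtain n where n: "\<And>x. dist (\<Sum>i<n. a (idx i) * character (idx i) x) (fser a x) < e" "m < n"
      by (auto simp: eventually_sequentially)
    define s where "s x = (\<Sum>i<n. a (idx i) * character (idx i) x)" for x
    have cs: "cper s" unfolding s_def by (intro cper_sum cper_intros cper_character)
    have "fc (fser a) k - a k = fc (\<lambda>x. fser a x - s x) k"
      using fcn[of n] n(2) by (simp add: fc_diff fser_cper a cs) (simp add: s_def[abs_def])
    also have "cmod \<dots> \<le> (\<integral>x. cmod ((fser a x - s x) * character (- k) x) \<partial>torus)"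
      unfolding fc_def by (rule integral_norm_bound)
    also have "\<dots> \<le> (\<integral>x. e \<partial>torus)"
    proof (rule integral_mono)
      show "integrable torus (\<lambda>x. cmod ((fser a x - s x) * character (- k) x))"
        using fser_cper[OF a] cs cper_character[of "- k"]
        by (intro torus_integrable_continuous) (auto simp: cper_def intro!: continuous_intros)
      show "cmod ((fser a x - s x) * character (- k) x) \<le> e" for x
        using n(1)[of x] by (simp add: norm_mult s_def dist_norm norm_minus_commute)
    qed simp
    also have "\<dots> = e" by (simp add: torus.prob_space[simplified])
    finally show ?thesis .
  qed
  then have "cmod (fc (fser a) k - a k) \<le> 0" by (rule field_le_epsilon) simp
  then show ?thesis by simp
qed

lemma fser_rfc:
  assumes "Ck 0 w" "asum (rfc w)"
  shows "fser (rfc w) x = of_real (w x)"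
  by (rule fc_unique[OF fser_cper[OF assms(2)] cper_of_real[OF assms(1)]])
     (simp only: fc_fser[OF assms(2)], simp only: rfc_def)

text \<open>The \<open>i\<close>-th partial derivative acting on coefficients.\<close>

definition fdiff :: "2 \<Rightarrow> (int \<times> int \<Rightarrow> complex) \<Rightarrow> int \<times> int \<Rightarrow> complex" where
  "fdiff i a k = of_real (2 * pi * freq i k) * \<i> * a k"

lemma character_has_derivative:
  "(character k has_derivative (\<lambda>v. of_real (v $ 1) * (of_real (2 * pi * freq 1 k) * \<i> * character k x) +
      of_real (v $ 2) * (of_real (2 * pi * freq 2 k) * \<i> * character k x))) (at x)"
proof -
  have "(phase k has_derivative (\<lambda>v. v $ 1 * (2 * pi * freq 1 k) + v $ 2 * (2 * pi * freq 2 k))) (at x)"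
    unfolding phase_def[abs_def]
    by (auto intro!: derivative_eq_intros bounded_linear.has_derivative[OF bounded_linear_vec_nth] simp: fun_eq_iff algebra_simps)
  then have "((\<lambda>x. \<i> * of_real (phase k x)) has_derivative
      (\<lambda>v. \<i> * of_real (v $ 1 * (2 * pi * freq 1 k) + v $ 2 * (2 * pi * freq 2 k)))) (at x)"
    by (intro has_derivative_mult_right has_derivative_of_real)
  from has_derivative_compose[OF this DERIV_exp[unfolded has_field_derivative_def]]
  have "((\<lambda>x. exp (\<i> * of_real (phase k x))) has_derivative
      (\<lambda>v. exp (\<i> * of_real (phase k x)) * (\<i> * of_real (v $ 1 * (2 * pi * freq 1 k) + v $ 2 * (2 * pi * freq 2 k))))) (at x)" .
  then show ?thesis
    unfolding character_def[abs_def] cis_conv_exp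
    by (rule has_derivative_eq_rhs) (simp add: fun_eq_iff algebra_simps)
qed

text \<open>Termwise differentiation. Uniform closeness of the derivatives in operator norm reduces
  to that of the two scalar series of partial derivatives, each allowed half of the error.\<close>

lemma fser_has_derivative:
  assumes a: "asum a" and da: "\<And>i. asum (fdiff i a)"
  shows "(fser a has_derivative (\<lambda>v. of_real (v $ 1) * fser (fdiff 1 a) x + of_real (v $ 2) * fser (fdiff 2 a) x)) (at x)"
proof -
  let ?f = "\<lambda>n x. a (idx n) * character (idx n) x"
  let ?f' = "\<lambda>n x (v :: real^2). of_real (v $ 1) * (fdiff 1 a (idx n) * character (idx n) x) + of_real (v $ 2) * (fdiff 2 a (idx n) * character (idx n) x)"
  let ?g' = "\<lambda>x (v :: real^2). of_real (v $ 1) * fser (fdiff 1 a) x + of_real (v $ 2) * fser (fdiff 2 a) x"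
  have "\<exists>g. \<forall>x\<in>UNIV. (\<lambda>n. ?f n x) sums (g x) \<and> (g has_derivative ?g' x) (at x within UNIV)"
  proof (rule has_derivative_series)
    fix n x
    show "(?f n has_derivative ?f' n x) (at x within UNIV)"
      by (rule has_derivative_eq_rhs[OF has_derivative_mult_right[OF character_has_derivative]])
         (simp add: fdiff_def algebra_simps)
  next
    fix e :: real assume "e > 0"
    then have e: "e / 2 > 0" by simp
    from eventually_conj[OF uniform_limitD[OF fser_uniform_limit[OF da[of 1]] e] uniform_limitD[OF fser_uniform_limit[OF da[of 2]] e]]
    show "\<forall>\<^sub>F n in sequentially. \<forall>x\<in>UNIV. \<forall>v. norm ((\<Sum>i<n. ?f' i x v) - ?g' x v) \<le> e * norm v"
    proof eventually_elim
      case (elim n)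
      have "norm ((\<Sum>i<n. ?f' i x v) - ?g' x v) \<le> e * norm v" for x v :: "real^2"
      proof -
        let ?S = "\<lambda>j. (\<Sum>i<n. fdiff j a (idx i) * character (idx i) x) - fser (fdiff j a) x"
        have "(\<Sum>i<n. ?f' i x v) - ?g' x v = of_real (v $ 1) * ?S 1 + of_real (v $ 2) * ?S 2"
          by (simp add: sum.distrib sum_distrib_left[symmetric] right_diff_distrib)
        also have "norm \<dots> \<le> \<bar>v $ 1\<bar> * norm (?S 1) + \<bar>v $ 2\<bar> * norm (?S 2)"
          by (rule order_trans[OF norm_triangle_ineq]) (simp only: norm_mult norm_of_real order_refl)
        also have "\<dots> \<le> norm v * (e / 2) + norm v * (e / 2)"
        proof -
          have "norm (?S 1) \<le> e / 2" "norm (?S 2) \<le> e / 2"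
            using elim by (simp_all add: dist_norm less_imp_le)
          then show ?thesis using component_le_norm_cart[of v 1] component_le_norm_cart[of v 2]
            by (intro add_mono mult_mono) simp_all
        qed
        finally show ?thesis by (simp add: mult.commute)
      qed
      then show ?case by blast
    qed
  qed (use fser_summable[OF a] in \<open>auto intro!: summable_sums\<close>)
  then obtain g where g: "\<And>x. (\<lambda>n. ?f n x) sums (g x)" "\<And>x. (g has_derivative ?g' x) (at x)" by auto
  have "g = fser a" using g(1) by (auto simp: fser_def sums_iff)
  with g(2) show ?thesis by simp
qed

lemma Re_fser:
  assumes a: "asum a" and da: "\<And>i. asum (fdiff i a)"
  shows "pd i (\<lambda>x. Re (fser a x)) x = Re (fser (fdiff i a) x)" "(\<lambda>x. Re (fser a x)) differentiable at x"
proof -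
  have *: "((\<lambda>x. Re (fser a x)) has_derivative (\<lambda>v. v $ 1 * Re (fser (fdiff 1 a) x) + v $ 2 * Re (fser (fdiff 2 a) x))) (at x)"
    by (rule has_derivative_eq_rhs[OF has_derivative_Re[OF fser_has_derivative[OF assms]]]) simp
  from differentiable_if_pd[OF this] exhaust_2[of i]
  show "pd i (\<lambda>x. Re (fser a x)) x = Re (fser (fdiff i a) x)" "(\<lambda>x. Re (fser a x)) differentiable at x"
    by auto
qed

lemma Ck_0_Re_fser: "asum a \<Longrightarrow> Ck 0 (\<lambda>x. Re (fser a x))"
  using fser_cper[of a] by (auto simp: cper_def Ck.simps periodic_def intro!: continuous_intros)

lemma Ck_Suc_Re_fser:
  assumes "asum a" "\<And>i. asum (fdiff i a)" "\<And>i. Ck n (\<lambda>x. Re (fser (fdiff i a) x))"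
  shows "Ck (Suc n) (\<lambda>x. Re (fser a x))"
proof -
  have "pd i (\<lambda>x. Re (fser a x)) = (\<lambda>x. Re (fser (fdiff i a) x))" for i
    by (rule ext) (rule Re_fser(1)[OF assms(1,2)])
  then show ?thesis
    using Ck_periodic[OF Ck_0_Re_fser[OF assms(1)]] Re_fser(2)[OF assms(1,2)] assms(3)
    by (simp add: Ck.simps)
qed

text \<open>The absolute value is injective on each half line, so both halves are compared with one
  series over the naturals, which converges because \<open>(n + 1)^2 <= 2 (1 + n^2)\<close>.\<close>

lemma sum_inverse_sq_int:
  obtains C where "\<And>A :: int set. finite A \<Longrightarrow> (\<Sum>k\<in>A. 1 / (1 + (real_of_int k)\<^sup>2)) \<le> C"
proof -
  define f where "f n = 1 / (1 + (real n)\<^sup>2)" for n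
  have "summable f"
  proof (rule summable_comparison_test')
    show "summable (\<lambda>n. 1 / real (Suc n) ^ 2 * 2)"
      using inverse_power_summable[of 2] by (intro summable_mult2) (simp add: summable_Suc_iff[of "\<lambda>n. 1 / real n ^ 2"] inverse_eq_divide del: of_nat_Suc)
    show "norm (f n) \<le> 1 / real (Suc n) ^ 2 * 2" for n
    proof -
      have "(real (Suc n))\<^sup>2 \<le> 2 * (1 + (real n)\<^sup>2)"
        using sum_squares_bound[of "real n" 1] by (simp add: power2_eq_square algebra_simps)
      moreover have "0 < 1 + (real n)\<^sup>2" by (simp add: add_pos_nonneg)
      ultimately show ?thesis by (simp add: f_def field_simps)
    qed
  qed
  have le: "(\<Sum>k\<in>A. 1 / (1 + (real_of_int k)\<^sup>2)) \<le> suminf f" if A: "finite A" and s: "(\<forall>k\<in>A. 0 \<le> k) \<or> (\<forall>k\<in>A. k < 0)" for A :: "int set"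
  proof -
    have inj: "inj_on (\<lambda>k. nat \<bar>k\<bar>) A" unfolding inj_on_def using s by (metis abs_of_neg abs_of_nonneg abs_ge_zero neg_equal_iff_equal nat_0_le)
    have "(\<Sum>k\<in>A. 1 / (1 + (real_of_int k)\<^sup>2)) = sum f ((\<lambda>k. nat \<bar>k\<bar>) ` A)"
      by (subst sum.reindex[OF inj]) (auto simp: f_def intro!: sum.cong)
    also have "\<dots> \<le> suminf f"
      by (rule sum_le_suminf[OF \<open>summable f\<close>]) (auto simp: f_def A)
    finally show ?thesis .
  qed
  have "(\<Sum>k\<in>A. 1 / (1 + (real_of_int k)\<^sup>2)) \<le> suminf f + suminf f" if A: "finite A" for A :: "int set"
  proof -
    have "(\<Sum>k\<in>A. 1 / (1 + (real_of_int k)\<^sup>2)) =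
        (\<Sum>k\<in>A \<inter> {0..}. 1 / (1 + (real_of_int k)\<^sup>2)) + (\<Sum>k\<in>A \<inter> - {0..}. 1 / (1 + (real_of_int k)\<^sup>2))"
      by (subst sum.union_disjoint[symmetric]) (auto simp: A intro!: sum.cong)
    also have "\<dots> \<le> suminf f + suminf f" by (intro add_mono le) (auto simp: A)
    finally show ?thesis .
  qed
  then show thesis by (rule that)
qed

text \<open>The weight is a product of one-variable weights so that the lattice sum is dominated by
  a product of two one-dimensional sums.\<close>

lemma asum_if_decay:
  assumes "\<And>k. cmod (a k) * ((1 + (freq 1 k)\<^sup>2) * (1 + (freq 2 k)\<^sup>2)) \<le> M"
  shows "asum a"
proof -
  obtain C where C: "\<And>A :: int set. finite A \<Longrightarrow> (\<Sum>k\<in>A. 1 / (1 + (real_of_int k)\<^sup>2)) \<le> C"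
    using sum_inverse_sq_int by blast
  let ?g = "\<lambda>k. 1 / (1 + (real_of_int k)\<^sup>2)"
  have g0: "0 \<le> ?g k" for k by (simp add: add_nonneg_nonneg)
  have M: "0 \<le> M" using assms[of 0] by (smt (verit) norm_ge_zero mult_nonneg_nonneg zero_le_power2)
  have C0: "0 \<le> C" using C[of "{}"] by simp
  have bd: "cmod (a k) \<le> M * (?g (fst k) * ?g (snd k))" for k
  proof -
    have "0 < 1 + (freq 1 k)\<^sup>2" "0 < 1 + (freq 2 k)\<^sup>2" by (auto intro: add_pos_nonneg)
    then have "0 < (1 + (freq 1 k)\<^sup>2) * (1 + (freq 2 k)\<^sup>2)" by (rule mult_pos_pos)
    then have "cmod (a k) \<le> M / ((1 + (freq 1 k)\<^sup>2) * (1 + (freq 2 k)\<^sup>2))"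
      using assms[of k] by (simp only: pos_le_divide_eq)
    then show ?thesis by simp
  qed
  have fin: "sum (\<lambda>k. cmod (a k)) F \<le> M * (C * C)" if F: "finite F" for F
  proof -
    have "sum (\<lambda>k. cmod (a k)) F \<le> (\<Sum>k\<in>fst ` F \<times> snd ` F. M * (?g (fst k) * ?g (snd k)))"
      using F g0 M by (intro order_trans[OF sum_mono[OF bd] sum_mono2]) (auto intro: rev_image_eqI)
    also have "\<dots> = M * (\<Sum>k\<in>fst ` F \<times> snd ` F. ?g (fst k) * ?g (snd k))"
      by (rule sum_distrib_left[symmetric])
    also have "(\<Sum>k\<in>fst ` F \<times> snd ` F. ?g (fst k) * ?g (snd k)) = (\<Sum>i\<in>fst ` F. \<Sum>j\<in>snd ` F. ?g i * ?g j)"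
      by (simp only: sum.cartesian_product case_prod_unfold)
    also have "\<dots> = (\<Sum>k\<in>fst ` F. ?g k) * (\<Sum>k\<in>snd ` F. ?g k)" by (rule sum_product[symmetric])
    also have "M * ((\<Sum>k\<in>fst ` F. ?g k) * (\<Sum>k\<in>snd ` F. ?g k)) \<le> M * (C * C)"
      using F M C0 g0 by (intro mult_left_mono[OF mult_mono] C sum_nonneg finite_imageI)
    finally show ?thesis .
  qed
  show ?thesis unfolding asum_def
  proof (rule summableI_nonneg_bounded)
    fix n
    have inj: "inj_on idx {..<n}" using bij_idx by (metis bij_def inj_on_subset subset_UNIV)
    show "(\<Sum>i<n. cmod (a (idx i))) \<le> M * (C * C)"
      using fin[of "idx ` {..<n}"] by (simp add: sum.reindex[OF inj])
  qed simp
qed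

text \<open>The operator \<open>A i\<close> has symbol \<open>1 + (freq i k)^2\<close>, so
  \<open>A 2\<close> after \<open>A 1\<close> has exactly the product weight of
  \<open>asum_if_decay\<close>. It consumes four derivatives and leaves a continuous function, whose
  single coefficients are bounded by its \<open>L^2\<close> norm.\<close>

lemma asum_rfc:
  assumes w: "Ck 4 w"
  shows "asum (rfc w)"
proof -
  define A where "A i f = (\<lambda>x. f x - 1 / (4 * pi\<^sup>2) * pd i (pd i f) x)" for i :: 2 and f :: "real^2 \<Rightarrow> real"
  have rA: "rfc (A i f) k = of_real (1 + (freq i k)\<^sup>2) * rfc f k" if f: "Ck 2 f" for i f k
  proof -
    have "rfc (\<lambda>x. 1 / (4 * pi\<^sup>2) * pd i (pd i f) x) k = of_real (1 / (4 * pi\<^sup>2)) * rfc (pd i (pd i f)) k"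
      unfolding rfc_def of_real_mult by (rule fc_cmult)
    then show ?thesis unfolding A_def
      by (subst rfc_diff[OF Ck_2D(4)[OF f] Ck_cmult[OF Ck_2D(6)[OF f]]]) (simp add: rfc_pd2 f power2_eq_square algebra_simps)
  qed
  have w': "Ck (Suc (Suc 2)) w" using w by (simp add: numeral_eq_Suc)
  have "Ck 2 (pd i (pd i w))" for i using Ck_pd[OF Ck_pd[OF w']] .
  then have A1: "Ck 2 (A 1 w)" unfolding A_def using Ck_le[OF _ w, of 2] by (intro Ck_diff Ck_cmult) auto
  then have A2: "Ck 0 (A 2 (A 1 w))" unfolding A_def[of 2] by (intro Ck_diff Ck_cmult Ck_2D)
  define M where "M = (\<integral>x. (A 2 (A 1 w) x)\<^sup>2 \<partial>torus)"
  have "cmod (rfc w k) * ((1 + (freq 1 k)\<^sup>2) * (1 + (freq 2 k)\<^sup>2)) \<le> sqrt M" for k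
  proof -
    have eq: "rfc (A 2 (A 1 w)) k = of_real ((1 + (freq 1 k)\<^sup>2) * (1 + (freq 2 k)\<^sup>2)) * rfc w k"
      using rA[OF A1, of 2] rA[of w 1] Ck_le[OF _ w, of 2] by (simp add: mult_ac)
    have "((\<lambda>k. (cmod (rfc (A 2 (A 1 w)) k))\<^sup>2) has_sum (cmod (rfc (A 2 (A 1 w)) k))\<^sup>2) {k}"
      by (rule has_sum_finiteI) auto
    from has_sum_mono2[OF this Parseval_real[OF A2]] have "(cmod (rfc (A 2 (A 1 w)) k))\<^sup>2 \<le> M"
      by (simp add: M_def)
    then have "cmod (rfc (A 2 (A 1 w)) k) \<le> sqrt M" by (rule real_le_rsqrt)
    moreover have "\<bar>(1 + (freq 1 k)\<^sup>2) * (1 + (freq 2 k)\<^sup>2)\<bar> = (1 + (freq 1 k)\<^sup>2) * (1 + (freq 2 k)\<^sup>2)"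
      by (intro abs_of_nonneg mult_nonneg_nonneg add_nonneg_nonneg) auto
    ultimately show ?thesis unfolding eq norm_mult norm_of_real by (simp add: mult.commute)
  qed
  then show ?thesis by (rule asum_if_decay)
qed

text \<open>Division by the symbol of the Laplacian. The coefficients of all derivatives up to order
  two are dominated by those of \<open>w\<close>, so absolute summability of the latter already
  yields a classical \<open>C^2\<close> solution.\<close>

theorem Poisson_solution:
  assumes w: "Ck 4 w" and z: "(\<integral>x. w x \<partial>torus) = 0"
  obtains h where "Ck 2 h" "(\<integral>x. h x \<partial>torus) = 0" "lap h = w"
proof -
  \<comment> \<open>At \<open>k = 0\<close> the division yields \<open>0\<close>; in that mode the
    equation holds because \<open>w\<close> has mean zero.\<close>
  define b where "b k = of_real (- 1 / (4 * pi\<^sup>2 * ksq k)) * rfc w k" for k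
  have aw: "asum (rfc w)" by (rule asum_rfc[OF w])
  have r0: "rfc w 0 = 0" by (simp add: rfc_0 z)
  have f1: "\<bar>freq i k\<bar> \<le> ksq k" for i k
  proof -
    have m: "\<bar>real_of_int m\<bar> \<le> (real_of_int m)\<^sup>2" for m
    proof (cases "m = 0")
      case False
      then have "1 \<le> \<bar>real_of_int m\<bar>" by linarith
      then have "\<bar>real_of_int m\<bar> * 1 \<le> \<bar>real_of_int m\<bar> * \<bar>real_of_int m\<bar>" by (intro mult_left_mono) auto
      then show ?thesis by (simp add: power2_eq_square)
    qed simp
    show ?thesis
      using exhaust_2[of i] m[of "fst k"] m[of "snd k"] by (auto simp: ksq_def add_increasing add_increasing2)
  qed
  have f2: "\<bar>freq i k\<bar> * \<bar>freq j k\<bar> \<le> ksq k" for i j k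
  proof -
    have "2 * \<bar>freq 1 k\<bar> * \<bar>freq 2 k\<bar> \<le> ksq k"
      using sum_squares_bound[of "\<bar>freq 1 k\<bar>" "\<bar>freq 2 k\<bar>"] by (simp add: ksq_def)
    moreover have "0 \<le> \<bar>freq 1 k\<bar> * \<bar>freq 2 k\<bar>" by simp
    ultimately have "\<bar>freq 1 k\<bar> * \<bar>freq 2 k\<bar> \<le> ksq k" by linarith
    then show ?thesis
      using exhaust_2[of i] exhaust_2[of j] by (auto simp: ksq_def power2_eq_square mult.commute simp flip: abs_mult)
  qed
  \<comment> \<open>One estimate for all three families below, with \<open>X\<close> equal to
    \<open>1\<close>, to one absolute frequency, or to a product of two; each of these is at most
    \<open>ksq k\<close> (for \<open>X = 1\<close> off the zero mode).\<close>
  have dom: "X * cmod (b k) \<le> 1 / (4 * pi\<^sup>2) * cmod (rfc w k)" if X: "X \<le> ksq k" for X k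
  proof (cases "k = 0")
    case True then show ?thesis by (simp add: b_def r0)
  next
    case False
    then have k: "0 < ksq k" using ksq_ge_1[of k] by simp
    have "X * cmod (b k) = (X / ksq k) * (1 / (4 * pi\<^sup>2) * cmod (rfc w k))"
      using k by (simp add: b_def norm_mult norm_divide abs_mult power2_eq_square)
    also have "\<dots> \<le> 1 * (1 / (4 * pi\<^sup>2) * cmod (rfc w k))"
      using X k by (intro mult_right_mono) auto
    finally show ?thesis by simp
  qed
  have b1: "asum b"
  proof (rule asum_le[OF aw])
    fix k
    show "cmod (b k) \<le> 1 / (4 * pi\<^sup>2) * cmod (rfc w k)"
    proof (cases "k = 0")
      case True then show ?thesis by (simp add: b_def r0)
    next
      case False then show ?thesis using dom[OF ksq_ge_1[of k]] by simp
    qed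
  qed
  have b2: "asum (fdiff i b)" for i
  proof (rule asum_le[OF aw])
    fix k
    have "cmod (fdiff i b k) = 2 * pi * (\<bar>freq i k\<bar> * cmod (b k))"
      by (simp add: fdiff_def norm_mult abs_mult)
    also have "\<dots> \<le> 2 * pi * (1 / (4 * pi\<^sup>2) * cmod (rfc w k))"
      by (intro mult_left_mono dom f1) auto
    finally show "cmod (fdiff i b k) \<le> (2 * pi * (1 / (4 * pi\<^sup>2))) * cmod (rfc w k)" by (simp only: mult.assoc)
  qed
  have b3: "asum (fdiff i (fdiff j b))" for i j
  proof (rule asum_le[OF aw])
    fix k
    have "cmod (fdiff i (fdiff j b) k) = 4 * pi\<^sup>2 * ((\<bar>freq i k\<bar> * \<bar>freq j k\<bar>) * cmod (b k))"
      by (simp add: fdiff_def norm_mult abs_mult power2_eq_square)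
    also have "\<dots> \<le> 4 * pi\<^sup>2 * (1 / (4 * pi\<^sup>2) * cmod (rfc w k))"
      by (intro mult_left_mono dom f2) auto
    finally show "cmod (fdiff i (fdiff j b) k) \<le> 1 * cmod (rfc w k)" by simp
  qed
  define h where "h = (\<lambda>x. Re (fser b x))"
  have h1: "Ck (Suc 0) (\<lambda>x. Re (fser (fdiff i b) x))" for i
    by (rule Ck_Suc_Re_fser[OF b2 b3 Ck_0_Re_fser[OF b3]])
  have h2: "Ck 2 h"
    unfolding h_def numeral_2_eq_2 by (rule Ck_Suc_Re_fser[OF b1 b2 h1])
  have pp: "pd i (pd i h) x = Re (fser (fdiff i (fdiff i b)) x)" for i x
  proof -
    have "pd i (\<lambda>x. Re (fser b x)) = (\<lambda>x. Re (fser (fdiff i b) x))"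
      by (rule ext) (rule Re_fser(1)[OF b1 b2])
    then show ?thesis unfolding h_def by (simp only: Re_fser(1)[OF b2 b3])
  qed
  have lap: "lap h x = w x" for x
  proof -
    have "fdiff 1 (fdiff 1 b) k + fdiff 2 (fdiff 2 b) k = rfc w k" for k
    proof (cases "k = 0")
      case True then show ?thesis by (simp add: fdiff_def r0 freq_def)
    next
      case False
      then have k: "ksq k \<noteq> 0" using ksq_ge_1[of k] by auto
      have "fdiff 1 (fdiff 1 b) k + fdiff 2 (fdiff 2 b) k = of_real (- (4 * pi\<^sup>2 * ksq k)) * b k"
        by (simp add: fdiff_def ksq_def power2_eq_square algebra_simps)
      also have "\<dots> = of_real (- (4 * pi\<^sup>2 * ksq k) * (- 1 / (4 * pi\<^sup>2 * ksq k))) * rfc w k"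
        by (simp only: b_def of_real_mult mult.assoc)
      also have "- (4 * pi\<^sup>2 * ksq k) * (- 1 / (4 * pi\<^sup>2 * ksq k)) = 1" using k by simp
      finally show ?thesis by simp
    qed
    then have "fser (fdiff 1 (fdiff 1 b)) x + fser (fdiff 2 (fdiff 2 b)) x = fser (rfc w) x"
      unfolding fser_def by (subst suminf_add) (auto intro!: fser_summable b3 simp flip: distrib_right)
    also have "\<dots> = of_real (w x)" using Ck_le[OF _ w] by (intro fser_rfc aw) auto
    finally have "Re (fser (fdiff 1 (fdiff 1 b)) x + fser (fdiff 2 (fdiff 2 b)) x) = w x" by simp
    then show ?thesis by (simp add: lap_def pp)
  qed
  define c where "c = (\<integral>x. h x \<partial>torus)"
  show thesis
  proof (rule that[of "\<lambda>x. h x - c"])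
    show "Ck 2 (\<lambda>x. h x - c)" by (intro Ck_diff h2 Ck_const)
    show "(\<integral>x. h x - c \<partial>torus) = 0"
      using Ck_integrable[OF h2] by (simp add: c_def torus.prob_space[simplified])
    have "pd i (\<lambda>x. h x - c) = pd i h" for i
      using Ck_2D(1)[OF h2] by (auto simp: pd_diff)
    then show "lap (\<lambda>x. h x - c) = w" using lap by (auto simp: lap_def)
  qed
qed

section \<open>Wente's inequality\<close>

definition br :: "(real^2 \<Rightarrow> real) \<Rightarrow> (real^2 \<Rightarrow> real) \<Rightarrow> real^2 \<Rightarrow> real" where
  "br a b x = pd 1 a x * pd 2 b x - pd 2 a x * pd 1 b x"

definition gnorm :: "(real^2 \<Rightarrow> real) \<Rightarrow> real" where
  "gnorm f = sqrt (\<integral>x. (pd 1 f x)\<^sup>2 + (pd 2 f x)\<^sup>2 \<partial>torus)"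

lemma gnorm_nonneg [simp]: "0 \<le> gnorm f"
  unfolding gnorm_def by (intro real_sqrt_ge_zero integral_nonneg_AE) auto

lemma gnorm_sq: "(gnorm f)\<^sup>2 = (\<integral>x. (pd 1 f x)\<^sup>2 + (pd 2 f x)\<^sup>2 \<partial>torus)"
  unfolding gnorm_def by (intro real_sqrt_pow2 integral_nonneg_AE) auto

text \<open>Gradient amplitude of a mode, stripped of the factor \<open>2 pi\<close>; this is why
  \<open>gnorm f / (2 * pi)\<close> appears in the bounds below.\<close>

definition wamp :: "(real^2 \<Rightarrow> real) \<Rightarrow> int \<times> int \<Rightarrow> real" where
  "wamp f k = sqrt (ksq k) * cmod (rfc f k)"

text \<open>Symbol of the bracket up to a constant: the oriented area spanned by two
  frequencies.\<close>

definition cross :: "int \<times> int \<Rightarrow> int \<times> int \<Rightarrow> real" where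
  "cross j k = freq 1 j * freq 2 k - freq 2 j * freq 1 k"

lemma ksq_nonneg [simp]: "0 \<le> ksq k" by (simp add: ksq_def)

lemma wamp_nonneg [simp]: "0 \<le> wamp f k" by (simp add: wamp_def)

lemma wamp_sum:
  assumes f: "Ck 1 f" and F: "finite F"
  shows "(\<Sum>k\<in>F. (wamp f k)\<^sup>2) \<le> (gnorm f / (2 * pi))\<^sup>2"
proof -
  have "((\<lambda>k. (cmod (rfc (pd 1 f) k))\<^sup>2 + (cmod (rfc (pd 2 f) k))\<^sup>2) has_sum
     ((\<integral>x. (pd 1 f x)\<^sup>2 \<partial>torus) + (\<integral>x. (pd 2 f x)\<^sup>2 \<partial>torus))) UNIV"
    by (intro has_sum_add Parseval_real Ck_1D(2)[OF f])
  moreover have "(\<integral>x. (pd 1 f x)\<^sup>2 \<partial>torus) + (\<integral>x. (pd 2 f x)\<^sup>2 \<partial>torus) = (gnorm f)\<^sup>2"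
    unfolding gnorm_sq using Ck_integrable[OF Ck_power[OF Ck_1D(2)[OF f]]]
    by (subst Bochner_Integration.integral_add) auto
  moreover have "(cmod (rfc (pd 1 f) k))\<^sup>2 + (cmod (rfc (pd 2 f) k))\<^sup>2 = (2 * pi)\<^sup>2 * (wamp f k)\<^sup>2" for k
    unfolding rfc_pd[OF f] wamp_def power_mult_distrib real_sqrt_pow2[OF ksq_nonneg] norm_mult
    by (simp add: ksq_def power_mult_distrib algebra_simps)
  ultimately have hs: "((\<lambda>k. (2 * pi)\<^sup>2 * (wamp f k)\<^sup>2) has_sum (gnorm f)\<^sup>2) UNIV" by simp
  have "((\<lambda>k. (2 * pi)\<^sup>2 * (wamp f k)\<^sup>2) has_sum (\<Sum>k\<in>F. (2 * pi)\<^sup>2 * (wamp f k)\<^sup>2)) F"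
    using F by (intro has_sum_finite)
  from has_sum_mono2[OF this hs] have "(\<Sum>k\<in>F. (2 * pi)\<^sup>2 * (wamp f k)\<^sup>2) \<le> (gnorm f)\<^sup>2" by simp
  then show ?thesis
    by (simp add: sum_distrib_left power_divide power_mult_distrib pos_le_divide_eq mult.commute)
qed

text \<open>The disc lies in a square of \<open>(2 n + 1)^2\<close> lattice points, where
  \<open>n\<close> is the integer part of the radius. As the radius is at least 1, the side is at
  most three times the radius; this is the origin of the constants 3 and 9 in Wente's
  inequality.\<close>

lemma card_small_frequencies:
  assumes "p \<noteq> 0"
  shows "finite {q. ksq q \<le> ksq p}" "real (card {q. ksq q \<le> ksq p}) \<le> 9 * ksq p"
proof -
  define n where "n = \<lfloor>sqrt (ksq p)\<rfloor>"
  have s1: "1 \<le> sqrt (ksq p)" using ksq_ge_1[OF assms] by simp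
  then have n: "1 \<le> n" "of_int n \<le> sqrt (ksq p)" unfolding n_def by (auto simp: le_floor_iff)
  have *: "\<bar>m\<bar> \<le> n" if "(of_int m)\<^sup>2 \<le> ksq p" for m :: int
  proof -
    have "of_int \<bar>m\<bar> \<le> sqrt (ksq p)" using real_le_rsqrt[of "\<bar>of_int m\<bar>" "ksq p"] that by simp
    then show ?thesis unfolding n_def by (simp add: le_floor_iff)
  qed
  have sub: "{q. ksq q \<le> ksq p} \<subseteq> {-n..n} \<times> {-n..n}"
  proof
    fix q assume "q \<in> {q. ksq q \<le> ksq p}"
    then have "(of_int (fst q))\<^sup>2 \<le> ksq p" "(of_int (snd q))\<^sup>2 \<le> ksq p"
      by (auto simp: ksq_def intro: order_trans[rotated])
    from *[OF this(1)] *[OF this(2)] show "q \<in> {-n..n} \<times> {-n..n}"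
      by (cases q) auto
  qed
  then show "finite {q. ksq q \<le> ksq p}" by (rule finite_subset) auto
  have "card {q. ksq q \<le> ksq p} \<le> card ({-n..n} \<times> {-n..n})" by (intro card_mono sub) auto
  then have "real (card {q. ksq q \<le> ksq p}) \<le> real (nat (2 * n + 1) * nat (2 * n + 1))"
    by (simp only: of_nat_le_iff card_cartesian_product card_atLeastAtMost_int) (simp add: algebra_simps)
  also have "\<dots> = (2 * of_int n + 1)\<^sup>2" using n(1) by (simp add: power2_eq_square)
  also have "\<dots> \<le> (3 * sqrt (ksq p))\<^sup>2" using n by (intro power_mono) auto
  also have "\<dots> = 9 * ksq p" by (simp add: power_mult_distrib)
  finally show "real (card {q. ksq q \<le> ksq p}) \<le> 9 * ksq p" .
qed

text \<open>Cauchy-Schwarz over \<open>R\<close>. In the first factor each \<open>p\<close> occurs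
  with at most \<open>9 ksq p\<close> indices \<open>q\<close>, which exactly absorbs the division
  by \<open>ksq p\<close>: dimension two is critical here, and the order between \<open>p\<close>
  and \<open>q\<close> is what avoids a logarithm. The second factor is a full double sum and splits
  because \<open>r\<close> is injective in \<open>p\<close>.\<close>

lemma convolution_bound:
  fixes X Y Z :: "int \<times> int \<Rightarrow> real"
  assumes R: "finite R" "\<And>p q. (p, q) \<in> R \<Longrightarrow> p \<noteq> 0 \<and> ksq q \<le> ksq p"
    and X: "\<And>F. finite F \<Longrightarrow> (\<Sum>k\<in>F. (X k)\<^sup>2) \<le> x\<^sup>2" and Y: "\<And>F. finite F \<Longrightarrow> (\<Sum>k\<in>F. (Y k)\<^sup>2) \<le> y\<^sup>2"
    and Z: "\<And>F. finite F \<Longrightarrow> (\<Sum>k\<in>F. (Z k)\<^sup>2) \<le> z\<^sup>2" and nn: "0 \<le> x" "0 \<le> y" "0 \<le> z"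
    and r: "\<And>q. inj (\<lambda>p. r p q)"
  shows "(\<Sum>(p, q)\<in>R. X p / sqrt (ksq p) * (Y q * Z (r p q))) \<le> 3 * x * y * z"
proof -
  let ?P = "fst ` R" and ?Q = "snd ` R"
  have fin: "finite ?P" "finite ?Q" using R(1) by auto
  have sub: "R \<subseteq> ?P \<times> ?Q" by force
  have "(\<Sum>(p, q)\<in>R. (X p / sqrt (ksq p))\<^sup>2) \<le> (\<Sum>(p, q)\<in>Sigma ?P (\<lambda>p. {q. ksq q \<le> ksq p}). (X p / sqrt (ksq p))\<^sup>2)"
  proof (rule sum_mono2)
    show "finite (Sigma ?P (\<lambda>p. {q. ksq q \<le> ksq p}))"
      using fin card_small_frequencies(1) R(2) by (intro finite_SigmaI) auto
    show "R \<subseteq> Sigma ?P (\<lambda>p. {q. ksq q \<le> ksq p})" using R(2) by force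
  qed auto
  also have "\<dots> = (\<Sum>p\<in>?P. \<Sum>q\<in>{q. ksq q \<le> ksq p}. (X p / sqrt (ksq p))\<^sup>2)"
    using fin card_small_frequencies(1) R(2) by (intro sum.Sigma[symmetric]) auto
  also have "\<dots> \<le> (\<Sum>p\<in>?P. 9 * (X p)\<^sup>2)"
  proof (rule sum_mono)
    fix p assume "p \<in> ?P"
    then have p: "p \<noteq> 0" using R(2) by auto
    then have k: "0 < ksq p" using ksq_ge_1[OF p] by linarith
    have "(\<Sum>q\<in>{q. ksq q \<le> ksq p}. (X p / sqrt (ksq p))\<^sup>2) = real (card {q. ksq q \<le> ksq p}) * ((X p)\<^sup>2 / ksq p)"
      using k by (simp add: power_divide)
    also have "\<dots> \<le> (9 * ksq p) * ((X p)\<^sup>2 / ksq p)"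
      using k by (intro mult_right_mono card_small_frequencies p) auto
    finally show "(\<Sum>q\<in>{q. ksq q \<le> ksq p}. (X p / sqrt (ksq p))\<^sup>2) \<le> 9 * (X p)\<^sup>2" using k by simp
  qed
  also have "\<dots> \<le> 9 * x\<^sup>2" using X[OF fin(1)] by (simp add: sum_distrib_left[symmetric])
  finally have b1: "(\<Sum>(p, q)\<in>R. (X p / sqrt (ksq p))\<^sup>2) \<le> (3 * x)\<^sup>2" by (simp add: power_mult_distrib)
  have "(\<Sum>(p, q)\<in>R. (Y q * Z (r p q))\<^sup>2) \<le> (\<Sum>(p, q)\<in>?P \<times> ?Q. (Y q * Z (r p q))\<^sup>2)"
    using fin sub by (intro sum_mono2) auto
  also have "\<dots> = (\<Sum>q\<in>?Q. \<Sum>p\<in>?P. (Y q * Z (r p q))\<^sup>2)"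
    by (subst sum.swap) (simp only: sum.cartesian_product)
  also have "\<dots> = (\<Sum>q\<in>?Q. (Y q)\<^sup>2 * (\<Sum>k\<in>(\<lambda>p. r p q) ` ?P. (Z k)\<^sup>2))"
    by (simp add: sum.reindex[OF inj_on_subset[OF r]] power_mult_distrib sum_distrib_left)
  also have "\<dots> \<le> (\<Sum>q\<in>?Q. (Y q)\<^sup>2 * z\<^sup>2)"
    using fin by (intro sum_mono mult_left_mono Z) auto
  also have "\<dots> \<le> y\<^sup>2 * z\<^sup>2"
    unfolding sum_distrib_right[symmetric] by (intro mult_right_mono Y fin) auto
  finally have b2: "(\<Sum>(p, q)\<in>R. (Y q * Z (r p q))\<^sup>2) \<le> (y * z)\<^sup>2" by (simp add: power_mult_distrib)
  have "(\<Sum>(p, q)\<in>R. X p / sqrt (ksq p) * (Y q * Z (r p q)))\<^sup>2 \<le>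
      (\<Sum>(p, q)\<in>R. (X p / sqrt (ksq p))\<^sup>2) * (\<Sum>(p, q)\<in>R. (Y q * Z (r p q))\<^sup>2)"
    using Cauchy_Schwarz_ineq_sum[of "\<lambda>(p, q). X p / sqrt (ksq p)" "\<lambda>(p, q). Y q * Z (r p q)" R]
    by (simp only: case_prod_unfold)
  also have "\<dots> \<le> (3 * x)\<^sup>2 * (y * z)\<^sup>2"
    by (intro mult_mono b1 b2) (auto intro!: sum_nonneg)
  finally have "(\<Sum>(p, q)\<in>R. X p / sqrt (ksq p) * (Y q * Z (r p q)))\<^sup>2 \<le> (3 * x * y * z)\<^sup>2"
    by (simp add: power_mult_distrib)
  moreover have "0 \<le> 3 * x * y * z" using nn by simp
  ultimately show ?thesis by (rule power2_le_imp_le)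
qed

text \<open>Lagrange's identity in the plane.\<close>

lemma cross_le: "\<bar>cross j k\<bar> \<le> sqrt (ksq j) * sqrt (ksq k)"
proof -
  have "(cross j k)\<^sup>2 \<le> (cross j k)\<^sup>2 + (freq 1 j * freq 1 k + freq 2 j * freq 2 k)\<^sup>2" by simp
  also have "\<dots> = ksq j * ksq k" by (simp add: cross_def ksq_def power2_eq_square algebra_simps)
  finally have "\<bar>cross j k\<bar> \<le> sqrt (ksq j * ksq k)" by (simp add: real_le_rsqrt)
  then show ?thesis by (simp add: real_sqrt_mult)
qed

text \<open>The kernel of the trilinear form is the inverse diameter of the circumscribed circle of the
  triangle \<open>j + k = l\<close>, hence at most the inverse of its longest side.\<close>

lemma trilinear_bound:
  assumes a: "Ck 1 a" and b: "Ck 1 b" and f: "Ck 1 f" and L: "finite L" and J: "finite J"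
  shows "(\<Sum>l\<in>L. \<Sum>j\<in>J. \<bar>cross j (l - j)\<bar> * cmod (rfc a j) * cmod (rfc b (l - j)) * cmod (rfc f l))
    \<le> 9 * (gnorm a / (2 * pi)) * (gnorm b / (2 * pi)) * (gnorm f / (2 * pi))"
proof -
  let ?A = "wamp a" and ?B = "wamp b" and ?F = "wamp f"
  define t where "t l j = \<bar>cross j (l - j)\<bar> * cmod (rfc a j) * cmod (rfc b (l - j)) * cmod (rfc f l)" for l j
  define R where "R = {(l, j) \<in> L \<times> J. l \<noteq> 0 \<and> j \<noteq> 0 \<and> l - j \<noteq> 0}"
  \<comment> \<open>In each region one side of the triangle dominates the frequency that
    \<open>convolution_bound\<close> takes as \<open>q\<close>, and the kernel is estimated by the
    inverse of this dominating side.\<close>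
  define R1 where "R1 = {(l, j) \<in> R. ksq l \<le> ksq j}"
  define R2 where "R2 = {(l, j) \<in> R. ksq l \<le> ksq (l - j)}"
  define R3 where "R3 = {(l, j) \<in> R. ksq j \<le> ksq l}"
  have fin: "finite R" "finite R1" "finite R2" "finite R3"
    unfolding R_def R1_def R2_def R3_def using L J by (auto intro: finite_subset[of _ "L \<times> J"])
  have t0: "0 \<le> t l j" for l j by (simp add: t_def)
  \<comment> \<open>The area of the triangle can be computed from any two of its sides;
    \<open>t1\<close>, \<open>t2\<close> and \<open>t3\<close> each use the pair that leaves the
    third side in the denominator.\<close>
  have cr: "cross j (l - j) = cross j l" "cross j (l - j) = cross l (l - j)" for l j
    by (simp_all add: cross_def algebra_simps)
  have s: "0 < sqrt (ksq k)" if "k \<noteq> 0" for k using ksq_ge_1[OF that] by simp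
  have t1: "t l j \<le> ?A j / sqrt (ksq j) * (?F l * ?B (l - j))" if "(l, j) \<in> R" for l j
  proof -
    have nz: "l \<noteq> 0" "j \<noteq> 0" "l - j \<noteq> 0" using that by (auto simp: R_def)
    have "t l j \<le> (sqrt (ksq l) * sqrt (ksq (l - j))) * cmod (rfc a j) * cmod (rfc b (l - j)) * cmod (rfc f l)"
      unfolding t_def using cross_le[of l "l - j"] cr(2)[where l = l and j = j] by (intro mult_right_mono) auto
    also have "\<dots> = ?A j / sqrt (ksq j) * (?F l * ?B (l - j))" using s[OF nz(2)] by (simp add: wamp_def)
    finally show ?thesis .
  qed
  have t2: "t l j \<le> ?B (l - j) / sqrt (ksq (l - j)) * (?F l * ?A j)" if "(l, j) \<in> R" for l j
  proof -
    have nz: "l \<noteq> 0" "j \<noteq> 0" "l - j \<noteq> 0" using that by (auto simp: R_def)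
    have "t l j \<le> (sqrt (ksq j) * sqrt (ksq l)) * cmod (rfc a j) * cmod (rfc b (l - j)) * cmod (rfc f l)"
      unfolding t_def cr(1) by (intro mult_right_mono cross_le) auto
    also have "\<dots> = ?B (l - j) / sqrt (ksq (l - j)) * (?F l * ?A j)" using s[OF nz(3)] by (simp add: wamp_def)
    finally show ?thesis .
  qed
  have t3: "t l j \<le> ?F l / sqrt (ksq l) * (?A j * ?B (l - j))" if "(l, j) \<in> R" for l j
  proof -
    have nz: "l \<noteq> 0" "j \<noteq> 0" "l - j \<noteq> 0" using that by (auto simp: R_def)
    have "t l j \<le> (sqrt (ksq j) * sqrt (ksq (l - j))) * cmod (rfc a j) * cmod (rfc b (l - j)) * cmod (rfc f l)"
      unfolding t_def by (intro mult_right_mono cross_le) auto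
    also have "\<dots> = ?F l / sqrt (ksq l) * (?A j * ?B (l - j))" using s[OF nz(1)] by (simp add: wamp_def)
    finally show ?thesis .
  qed
  note W = wamp_sum[OF a] wamp_sum[OF b] wamp_sum[OF f]
  have nn: "0 \<le> gnorm g / (2 * pi)" for g by simp
  define G where "G = (gnorm a / (2 * pi)) * (gnorm b / (2 * pi)) * (gnorm f / (2 * pi))"
  have "(\<Sum>(l, j)\<in>R1. t l j) \<le> (\<Sum>(l, j)\<in>R1. ?A j / sqrt (ksq j) * (?F l * ?B (l - j)))"
    using t1 by (intro sum_mono) (auto simp: R1_def)
  also have "\<dots> = (\<Sum>(p, q)\<in>(\<lambda>(l, j). (j, l)) ` R1. ?A p / sqrt (ksq p) * (?F q * ?B (q - p)))"
    by (subst sum.reindex) (auto simp: inj_on_def case_prod_unfold)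
  also have "\<dots> \<le> 3 * (gnorm a / (2 * pi)) * (gnorm f / (2 * pi)) * (gnorm b / (2 * pi))"
    by (rule convolution_bound[where r = "\<lambda>p q. q - p"]) (use fin in \<open>auto simp: R1_def R_def inj_def intro!: W\<close>)
  finally have s1: "(\<Sum>(l, j)\<in>R1. t l j) \<le> 3 * G" by (simp add: G_def mult_ac)
  have "(\<Sum>(l, j)\<in>R2. t l j) \<le> (\<Sum>(l, j)\<in>R2. ?B (l - j) / sqrt (ksq (l - j)) * (?F l * ?A j))"
    using t2 by (intro sum_mono) (auto simp: R2_def)
  also have "\<dots> = (\<Sum>(p, q)\<in>(\<lambda>(l, j). (l - j, l)) ` R2. ?B p / sqrt (ksq p) * (?F q * ?A (q - p)))"
    by (subst sum.reindex) (auto simp: inj_on_def case_prod_unfold)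
  also have "\<dots> \<le> 3 * (gnorm b / (2 * pi)) * (gnorm f / (2 * pi)) * (gnorm a / (2 * pi))"
  proof (rule convolution_bound[where r = "\<lambda>p q. q - p"])
    fix p q assume "(p, q) \<in> (\<lambda>(l, j). (l - j, l)) ` R2"
    then obtain l j where "(l, j) \<in> R2" "p = l - j" "q = l" by auto
    then show "p \<noteq> 0 \<and> ksq q \<le> ksq p" by (simp add: R2_def R_def)
  qed (use fin in \<open>auto simp: inj_def intro!: W\<close>)
  finally have s2: "(\<Sum>(l, j)\<in>R2. t l j) \<le> 3 * G" by (simp add: G_def mult_ac)
  have "(\<Sum>(l, j)\<in>R3. t l j) \<le> (\<Sum>(l, j)\<in>R3. ?F l / sqrt (ksq l) * (?A j * ?B (l - j)))"
    using t3 by (intro sum_mono) (auto simp: R3_def)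
  also have "\<dots> \<le> 3 * (gnorm f / (2 * pi)) * (gnorm a / (2 * pi)) * (gnorm b / (2 * pi))"
    by (rule convolution_bound[where r = "\<lambda>p q. p - q"]) (use fin in \<open>auto simp: R3_def R_def inj_def intro!: W\<close>)
  finally have s3: "(\<Sum>(l, j)\<in>R3. t l j) \<le> 3 * G" by (simp add: G_def mult_ac)
  have "(\<Sum>l\<in>L. \<Sum>j\<in>J. t l j) = (\<Sum>(l, j)\<in>L \<times> J. t l j)" by (rule sum.cartesian_product)
  \<comment> \<open>A triangle with a vanishing side has area zero, so the excluded pairs contribute
    nothing.\<close>
  also have "\<dots> = (\<Sum>(l, j)\<in>R. t l j)"
    using L J by (intro sum.mono_neutral_right) (auto simp: R_def t_def cross_def freq_def)
  also have "\<dots> \<le> (\<Sum>(l, j)\<in>R1 \<union> R2 \<union> R3. t l j)"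
    using fin t0 by (intro sum_mono2) (auto simp: R1_def R2_def R3_def)
  also have "\<dots> \<le> (\<Sum>(l, j)\<in>R1 \<union> R2. t l j) + (\<Sum>(l, j)\<in>R3. t l j)"
    using fin sum_nonneg[of "(R1 \<union> R2) \<inter> R3" "\<lambda>(l, j). t l j"] t0 by (subst sum_Un) auto
  also have "\<dots> \<le> (\<Sum>(l, j)\<in>R1. t l j) + (\<Sum>(l, j)\<in>R2. t l j) + (\<Sum>(l, j)\<in>R3. t l j)"
    using fin sum_nonneg[of "R1 \<inter> R2" "\<lambda>(l, j). t l j"] t0 by (subst sum_Un) auto
  also have "\<dots> \<le> 9 * G" using s1 s2 s3 by linarith
  finally show ?thesis by (simp add: t_def G_def)
qed

text \<open>Convolution theorem, as Parseval for \<open>a\<close> against \<open>b\<close> modulated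
  by the character \<open>l\<close>; since \<open>b\<close> is real, conjugating the modulated
  coefficient gives the one at \<open>l - j\<close>.\<close>

lemma rfc_mult:
  assumes a: "Ck 0 a" and b: "Ck 0 b"
  shows "((\<lambda>j. rfc a j * rfc b (l - j)) has_sum rfc (\<lambda>x. a x * b x) l) UNIV"
proof -
  let ?G = "\<lambda>x. of_real (b x) * character l x"
  have "((\<lambda>j. rfc a j * cnj (fc ?G j)) has_sum (\<integral>x. of_real (a x) * cnj (?G x) \<partial>torus)) UNIV"
    unfolding rfc_def by (intro Parseval cper_of_real[OF a] cper_intros cper_of_real[OF b] cper_character)
  moreover have "cnj (fc ?G j) = rfc b (l - j)" for j
  proof -
    have "cnj (fc ?G j) = (\<integral>x. cnj (?G x * character (- j) x) \<partial>torus)"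
      unfolding fc_def by (rule Bochner_Integration.integral_cnj[symmetric])
    also have "\<dots> = rfc b (l - j)"
      unfolding rfc_def fc_def by (simp add: character_add[symmetric] mult.assoc)
    finally show ?thesis .
  qed
  moreover have "(\<integral>x. of_real (a x) * cnj (?G x) \<partial>torus) = rfc (\<lambda>x. a x * b x) l"
    by (simp add: rfc_def fc_def mult.assoc)
  ultimately show ?thesis by simp
qed

text \<open>Parseval writes the pairing as a sum over \<open>l\<close>, and the convolution theorem
  writes each bracket coefficient as a sum over \<open>j\<close>. The finite trilinear sums are
  bounded uniformly, so the limit may be taken in \<open>j\<close> for fixed finite \<open>L\<close>
  and afterwards in \<open>L\<close>.\<close>

theorem Wente:
  assumes a: "Ck 1 a" and b: "Ck 1 b" and f: "Ck 1 f"
  shows "\<bar>\<integral>x. br a b x * f x \<partial>torus\<bar> \<le> 9 * gnorm a * gnorm b * gnorm f"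
proof -
  define C where "C = 9 * (gnorm a / (2 * pi)) * (gnorm b / (2 * pi)) * (gnorm f / (2 * pi))"
  have C0: "0 \<le> C" by (simp add: C_def)
  have brC: "Ck 0 (br a b)" unfolding br_def by (intro Ck_diff Ck_mult Ck_1D a b)
  have hs: "((\<lambda>j. of_real (- 4 * pi\<^sup>2 * cross j (l - j)) * rfc a j * rfc b (l - j)) has_sum rfc (br a b) l) UNIV" for l
  proof -
    have "((\<lambda>j. rfc (pd 1 a) j * rfc (pd 2 b) (l - j) + (-1) * (rfc (pd 2 a) j * rfc (pd 1 b) (l - j))) has_sum
      (rfc (\<lambda>x. pd 1 a x * pd 2 b x) l + (-1) * rfc (\<lambda>x. pd 2 a x * pd 1 b x) l)) UNIV"
      by (intro has_sum_add has_sum_cmult_right rfc_mult Ck_1D(2) a b)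
    moreover have "rfc (\<lambda>x. pd 1 a x * pd 2 b x) l + (-1) * rfc (\<lambda>x. pd 2 a x * pd 1 b x) l = rfc (br a b) l"
      unfolding br_def by (subst rfc_diff) (auto intro!: Ck_mult Ck_1D(2) a b)
    moreover have "rfc (pd 1 a) j * rfc (pd 2 b) (l - j) + (-1) * (rfc (pd 2 a) j * rfc (pd 1 b) (l - j)) =
        of_real (- 4 * pi\<^sup>2 * cross j (l - j)) * rfc a j * rfc b (l - j)" for j
    proof -
      have "rfc (pd 1 a) j * rfc (pd 2 b) (l - j) + (-1) * (rfc (pd 2 a) j * rfc (pd 1 b) (l - j)) =
        (\<i> * \<i>) * (4 * of_real pi ^ 2 * (freq 1 j * freq 2 (l - j) - freq 2 j * freq 1 (l - j)) * rfc a j * rfc b (l - j))"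
        unfolding rfc_pd[OF a] rfc_pd[OF b] by (simp add: power2_eq_square algebra_simps)
      then show ?thesis by (simp add: cross_def)
    qed
    ultimately show ?thesis by simp
  qed
  have fin: "(\<Sum>l\<in>L. cmod (rfc (br a b) l) * cmod (rfc f l)) \<le> 4 * pi\<^sup>2 * C" if L: "finite L" for L
  proof -
    have lim: "((\<lambda>J. \<Sum>l\<in>L. cmod (\<Sum>j\<in>J. of_real (- 4 * pi\<^sup>2 * cross j (l - j)) * rfc a j * rfc b (l - j)) * cmod (rfc f l))
       \<longlongrightarrow> (\<Sum>l\<in>L. cmod (rfc (br a b) l) * cmod (rfc f l))) (finite_subsets_at_top UNIV)"
      by (intro tendsto_intros) (use hs in \<open>simp add: has_sum_def\<close>)
    show ?thesis
    proof (rule tendsto_upperbound[OF lim])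
      show "\<forall>\<^sub>F J in finite_subsets_at_top UNIV.
         (\<Sum>l\<in>L. cmod (\<Sum>j\<in>J. of_real (- 4 * pi\<^sup>2 * cross j (l - j)) * rfc a j * rfc b (l - j)) * cmod (rfc f l)) \<le> 4 * pi\<^sup>2 * C"
      proof (rule eventually_finite_subsets_at_top_weakI)
        fix J :: "(int \<times> int) set" assume J: "finite J"
        have "(\<Sum>l\<in>L. cmod (\<Sum>j\<in>J. of_real (- 4 * pi\<^sup>2 * cross j (l - j)) * rfc a j * rfc b (l - j)) * cmod (rfc f l))
          \<le> (\<Sum>l\<in>L. (\<Sum>j\<in>J. cmod (of_real (- 4 * pi\<^sup>2 * cross j (l - j)) * rfc a j * rfc b (l - j))) * cmod (rfc f l))"
          by (intro sum_mono mult_right_mono norm_sum) auto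
        also have "\<dots> = 4 * pi\<^sup>2 * (\<Sum>l\<in>L. \<Sum>j\<in>J. \<bar>cross j (l - j)\<bar> * cmod (rfc a j) * cmod (rfc b (l - j)) * cmod (rfc f l))"
          unfolding sum_distrib_left sum_distrib_right norm_mult norm_of_real by (simp add: abs_mult mult_ac)
        also have "\<dots> \<le> 4 * pi\<^sup>2 * C"
          unfolding C_def by (intro mult_left_mono trilinear_bound a b f L J) auto
        finally show "(\<Sum>l\<in>L. cmod (\<Sum>j\<in>J. of_real (- 4 * pi\<^sup>2 * cross j (l - j)) * rfc a j * rfc b (l - j)) * cmod (rfc f l))
          \<le> 4 * pi\<^sup>2 * C" .
      qed
    qed simp
  qed
  have P: "((\<lambda>k. rfc (br a b) k * cnj (rfc f k)) has_sum (\<integral>x. complex_of_real (br a b x) * cnj (of_real (f x)) \<partial>torus)) UNIV"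
    unfolding rfc_def by (intro Parseval cper_of_real[OF brC] cper_of_real[OF f])
  have eq: "(\<integral>x. complex_of_real (br a b x) * cnj (of_real (f x)) \<partial>torus) = of_real (\<integral>x. br a b x * f x \<partial>torus)"
    by (simp flip: of_real_mult integral_complex_of_real)
  have "cmod (of_real (\<integral>x. br a b x * f x \<partial>torus)) \<le> 4 * pi\<^sup>2 * C"
  proof (rule tendsto_upperbound[OF tendsto_norm[OF P[unfolded has_sum_def eq]]])
    show "\<forall>\<^sub>F L in finite_subsets_at_top UNIV. cmod (\<Sum>k\<in>L. rfc (br a b) k * cnj (rfc f k)) \<le> 4 * pi\<^sup>2 * C"
    proof (rule eventually_finite_subsets_at_top_weakI)
      fix L :: "(int \<times> int) set" assume "finite L"
      then show "cmod (\<Sum>k\<in>L. rfc (br a b) k * cnj (rfc f k)) \<le> 4 * pi\<^sup>2 * C"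
        using fin[of L] by (intro order_trans[OF norm_sum]) (simp add: norm_mult)
    qed
  qed simp
  \<comment> \<open>The symbol contributes \<open>4 pi^2\<close> and each of the three amplitudes
    \<open>1 / (2 pi)\<close>; the remaining \<open>1 / (2 pi)\<close> is discarded.\<close>
  also have "4 * pi\<^sup>2 * C = (9 * gnorm a * gnorm b * gnorm f) / (2 * pi)"
    by (simp add: C_def field_simps power2_eq_square)
  also have "\<dots> \<le> (9 * gnorm a * gnorm b * gnorm f) / 1"
    using pi_ge_two by (intro divide_left_mono) auto
  finally show ?thesis by simp
qed

section \<open>Couplings of torus densities\<close>

definition mix :: "real \<Rightarrow> 'a measure \<Rightarrow> 'a measure \<Rightarrow> 'a measure" where
  "mix p M N = measure_of (space M) (sets M) (\<lambda>A. ennreal p * emeasure M A + ennreal (1 - p) * emeasure N A)"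

lemma sets_mix [simp, measurable_cong]: "sets (mix p M N) = sets M"
  and space_mix [simp]: "space (mix p M N) = space M"
  by (simp_all add: mix_def)

lemma emeasure_mix:
  assumes N: "sets N = sets M" and A: "A \<in> sets M"
  shows "emeasure (mix p M N) A = ennreal p * emeasure M A + ennreal (1 - p) * emeasure N A"
  unfolding mix_def
proof (rule emeasure_measure_of_sigma)
  show "sigma_algebra (space M) (sets M)" ..
  show "positive (sets M) (\<lambda>A. ennreal p * emeasure M A + ennreal (1 - p) * emeasure N A)"
    by (simp add: positive_def)
  show "countably_additive (sets M) (\<lambda>A. ennreal p * emeasure M A + ennreal (1 - p) * emeasure N A)"
  proof (rule countably_additiveI)
    fix B :: "nat \<Rightarrow> 'a set" assume B: "range B \<subseteq> sets M" "disjoint_family B"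
    show "(\<Sum>i. ennreal p * emeasure M (B i) + ennreal (1 - p) * emeasure N (B i)) =
      ennreal p * emeasure M (\<Union> (range B)) + ennreal (1 - p) * emeasure N (\<Union> (range B))"
      using suminf_emeasure[of B M] suminf_emeasure[of B N] B N
      by (simp add: suminf_add[symmetric] ennreal_suminf_cmult)
  qed
qed (rule A)

lemma nn_integral_mix:
  assumes N: "sets N = sets M" and f: "f \<in> borel_measurable M"
  shows "(\<integral>\<^sup>+x. f x \<partial>mix p M N) = ennreal p * (\<integral>\<^sup>+x. f x \<partial>M) + ennreal (1 - p) * (\<integral>\<^sup>+x. f x \<partial>N)"
  using f
proof (induction rule: borel_measurable_induct)
  case (cong f g)
  have "(\<integral>\<^sup>+x. f x \<partial>mix p M N) = (\<integral>\<^sup>+x. g x \<partial>mix p M N)" "(\<integral>\<^sup>+x. f x \<partial>M) = (\<integral>\<^sup>+x. g x \<partial>M)"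
    "(\<integral>\<^sup>+x. f x \<partial>N) = (\<integral>\<^sup>+x. g x \<partial>N)"
    using cong(3) sets_eq_imp_space_eq[OF N] by (auto intro!: nn_integral_cong)
  with cong show ?case by simp
next
  case (set A)
  then show ?case using emeasure_mix[OF N set] N by simp
next
  case (mult f c)
  have f: "f \<in> borel_measurable (mix p M N)" "f \<in> borel_measurable N"
    using mult(2) N by (simp_all cong: measurable_cong_sets)
  then show ?case using mult by (simp add: nn_integral_cmult distrib_left mult.left_commute)
next
  case (add f g)
  have f: "f \<in> borel_measurable (mix p M N)" "f \<in> borel_measurable N"
    "g \<in> borel_measurable (mix p M N)" "g \<in> borel_measurable N"
    using add N by (simp_all cong: measurable_cong_sets)
  then show ?case using add by (simp add: nn_integral_add distrib_left add_ac)
next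
  case (seq F)
  have F: "F i \<in> borel_measurable (mix p M N)" "F i \<in> borel_measurable N" for i
    using seq(1) N by (simp_all cong: measurable_cong_sets)
  have i: "incseq (\<lambda>i. ennreal q * (\<integral>\<^sup>+x. F i x \<partial>L))" for q L
    using seq(3) by (auto simp: incseq_def le_fun_def intro!: mult_left_mono nn_integral_mono)
  have S: "(\<integral>\<^sup>+x. (SUP i. F i) x \<partial>L) = (SUP i. \<integral>\<^sup>+x. F i x \<partial>L)" if "\<And>i. F i \<in> borel_measurable L" for L
    using nn_integral_monotone_convergence_SUP[OF seq(3) that] by (simp add: image_comp)
  show ?case unfolding S[OF F(1)] S[OF F(2)] S[OF seq(1)] seq.IH
    by (simp add: SUP_mult_left_ennreal ennreal_SUP_add[OF i i])
qed

section \<open>Cell representatives and the torus distance\<close>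

definition cell_part :: "real^2 \<Rightarrow> real^2" where
  "cell_part x = x - lattice_point (\<lfloor>x $ 1\<rfloor>, \<lfloor>x $ 2\<rfloor>)"

lemma cell_part_in: "cell_part x \<in> unit_cell"
  by (simp add: cell_part_def unit_cell_iff) linarith

lemma cell_part_id: "x \<in> unit_cell \<Longrightarrow> cell_part x = x"
proof -
  assume "x \<in> unit_cell"
  then have "\<lfloor>x $ 1\<rfloor> = 0" "\<lfloor>x $ 2\<rfloor> = 0" by (auto simp: unit_cell_iff floor_eq_iff)
  then show ?thesis by (simp add: cell_part_def vec_eq_iff forall_2)
qed

lemma cell_part_periodic: "cell_part (x + lattice_point k) = cell_part x"
  by (simp add: cell_part_def vec_eq_iff forall_2)

lemma cell_part_borel [measurable]: "cell_part \<in> borel_measurable borel"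
proof -
  have "cell_part = (\<lambda>x. (x $ 1 - of_int \<lfloor>x $ 1\<rfloor>) *\<^sub>R axis 1 1 + (x $ 2 - of_int \<lfloor>x $ 2\<rfloor>) *\<^sub>R axis 2 1)"
    by (rule ext) (simp add: cell_part_def vec_eq_iff forall_2 axis_def)
  moreover have "\<dots> \<in> borel_measurable borel" by measurable
  ultimately show ?thesis by simp
qed

lemma torus_dist_eq: "torus_dist x y = (INF k. dist x (y + lattice_point k))"
  by (simp add: torus_dist_def int_lattice_eq image_comp)

lemma torus_dist_le: "torus_dist x y \<le> dist x (y + lattice_point k)"
  unfolding torus_dist_eq by (rule cINF_lower) (auto intro!: bdd_belowI[of _ 0])

lemma torus_dist_nonneg: "0 \<le> torus_dist x y"
  unfolding torus_dist_eq by (rule cINF_greatest) auto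

lemma torus_dist_cell_part_le: "torus_dist x (cell_part y) \<le> dist x y"
  using torus_dist_le[of x "cell_part y" "(\<lfloor>y $ 1\<rfloor>, \<lfloor>y $ 2\<rfloor>)"] by (simp add: cell_part_def)

text \<open>A crude diameter bound; it prices the small mass that is coupled without regard to
  distance and produces the term \<open>2 * (1 - p)\<close> in \<open>W2_le_map\<close>.\<close>

lemma torus_dist_unit_cell_le:
  assumes "x \<in> unit_cell" "y \<in> unit_cell"
  shows "(torus_dist x y)\<^sup>2 \<le> 2"
proof -
  have "(torus_dist x y)\<^sup>2 \<le> (dist x y)\<^sup>2"
  proof -
    have "lattice_point 0 = 0" by (simp add: vec_eq_iff forall_2)
    then show ?thesis
      using torus_dist_le[of x y 0] torus_dist_nonneg[of x y] by (intro power_mono) simp_all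
  qed
  also have "\<dots> = (x $ 1 - y $ 1)\<^sup>2 + (x $ 2 - y $ 2)\<^sup>2"
    by (simp add: dist_norm norm_vec_def L2_set_def sum_2)
  also have "\<dots> \<le> 1 + 1"
    using assms by (intro add_mono; simp add: abs_square_le_1 unit_cell_iff; linarith)
  finally show ?thesis by simp
qed

lemma torus_dist_measurable: "(\<lambda>(x, y). torus_dist x y) \<in> borel_measurable (borel \<Otimes>\<^sub>M borel)"
  unfolding torus_dist_eq case_prod_unfold
  by (intro borel_measurable_cINF) (auto intro!: bdd_belowI[of _ 0])

lemma sets_torus_density [simp, measurable_cong]: "sets (torus_density m) = sets torus"
  and space_torus_density [simp]: "space (torus_density m) = unit_cell"
  by (simp_all add: torus_density_def)

lemma emeasure_torus_density:
  assumes m: "Ck n m" "\<And>x. 0 \<le> m x" and A: "A \<in> sets torus"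
  shows "emeasure (torus_density m) A = ennreal (\<integral>x. indicator A x * m x \<partial>torus)"
proof -
  have [measurable]: "m \<in> borel_measurable torus"
    by (rule measurable_torus) (auto intro: continuous_borel Ck_continuous[OF m(1)])
  have i: "integrable torus (\<lambda>x. indicator A x * m x)"
    using integrable_mult_indicator[OF A Ck_integrable[OF m(1)]] by simp
  have "emeasure (torus_density m) A = (\<integral>\<^sup>+x. ennreal (m x) * indicator A x \<partial>torus)"
    unfolding torus_density_def by (rule emeasure_density) (auto simp: A)
  also have "\<dots> = (\<integral>\<^sup>+x. ennreal (indicator A x * m x) \<partial>torus)"
    by (intro nn_integral_cong) (auto simp: indicator_def)
  also have "\<dots> = ennreal (\<integral>x. indicator A x * m x \<partial>torus)"
    by (rule nn_integral_eq_integral[OF i]) (auto simp: m(2))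
  finally show ?thesis .
qed

lemma prob_space_torus_density:
  assumes m: "Ck n m" "\<And>x. 0 \<le> m x" "(\<integral>x. m x \<partial>torus) = 1"
  shows "prob_space (torus_density m)"
proof (rule prob_spaceI)
  have "unit_cell \<in> sets torus" using sets.top[of torus] by simp
  from emeasure_torus_density[OF m(1,2) this]
  have "emeasure (torus_density m) unit_cell = ennreal (\<integral>x. indicator unit_cell x * m x \<partial>torus)" .
  also have "(\<integral>x. indicator unit_cell x * m x \<partial>torus) = (\<integral>x. m x \<partial>torus)"
    by (intro Bochner_Integration.integral_cong) auto
  finally show "emeasure (torus_density m) (space (torus_density m)) = 1" by (simp add: m)
qed

text \<open>The graph of \<open>S\<close>, weighted by \<open>p\<close>, is completed to a coupling by the product of the remaining
  parts of the two densities.\<close>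

lemma W2_le_map:
  fixes S :: "real^2 \<Rightarrow> real^2"
  assumes m0: "Ck n m0" "\<And>x. 0 \<le> m0 x" "(\<integral>x. m0 x \<partial>torus) = 1"
    and m1: "Ck n m1" "\<And>x. 0 \<le> m1 x" "(\<integral>x. m1 x \<partial>torus) = 1"
    and S: "continuous_on UNIV S" and p: "0 < p" "p < 1"
    and push: "\<And>F. F \<in> borel_measurable borel \<Longrightarrow> periodic F \<Longrightarrow> (\<And>x. 0 \<le> F x) \<Longrightarrow> (\<And>x. F x \<le> 1) \<Longrightarrow>
       p * (\<integral>x. F (S x) * m0 x \<partial>torus) \<le> (\<integral>x. F x * m1 x \<partial>torus)"
    and cost: "(\<integral>x. (dist x (S x))\<^sup>2 * m0 x \<partial>torus) \<le> Q"
  shows "W2 (torus_density m0) (torus_density m1) \<le> sqrt (p * Q + 2 * (1 - p))"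
proof -
  let ?M0 = "torus_density m0" and ?M1 = "torus_density m1"
  interpret M0: prob_space ?M0 by (rule prob_space_torus_density[OF m0])
  interpret M1: prob_space ?M1 by (rule prob_space_torus_density[OF m1])
  define g where "g x = cell_part (S x)" for x
  have [measurable]: "S \<in> borel_measurable borel" by (rule continuous_borel[OF S])
  have gb [measurable]: "g \<in> borel_measurable borel" unfolding g_def by measurable
  have gm [measurable]: "g \<in> measurable torus torus"
    unfolding torus_def using cell_part_in
    by (intro measurable_restrict_space2 measurable_restrict_space1) (auto simp: g_def[abs_def])
  have g0 [measurable]: "g \<in> measurable ?M0 torus" using gm by (simp cong: measurable_cong_sets)
  have m0b [measurable]: "m0 \<in> borel_measurable borel" and m1b [measurable]: "m1 \<in> borel_measurable borel"
    using m0(1) m1(1) by (auto intro: continuous_borel Ck_continuous)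
  define M' where "M' = distr ?M0 torus g"
  interpret M': prob_space M' unfolding M'_def by (rule M0.prob_space_distr[OF g0])
  have setsM' [simp, measurable_cong]: "sets M' = sets torus" by (simp add: M'_def)
  have le: "ennreal p * emeasure M' A \<le> emeasure ?M1 A" if A: "A \<in> sets torus" for A
  proof -
    have Ab: "A \<in> sets borel" "A \<subseteq> unit_cell"
      using A unfolding torus_def by (auto simp: sets_restrict_space)
    have gA: "g -` A \<inter> unit_cell \<in> sets torus" using measurable_sets[OF gm A] by simp
    \<comment> \<open>Composition with \<open>cell_part\<close> makes the indicator periodic, so
      that \<open>push\<close> applies, and changes nothing on the cell.\<close>
    define F where "F x = (indicator A (cell_part x) :: real)" for x
    have Fm [measurable]: "F \<in> borel_measurable borel" unfolding F_def using Ab(1) by measurable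
    have "emeasure M' A = emeasure ?M0 (g -` A \<inter> unit_cell)"
      unfolding M'_def using A by (subst emeasure_distr) auto
    also have "\<dots> = ennreal (\<integral>x. indicator (g -` A \<inter> unit_cell) x * m0 x \<partial>torus)"
      by (rule emeasure_torus_density[OF m0(1,2) gA])
    also have "(\<integral>x. indicator (g -` A \<inter> unit_cell) x * m0 x \<partial>torus) = (\<integral>x. F (S x) * m0 x \<partial>torus)"
      by (intro Bochner_Integration.integral_cong) (auto simp: F_def g_def indicator_def)
    finally have e1: "emeasure M' A = ennreal (\<integral>x. F (S x) * m0 x \<partial>torus)" .
    have "emeasure ?M1 A = ennreal (\<integral>x. indicator A x * m1 x \<partial>torus)"
      by (rule emeasure_torus_density[OF m1(1,2) A])
    also have "(\<integral>x. indicator A x * m1 x \<partial>torus) = (\<integral>x. F x * m1 x \<partial>torus)"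
      by (intro Bochner_Integration.integral_cong) (auto simp: F_def cell_part_id)
    finally have e2: "emeasure ?M1 A = ennreal (\<integral>x. F x * m1 x \<partial>torus)" .
    have "p * (\<integral>x. F (S x) * m0 x \<partial>torus) \<le> (\<integral>x. F x * m1 x \<partial>torus)"
      by (rule push[OF Fm]) (auto simp: F_def periodic_iff cell_part_periodic)
    then show ?thesis
      unfolding e1 e2 using p by (simp add: ennreal_mult'[symmetric] ennreal_leI)
  qed
  define L where "L = scale_measure (ennreal p) M'"
  have finL: "finite_measure L"
    by (rule finite_measureI) (simp add: L_def space_scale_measure M'.emeasure_space_1)
  have setsL: "sets L = sets ?M1" by (simp add: L_def)
  have emD: "emeasure (diff_measure ?M1 L) A = emeasure ?M1 A - ennreal p * emeasure M' A" if "A \<in> sets torus" for A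
    using that le by (subst emeasure_diff_measure) (auto simp: L_def finL[unfolded L_def] M1.finite_measure_axioms)
  \<comment> \<open>The part of the target not reached by the graph, renormalised to mass 1;
    subtracting is legitimate by the domination \<open>le\<close>.\<close>
  define R where "R = scale_measure (ennreal (1 / (1 - p))) (diff_measure ?M1 L)"
  have setsR [simp, measurable_cong]: "sets R = sets torus" by (simp add: R_def)
  have spR: "space R = unit_cell" by (simp add: R_def space_scale_measure)
  have R: "ennreal (1 - p) * emeasure R A = emeasure ?M1 A - ennreal p * emeasure M' A" if "A \<in> sets torus" for A
    using that p by (simp add: R_def emD mult.assoc[symmetric] ennreal_mult'[symmetric])
  have total: "emeasure R unit_cell = 1"
  proof -
    have u: "unit_cell \<in> sets torus" using sets.top[of torus] by simp
    have "emeasure R unit_cell = ennreal (1 / (1 - p)) * (emeasure ?M1 unit_cell - ennreal p * emeasure M' unit_cell)"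
      using u by (simp add: R_def emD)
    also have "\<dots> = ennreal (1 / (1 - p)) * (1 - ennreal p)"
      using M1.emeasure_space_1 M'.emeasure_space_1 by (simp add: M'_def)
    also have "1 - ennreal p = ennreal (1 - p)" using p by (simp add: ennreal_minus flip: ennreal_1)
    also have "ennreal (1 / (1 - p)) * ennreal (1 - p) = 1" using p by (simp add: ennreal_mult'[symmetric])
    finally show ?thesis .
  qed
  interpret R: prob_space R by (rule prob_spaceI) (simp add: spR total)
  let ?T = "torus \<Otimes>\<^sub>M torus"
  define P1 where "P1 = distr ?M0 ?T (\<lambda>x. (x, g x))"
  define P2 where "P2 = ?M0 \<Otimes>\<^sub>M R"
  have id0: "(\<lambda>x. x) \<in> measurable ?M0 torus" by (simp cong: measurable_cong_sets)
  have pm: "(\<lambda>x. (x, g x)) \<in> measurable ?M0 ?T" using id0 g0 by (rule measurable_Pair)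
  have sets2 [simp]: "sets P2 = sets ?T" unfolding P2_def by (intro sets_pair_measure_cong) auto
  have sets1 [simp]: "sets P1 = sets ?T" by (simp add: P1_def)
  have sp2: "space P2 = unit_cell \<times> unit_cell" by (simp add: P2_def space_pair_measure spR)
  \<comment> \<open>Both components have first marginal \<open>?M0\<close>; the second marginals
    \<open>M'\<close> and \<open>R\<close> recombine to \<open>?M1\<close> by the choice of
    \<open>R\<close>.\<close>
  define P where "P = mix p P1 P2"
  have setsP [simp]: "sets P = sets ?T" by (simp add: P_def)
  have spP: "space P = unit_cell \<times> unit_cell" by (simp add: P_def P1_def space_pair_measure)
  have emP: "emeasure P A = ennreal p * emeasure P1 A + ennreal (1 - p) * emeasure P2 A" if "A \<in> sets ?T" for A
    unfolding P_def using that by (intro emeasure_mix) auto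
  have pp: "ennreal p * e + ennreal (1 - p) * e = e" for e
    using p by (simp add: distrib_right[symmetric] ennreal_plus[symmetric] del: ennreal_plus)
  have coup: "P \<in> couplings ?M0 ?M1"
    unfolding couplings_def
  proof (intro CollectI conjI)
    show "sets P = sets (?M0 \<Otimes>\<^sub>M ?M1)" unfolding setsP by (intro sets_pair_measure_cong) auto
    have fm: "fst \<in> measurable P ?M0" "snd \<in> measurable P ?M1"
      by (simp_all cong: measurable_cong_sets)
    show "distr P ?M0 fst = ?M0"
    proof (rule measure_eqI)
      fix A assume "A \<in> sets (distr P ?M0 fst)"
      then have A: "A \<in> sets torus" by simp
      then have sub: "A \<subseteq> unit_cell" using sets.sets_into_space[OF A] by simp
      have Au: "A \<times> unit_cell \<in> sets ?T" using A sets.top[of torus] by (intro pair_measureI) auto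
      have "emeasure (distr P ?M0 fst) A = emeasure P (A \<times> unit_cell)"
        using A fm sub by (subst emeasure_distr) (auto simp: spP intro!: arg_cong[where f = "emeasure P"])
      also have "\<dots> = ennreal p * emeasure P1 (A \<times> unit_cell) + ennreal (1 - p) * emeasure P2 (A \<times> unit_cell)"
        by (rule emP[OF Au])
      also have "emeasure P1 (A \<times> unit_cell) = emeasure ?M0 A"
        unfolding P1_def using Au pm sub cell_part_in
        by (subst emeasure_distr) (auto simp: g_def intro!: arg_cong[where f = "emeasure ?M0"])
      also have "emeasure P2 (A \<times> unit_cell) = emeasure ?M0 A"
        unfolding P2_def using A sets.top[of torus] total by (subst R.emeasure_pair_measure_Times) auto
      finally show "emeasure (distr P ?M0 fst) A = emeasure ?M0 A" by (simp only: pp)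
    qed simp
    show "distr P ?M1 snd = ?M1"
    proof (rule measure_eqI)
      fix A assume "A \<in> sets (distr P ?M1 snd)"
      then have A: "A \<in> sets torus" by simp
      then have sub: "A \<subseteq> unit_cell" using sets.sets_into_space[OF A] by simp
      have Au: "unit_cell \<times> A \<in> sets ?T" using A sets.top[of torus] by (intro pair_measureI) auto
      have "emeasure (distr P ?M1 snd) A = emeasure P (unit_cell \<times> A)"
        using A fm sub by (subst emeasure_distr) (auto simp: spP intro!: arg_cong[where f = "emeasure P"])
      also have "\<dots> = ennreal p * emeasure P1 (unit_cell \<times> A) + ennreal (1 - p) * emeasure P2 (unit_cell \<times> A)"
        by (rule emP[OF Au])
      also have "emeasure P1 (unit_cell \<times> A) = emeasure M' A"
        unfolding P1_def M'_def using Au pm sub g0 A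
        by (subst (1 2) emeasure_distr) (auto intro!: arg_cong[where f = "emeasure ?M0"])
      also have "emeasure P2 (unit_cell \<times> A) = emeasure R A"
        unfolding P2_def using A sets.top[of torus] M0.emeasure_space_1 by (subst R.emeasure_pair_measure_Times) auto
      also have "ennreal p * emeasure M' A + ennreal (1 - p) * emeasure R A = emeasure ?M1 A"
        unfolding R[OF A] using le[OF A] by (rule add_diff_inverse_ennreal)
      finally show "emeasure (distr P ?M1 snd) A = emeasure ?M1 A" .
    qed simp
  qed
  have cm [measurable]: "(\<lambda>(x, y). ennreal ((torus_dist x y)\<^sup>2)) \<in> borel_measurable ?T"
  proof -
    have "(\<lambda>z. z) \<in> measurable ?T (borel \<Otimes>\<^sub>M borel)"
    proof -
      have "(\<lambda>z. (fst z, snd z)) \<in> measurable ?T (borel \<Otimes>\<^sub>M borel)"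
        by (intro measurable_Pair measurable_compose[OF measurable_fst] measurable_compose[OF measurable_snd] measurable_torus) auto
      then show ?thesis by simp
    qed
    from measurable_compose[OF this torus_dist_measurable]
    show ?thesis by (simp add: case_prod_unfold)
  qed
  have "(\<integral>\<^sup>+(x, y). ennreal ((torus_dist x y)\<^sup>2) \<partial>P) =
     ennreal p * (\<integral>\<^sup>+(x, y). ennreal ((torus_dist x y)\<^sup>2) \<partial>P1) + ennreal (1 - p) * (\<integral>\<^sup>+(x, y). ennreal ((torus_dist x y)\<^sup>2) \<partial>P2)"
    unfolding P_def by (rule nn_integral_mix) (use cm in \<open>simp_all cong: measurable_cong_sets\<close>)
  also have "(\<integral>\<^sup>+(x, y). ennreal ((torus_dist x y)\<^sup>2) \<partial>P1) = (\<integral>\<^sup>+x. ennreal ((torus_dist x (g x))\<^sup>2) \<partial>?M0)"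
    unfolding P1_def by (subst nn_integral_distr[OF pm]) (use cm in \<open>simp_all cong: measurable_cong_sets\<close>)
  also have "\<dots> \<le> (\<integral>\<^sup>+x. ennreal ((dist x (S x))\<^sup>2) \<partial>?M0)"
    using torus_dist_cell_part_le torus_dist_nonneg
    by (intro nn_integral_mono ennreal_leI power_mono) (auto simp: g_def)
  also have "\<dots> = (\<integral>\<^sup>+x. ennreal ((dist x (S x))\<^sup>2 * m0 x) \<partial>torus)"
    unfolding torus_density_def using m0(2)
    by (subst nn_integral_density) (auto intro!: nn_integral_cong measurable_torus simp: ennreal_mult' mult.commute)
  also have "\<dots> = ennreal (\<integral>x. (dist x (S x))\<^sup>2 * m0 x \<partial>torus)"
    using m0 by (intro nn_integral_eq_integral torus_integrable_continuous continuous_intros S Ck_continuous[OF m0(1)]) auto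
  also have "\<dots> \<le> ennreal Q" by (rule ennreal_leI[OF cost])
  also have "(\<integral>\<^sup>+(x, y). ennreal ((torus_dist x y)\<^sup>2) \<partial>P2) \<le> (\<integral>\<^sup>+z. ennreal 2 \<partial>P2)"
  proof -
    have "ennreal ((torus_dist a b)\<^sup>2) \<le> 2" if "a \<in> unit_cell" "b \<in> unit_cell" for a b
      using ennreal_leI[OF torus_dist_unit_cell_le[OF that]] by simp
    then show ?thesis by (intro nn_integral_mono) (auto simp: sp2)
  qed
  also have "\<dots> = 2"
  proof -
    have "emeasure P2 (space P2) = 1"
      unfolding sp2 unfolding P2_def using sets.top[of torus] M0.emeasure_space_1 total
      by (subst R.emeasure_pair_measure_Times) auto
    then show ?thesis by simp
  qed
  finally have fin: "(\<integral>\<^sup>+(x, y). ennreal ((torus_dist x y)\<^sup>2) \<partial>P) \<le> ennreal p * ennreal Q + ennreal (1 - p) * 2"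
    by (simp add: add_mono mult_left_mono)
  have Q0: "0 \<le> Q" using cost by (rule order_trans[rotated]) (auto intro!: integral_nonneg_AE simp: m0(2))
  have "(INF P\<in>couplings ?M0 ?M1. \<integral>\<^sup>+(x, y). ennreal ((torus_dist x y)\<^sup>2) \<partial>P) \<le> ennreal p * ennreal Q + ennreal (1 - p) * 2"
    by (rule INF_lower2[OF coup]) (rule fin)
  also have "\<dots> = ennreal (p * Q + 2 * (1 - p))"
  proof -
    have "ennreal (1 - p) * 2 = ennreal (2 * (1 - p))"
      using p ennreal_mult'[of "2" "1 - p"] by (simp add: mult.commute)
    then show ?thesis using p Q0 by (simp add: ennreal_mult' ennreal_plus)
  qed
  finally have "enn2real (INF P\<in>couplings ?M0 ?M1. \<integral>\<^sup>+(x, y). ennreal ((torus_dist x y)\<^sup>2) \<partial>P) \<le> p * Q + 2 * (1 - p)"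
    using p Q0 by (intro enn2real_leI) auto
  then show ?thesis unfolding W2_def by (rule real_sqrt_le_mono)
qed

section \<open>Moser's flow by Euler steps\<close>

lemma onorm_2_le: "onorm (\<lambda>v::real^2. v $ 1 * a + v $ 2 * b) \<le> \<bar>a\<bar> + \<bar>b\<bar>"
proof (rule onorm_le)
  fix v :: "real^2"
  have "norm (v $ 1 * a + v $ 2 * b) \<le> \<bar>v $ 1\<bar> * \<bar>a\<bar> + \<bar>v $ 2\<bar> * \<bar>b\<bar>"
    using abs_triangle_ineq[of "v $ 1 * a" "v $ 2 * b"] by (simp add: abs_mult)
  also have "\<dots> \<le> norm v * \<bar>a\<bar> + norm v * \<bar>b\<bar>"
    using component_le_norm_cart[of v 1] component_le_norm_cart[of v 2] by (intro add_mono mult_right_mono) auto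
  finally show "norm (v $ 1 * a + v $ 2 * b) \<le> (\<bar>a\<bar> + \<bar>b\<bar>) * norm v" by (simp add: algebra_simps)
qed

text \<open>Mean value inequality for \<open>f\<close> minus a linear function. With
  \<open>w = 0\<close> it is a Lipschitz bound, with \<open>w\<close> the gradient at
  \<open>x\<close> it is the first order Taylor estimate.\<close>

lemma pd_bound_on_segment:
  assumes d: "\<And>z. f differentiable at z"
    and b: "\<And>z i. z \<in> closed_segment x y \<Longrightarrow> \<bar>pd i f z - w i\<bar> \<le> M"
  shows "\<bar>f y - f x - ((y - x) $ 1 * w 1 + (y - x) $ 2 * w 2)\<bar> \<le> 2 * M * norm (y - x)"
proof -
  define g where "g z = f z - (z $ 1 * w 1 + z $ 2 * w 2)" for z
  have D: "(g has_derivative (\<lambda>v. v $ 1 * (pd 1 f z - w 1) + v $ 2 * (pd 2 f z - w 2))) (at z within closed_segment x y)" for z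
    unfolding g_def
    by (rule has_derivative_eq_rhs, rule has_derivative_diff[OF has_derivative_at_withinI[OF has_derivative_pd[OF d]]],
      auto intro!: derivative_eq_intros bounded_linear.has_derivative[OF bounded_linear_vec_nth] simp: fun_eq_iff algebra_simps)
  have "norm (g y - g x) \<le> 2 * M * norm (y - x)"
  proof (rule differentiable_bound[OF convex_closed_segment D])
    fix z assume "z \<in> closed_segment x y"
    then show "onorm (\<lambda>v::real^2. v $ 1 * (pd 1 f z - w 1) + v $ 2 * (pd 2 f z - w 2)) \<le> 2 * M"
      using b[of z 1] b[of z 2] by (intro order_trans[OF onorm_2_le]) linarith
  qed auto
  then show ?thesis by (simp add: g_def algebra_simps)
qed

lemma pd_Lipschitz:
  assumes "\<And>z. f differentiable at z" "\<And>z i. \<bar>pd i f z\<bar> \<le> M"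
  shows "\<bar>f y - f x\<bar> \<le> 2 * M * norm (y - x)"
  using pd_bound_on_segment[of f x y "\<lambda>i. 0" M] assms by simp

lemma pd_Taylor:
  assumes f: "Ck 2 f" and b: "\<And>z i j. \<bar>pd j (pd i f) z\<bar> \<le> M"
  shows "\<bar>f y - f x - ((y - x) $ 1 * pd 1 f x + (y - x) $ 2 * pd 2 f x)\<bar> \<le> 4 * M * (norm (y - x))\<^sup>2"
proof -
  have M: "0 \<le> M" using b[of 1 1 0] by linarith
  have "\<bar>pd i f z - pd i f x\<bar> \<le> 2 * M * norm (y - x)" if z: "z \<in> closed_segment x y" for i z
  proof -
    have "\<bar>pd i f z - pd i f x\<bar> \<le> 2 * M * norm (z - x)"
      by (rule pd_Lipschitz) (auto simp: Ck_2D(7)[OF f] b)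
    also have "\<dots> \<le> 2 * M * norm (y - x)"
      using segment_bound1[OF z] M by (intro mult_left_mono) auto
    finally show ?thesis .
  qed
  from pd_bound_on_segment[OF Ck_2D(1)[OF f] this]
  show ?thesis by (simp add: power2_eq_square mult_ac)
qed

text \<open>The preimage of \<open>z\<close> is the fixed point of \<open>y -> z - d v(y)\<close>, a
  contraction with factor 1/2, and the inverse obtained in this way is 2-Lipschitz.\<close>

lemma near_identity_homeomorphism:
  fixes v :: "real^2 \<Rightarrow> real^2"
  assumes lip: "\<And>x y. norm (v x - v y) \<le> K * norm (x - y)" and d: "0 \<le> d" "d * K \<le> 1 / 2" "0 \<le> K"
  obtains H where "\<And>x. H (x + d *\<^sub>R v x) = x" "\<And>x. H x + d *\<^sub>R v (H x) = x" "continuous_on UNIV H"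
proof -
  have lip': "norm (d *\<^sub>R v x - d *\<^sub>R v y) \<le> 1 / 2 * norm (x - y)" for x y
  proof -
    have "norm (d *\<^sub>R v x - d *\<^sub>R v y) = d * norm (v x - v y)"
      using d by (simp flip: scaleR_diff_right)
    also have "\<dots> \<le> d * (K * norm (x - y))" by (intro mult_left_mono lip d)
    also have "\<dots> \<le> 1 / 2 * norm (x - y)"
      using mult_right_mono[OF d(2), of "norm (x - y)"] by (simp add: mult.assoc)
    finally show ?thesis .
  qed
  have ex: "\<exists>!y. z - d *\<^sub>R v y = y" for z
  proof (rule banach_fix_type[of "1/2"])
    show "\<forall>x y. dist (z - d *\<^sub>R v x) (z - d *\<^sub>R v y) \<le> 1 / 2 * dist x y"
      using lip' by (auto simp: dist_norm norm_minus_commute)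
  qed auto
  define H where "H z = (THE y. z - d *\<^sub>R v y = y)" for z
  have H: "z - d *\<^sub>R v (H z) = H z" for z unfolding H_def by (rule theI'[OF ex])
  have H2: "H x + d *\<^sub>R v (H x) = x" for x using H[of x] by (metis diff_add_cancel)
  have H1: "H (x + d *\<^sub>R v x) = x" for x
  proof -
    have "x + d *\<^sub>R v x - d *\<^sub>R v x = x" by simp
    with ex[of "x + d *\<^sub>R v x"] H[of "x + d *\<^sub>R v x"] show ?thesis by blast
  qed
  have "norm (H x - H y) \<le> 2 * norm (x - y)" for x y
  proof -
    have "H x - H y = (x - y) - (d *\<^sub>R v (H x) - d *\<^sub>R v (H y))"
      using H[of x] H[of y] by (simp add: algebra_simps)
    then have "norm (H x - H y) \<le> norm (x - y) + norm (d *\<^sub>R v (H x) - d *\<^sub>R v (H y))"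
      by (metis norm_triangle_ineq4)
    with lip'[of "H x" "H y"] show ?thesis by linarith
  qed
  then have "2-lipschitz_on UNIV H" by (intro lipschitz_onI) (auto simp: dist_norm)
  then have "continuous_on UNIV H" by (rule lipschitz_on_continuous_on)
  with H1 H2 show thesis by (rule that)
qed

text \<open>The first order terms cancel because \<open>b + a * g = 0\<close> is the continuity equation.\<close>

lemma euler_step_algebra:
  fixes a b g e d2 d :: real
  assumes d: "0 \<le> d" "d \<le> 1" and bg: "b + a * g = 0" and a: "\<bar>a\<bar> \<le> A" and b: "\<bar>b\<bar> \<le> A" and g: "\<bar>g\<bar> \<le> A"
    and d2: "\<bar>d2\<bar> \<le> A" and e: "\<bar>e\<bar> \<le> A * d\<^sup>2" and A: "0 \<le> A"
  shows "a - (5 * A\<^sup>2 + A) * d\<^sup>2 \<le> (a + d * b + e) * (1 + d * g + d\<^sup>2 * d2)"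
proof -
  have mm: "\<bar>x * y\<bar> \<le> X * Y" if "\<bar>x\<bar> \<le> X" "\<bar>y\<bar> \<le> Y" for x y X Y :: real
    unfolding abs_mult using that by (intro mult_mono) auto
  have d': "\<bar>d\<bar> \<le> 1" "\<bar>d\<^sup>2\<bar> \<le> 1" "\<bar>d\<^sup>2\<bar> \<le> d\<^sup>2" using d by (auto simp: power_le_one)
  have eq: "(a + d * b + e) * (1 + d * g + d\<^sup>2 * d2) =
      a + d * (b + a * g) + (d\<^sup>2 * (b * g) + d\<^sup>2 * (a * d2) + d\<^sup>2 * (d * (b * d2)) + e + e * (d * g) + e * (d\<^sup>2 * d2))"
    by (simp add: algebra_simps power2_eq_square)
  \<comment> \<open>Of the six remainder terms, five are at most \<open>A^2 d^2\<close> and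
    \<open>e\<close> itself is at most \<open>A d^2\<close>; hence the constant
    \<open>5 A^2 + A\<close>.\<close>
  have "\<bar>d\<^sup>2 * (b * g)\<bar> \<le> d\<^sup>2 * (A * A)" "\<bar>d\<^sup>2 * (a * d2)\<bar> \<le> d\<^sup>2 * (A * A)"
    "\<bar>d\<^sup>2 * (d * (b * d2))\<bar> \<le> d\<^sup>2 * (1 * (A * A))" "\<bar>e * (d * g)\<bar> \<le> A * d\<^sup>2 * (1 * A)"
    "\<bar>e * (d\<^sup>2 * d2)\<bar> \<le> A * d\<^sup>2 * (1 * A)"
    by (intro mm d' a b g d2 e)+
  with e have "- ((5 * (A * A) + A) * d\<^sup>2) \<le> d\<^sup>2 * (b * g) + d\<^sup>2 * (a * d2) + d\<^sup>2 * (d * (b * d2)) + e + e * (d * g) + e * (d\<^sup>2 * d2)"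
    by (simp add: algebra_simps abs_le_iff)
  then show ?thesis unfolding eq bg by (simp add: power2_eq_square[of A])
qed

definition bounded_C1 :: "real \<Rightarrow> (real^2 \<Rightarrow> real) \<Rightarrow> bool" where
  "bounded_C1 M f \<longleftrightarrow> (\<forall>x. \<bar>f x\<bar> \<le> M \<and> (\<forall>i. \<bar>pd i f x\<bar> \<le> M))"

lemma Ck_bounded:
  assumes "Ck n f"
  obtains B where "\<And>x. \<bar>f x\<bar> \<le> B"
  using bounded_continuous_periodic[OF Ck_continuous[OF assms] Ck_periodic[OF assms]] by (metis real_norm_def)

lemma Ck_1_bounded_C1:
  assumes "Ck 1 f"
  obtains M where "bounded_C1 M f"
proof -
  obtain B0 B1 B2 where B: "\<And>x. \<bar>f x\<bar> \<le> B0" "\<And>x. \<bar>pd 1 f x\<bar> \<le> B1" "\<And>x. \<bar>pd 2 f x\<bar> \<le> B2"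
    using Ck_bounded[OF assms] Ck_bounded[OF Ck_1D(2)[OF assms]] by metis
  have "bounded_C1 (max B0 (max B1 B2)) f"
    unfolding bounded_C1_def using B by (auto simp: forall_2 le_max_iff_disj)
  then show thesis by (rule that)
qed

lemma bounded_C1_mono: "bounded_C1 M f \<Longrightarrow> M \<le> N \<Longrightarrow> bounded_C1 N f"
  unfolding bounded_C1_def by (meson order_trans)

text \<open>Moser's data: a flux whose divergence is the difference of the densities. Dividing it by
  the interpolated density \<open>m s\<close> gives the velocity \<open>v s\<close> that transports
  \<open>m0\<close> to \<open>m1\<close>.\<close>

locale Moser =
  fixes m0 m1 q1 q2 :: "real^2 \<Rightarrow> real" and c :: real
  assumes m0: "Ck 2 m0" and m1: "Ck 2 m1" and q1: "Ck 1 q1" and q2: "Ck 1 q2"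
    and c: "0 < c" "\<And>x. c \<le> m0 x" "\<And>x. c \<le> m1 x"
    and flux: "\<And>x. pd 1 q1 x + pd 2 q2 x = m0 x - m1 x"
begin

definition m :: "real \<Rightarrow> real^2 \<Rightarrow> real" where
  "m s x = (1 - s) * m0 x + s * m1 x"

definition v1 :: "real \<Rightarrow> real^2 \<Rightarrow> real" where "v1 s x = q1 x / m s x"
definition v2 :: "real \<Rightarrow> real^2 \<Rightarrow> real" where "v2 s x = q2 x / m s x"
definition v :: "real \<Rightarrow> real^2 \<Rightarrow> real^2" where "v s x = vector [v1 s x, v2 s x]"

lemma m_C2: "Ck 2 (m s)"
  unfolding m_def by (intro Ck_intros m0 m1)

lemma m_ge: "0 \<le> s \<Longrightarrow> s \<le> 1 \<Longrightarrow> c \<le> m s x"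
  unfolding m_def using convex_bound_le[of "- m0 x" "- c" "- m1 x" "1 - s" s] c(2)[of x] c(3)[of x] by simp

lemma m_ends: "m 0 = m0" "m 1 = m1" by (simp_all add: m_def fun_eq_iff)

lemma pd_m: "pd i (m s) x = (1 - s) * pd i m0 x + s * pd i m1 x"
  unfolding m_def using Ck_2D(1)[OF m0] Ck_2D(1)[OF m1] by (simp add: pd_add pd_cmult)

lemma pd2_m: "pd j (pd i (m s)) x = (1 - s) * pd j (pd i m0) x + s * pd j (pd i m1) x"
proof -
  have "pd i (m s) = (\<lambda>x. (1 - s) * pd i m0 x + s * pd i m1 x)" by (rule ext) (rule pd_m)
  then show ?thesis using Ck_2D(7)[OF m0] Ck_2D(7)[OF m1] by (simp add: pd_add pd_cmult)
qed

lemma quotient_pd: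
  assumes q: "Ck 1 q" and s: "0 \<le> s" "s \<le> 1"
  shows "pd i (\<lambda>x. q x / m s x) x = (pd i q x - q x / m s x * pd i (m s) x) / m s x"
    and "(\<lambda>x. q x / m s x) differentiable at x"
proof -
  have p: "0 < m s x" for x using m_ge[OF s] c(1) by (rule less_le_trans[rotated])
  have d: "(\<lambda>x. inverse (m s x)) differentiable at x"
    "pd i (\<lambda>x. inverse (m s x)) x = - inverse ((m s x)\<^sup>2) * pd i (m s) x" for x
    using pd_compose(1)[OF Ck_2D(1)[OF m_C2[of s], of x] DERIV_inverse, where i = i]
      pd_compose(2)[OF Ck_2D(1)[OF m_C2[of s], of x] DERIV_inverse] p[of x]
    by (simp_all add: numeral_2_eq_2)
  have e: "(\<lambda>x. q x / m s x) = (\<lambda>x. q x * inverse (m s x))" by (simp add: divide_inverse)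
  show "(\<lambda>x. q x / m s x) differentiable at x"
    unfolding e using d(1) Ck_1D(1)[OF q] by (intro differentiable_mult) auto
  show "pd i (\<lambda>x. q x / m s x) x = (pd i q x - q x / m s x * pd i (m s) x) / m s x"
    unfolding e using p[of x] by (simp only: pd_mult[OF Ck_1D(1)[OF q] d(1)] d(2)) (simp add: field_simps power2_eq_square)
qed

text \<open>The product \<open>m v\<close> is the flux, independently of \<open>s\<close>, and its
  divergence is \<open>m0 - m1\<close>. The equation is written in advective form to match
  \<open>b + a * g = 0\<close> in \<open>euler_step_algebra\<close>.\<close>

lemma continuity_equation:
  assumes s: "0 \<le> s" "s \<le> 1"
  shows "(v1 s x * pd 1 (m s) x + v2 s x * pd 2 (m s) x + (m1 x - m0 x)) + m s x * (pd 1 (v1 s) x + pd 2 (v2 s) x) = 0"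
proof -
  have "m s x \<noteq> 0" using m_ge[OF s, of x] c(1) by linarith
  then have "m s x * (pd 1 (v1 s) x + pd 2 (v2 s) x) =
      (pd 1 q1 x + pd 2 q2 x) - (v1 s x * pd 1 (m s) x + v2 s x * pd 2 (m s) x)"
    unfolding v1_def[abs_def] v2_def[abs_def]
    by (simp add: quotient_pd(1)[OF q1 s] quotient_pd(1)[OF q2 s] field_simps)
  then show ?thesis using flux[of x] by simp
qed

text \<open>One constant for all intermediate times: \<open>m s\<close> is a convex combination and
  all denominators stay above \<open>c\<close>. This makes the error per Euler step independent of
  \<open>s\<close> and of the number of steps.\<close>

lemma uniform_bound:
  obtains A where "0 \<le> A" "\<And>s x. 0 \<le> s \<Longrightarrow> s \<le> 1 \<Longrightarrow> \<bar>m s x\<bar> \<le> A"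
    "\<And>s i x. 0 \<le> s \<Longrightarrow> s \<le> 1 \<Longrightarrow> \<bar>pd i (m s) x\<bar> \<le> A"
    "\<And>s i j x. 0 \<le> s \<Longrightarrow> s \<le> 1 \<Longrightarrow> \<bar>pd j (pd i (m s)) x\<bar> \<le> A"
    "\<And>i x. \<bar>pd i m1 x - pd i m0 x\<bar> \<le> A" "\<And>x. \<bar>m1 x - m0 x\<bar> \<le> A"
    "\<And>s x. 0 \<le> s \<Longrightarrow> s \<le> 1 \<Longrightarrow> \<bar>v1 s x\<bar> \<le> A" "\<And>s x. 0 \<le> s \<Longrightarrow> s \<le> 1 \<Longrightarrow> \<bar>v2 s x\<bar> \<le> A"
    "\<And>s i x. 0 \<le> s \<Longrightarrow> s \<le> 1 \<Longrightarrow> \<bar>pd i (v1 s) x\<bar> \<le> A" "\<And>s i x. 0 \<le> s \<Longrightarrow> s \<le> 1 \<Longrightarrow> \<bar>pd i (v2 s) x\<bar> \<le> A"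
proof -
  have "\<exists>M. bounded_C1 M m0 \<and> bounded_C1 M m1 \<and> bounded_C1 M q1 \<and> bounded_C1 M q2 \<and>
    (\<forall>i. bounded_C1 M (pd i m0)) \<and> (\<forall>i. bounded_C1 M (pd i m1))"
  proof -
    obtain a1 where a1: "bounded_C1 a1 m0" by (rule Ck_1_bounded_C1[OF Ck_2D(3)[OF m0]])
    obtain a2 where a2: "bounded_C1 a2 m1" by (rule Ck_1_bounded_C1[OF Ck_2D(3)[OF m1]])
    obtain a3 where a3: "bounded_C1 a3 q1" by (rule Ck_1_bounded_C1[OF q1])
    obtain a4 where a4: "bounded_C1 a4 q2" by (rule Ck_1_bounded_C1[OF q2])
    obtain a5 where a5: "bounded_C1 a5 (pd 1 m0)" by (rule Ck_1_bounded_C1[OF Ck_2D(2)[OF m0]])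
    obtain a6 where a6: "bounded_C1 a6 (pd 2 m0)" by (rule Ck_1_bounded_C1[OF Ck_2D(2)[OF m0]])
    obtain a7 where a7: "bounded_C1 a7 (pd 1 m1)" by (rule Ck_1_bounded_C1[OF Ck_2D(2)[OF m1]])
    obtain a8 where a8: "bounded_C1 a8 (pd 2 m1)" by (rule Ck_1_bounded_C1[OF Ck_2D(2)[OF m1]])
    note a = a1 a2 a3 a4 a5 a6 a7 a8
    define M where "M = Max {a1, a2, a3, a4, a5, a6, a7, a8}"
    have "a1 \<le> M" "a2 \<le> M" "a3 \<le> M" "a4 \<le> M" "a5 \<le> M" "a6 \<le> M" "a7 \<le> M" "a8 \<le> M"
      unfolding M_def by (rule Max_ge, simp, simp)+
    note le = this
    have "bounded_C1 M (pd i m0)" "bounded_C1 M (pd i m1)" for i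
      using exhaust_2[of i] bounded_C1_mono[OF a(5) le(5)] bounded_C1_mono[OF a(6) le(6)]
        bounded_C1_mono[OF a(7) le(7)] bounded_C1_mono[OF a(8) le(8)] by auto
    then show ?thesis
      using bounded_C1_mono[OF a(1) le(1)] bounded_C1_mono[OF a(2) le(2)]
        bounded_C1_mono[OF a(3) le(3)] bounded_C1_mono[OF a(4) le(4)] by (intro exI[of _ M] conjI allI)
  qed
  then obtain M where M: "bounded_C1 M m0" "bounded_C1 M m1" "bounded_C1 M q1" "bounded_C1 M q2"
    "\<And>i. bounded_C1 M (pd i m0)" "\<And>i. bounded_C1 M (pd i m1)" by (elim exE conjE) (rule that; (assumption | erule spec))
  note M' = M[unfolded bounded_C1_def, THEN spec, THEN conjunct1] M[unfolded bounded_C1_def, THEN spec, THEN conjunct2, THEN spec]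
  have M0: "0 \<le> M" using M'(1)[of 0] by linarith
  define A where "A = 2 * M + M / c + (M + M / c * M) / c"
  have A: "2 * M \<le> A" "M / c \<le> A" "(M + M / c * M) / c \<le> A" "0 \<le> A"
    unfolding A_def using M0 c(1) by (auto intro!: add_nonneg_nonneg)
  have conv: "\<bar>(1 - s) * a + s * b\<bar> \<le> M" if "0 \<le> s" "s \<le> 1" "\<bar>a\<bar> \<le> M" "\<bar>b\<bar> \<le> M" for s a b :: real
  proof -
    have "\<bar>(1 - s) * a + s * b\<bar> \<le> \<bar>(1 - s) * a\<bar> + \<bar>s * b\<bar>" by (rule abs_triangle_ineq)
    also have "\<dots> = (1 - s) * \<bar>a\<bar> + s * \<bar>b\<bar>" using that by (simp add: abs_mult)
    also have "\<dots> \<le> M" using that by (intro convex_bound_le) auto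
    finally show ?thesis .
  qed
  have quo: "\<bar>q x / m s x\<bar> \<le> M / c" "\<bar>pd i (\<lambda>x. q x / m s x) x\<bar> \<le> (M + M / c * M) / c"
    if s: "0 \<le> s" "s \<le> 1" and q: "Ck 1 q" "bounded_C1 M q" for q s i x
  proof -
    have mp: "c \<le> m s x" "0 < m s x" using m_ge[OF s] c(1) by (auto intro: less_le_trans)
    show b: "\<bar>q x / m s x\<bar> \<le> M / c"
      using q(2) mp c(1) unfolding bounded_C1_def abs_divide by (intro frac_le) auto
    have pm: "\<bar>pd i (m s) x\<bar> \<le> M" unfolding pd_m by (intro conv s M')
    have "\<bar>pd i q x - q x / m s x * pd i (m s) x\<bar> \<le> \<bar>pd i q x\<bar> + \<bar>q x / m s x\<bar> * \<bar>pd i (m s) x\<bar>"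
      using abs_triangle_ineq4[of "pd i q x" "q x / m s x * pd i (m s) x"] by (simp only: abs_mult)
    also have "\<dots> \<le> M + M / c * M"
      using q(2) b pm M0 c(1) unfolding bounded_C1_def by (intro add_mono mult_mono) auto
    finally show "\<bar>pd i (\<lambda>x. q x / m s x) x\<bar> \<le> (M + M / c * M) / c"
      unfolding quotient_pd(1)[OF q(1) s] abs_divide using mp c(1) M0 by (intro frac_le) auto
  qed
  show thesis
  proof (rule that[of A])
    show "0 \<le> A" by (rule A)
    fix s :: real and x :: "real^2" and i j :: 2 assume s: "0 \<le> s" "s \<le> 1"
    have MA: "M \<le> A" using A(1) M0 by linarith
    show "\<bar>m s x\<bar> \<le> A" unfolding m_def using conv[OF s M'(1) M'(2)] MA by (rule order_trans)
    show "\<bar>pd i (m s) x\<bar> \<le> A" unfolding pd_m using conv[OF s M'(7) M'(8)] MA by (rule order_trans)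
    show "\<bar>pd j (pd i (m s)) x\<bar> \<le> A" unfolding pd2_m using conv[OF s M'(11) M'(12)] MA by (rule order_trans)
    show "\<bar>v1 s x\<bar> \<le> A" "\<bar>pd i (v1 s) x\<bar> \<le> A"
      unfolding v1_def[abs_def] using order_trans[OF quo(1)[OF s q1 M(3)] A(2)] order_trans[OF quo(2)[OF s q1 M(3)] A(3)] by auto
    show "\<bar>v2 s x\<bar> \<le> A" "\<bar>pd i (v2 s) x\<bar> \<le> A"
      unfolding v2_def[abs_def] using order_trans[OF quo(1)[OF s q2 M(4)] A(2)] order_trans[OF quo(2)[OF s q2 M(4)] A(3)] by auto
  next
    fix x :: "real^2" and i :: 2
    show "\<bar>pd i m1 x - pd i m0 x\<bar> \<le> A" using M'(7)[of i x] M'(8)[of i x] A(1) by linarith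
    show "\<bar>m1 x - m0 x\<bar> \<le> A" using M'(1)[of x] M'(2)[of x] A(1) by linarith
  qed
qed

definition euler :: "real \<Rightarrow> real \<Rightarrow> real^2 \<Rightarrow> real^2" where
  "euler d s x = x + d *\<^sub>R v s x"

lemma v_nth [simp]: "v s x $ 1 = v1 s x" "v s x $ 2 = v2 s x"
  by (simp_all add: v_def)

lemma v_periodic: "v s (x + lattice_point k) = v s x"
  using Ck_periodic[OF q1] Ck_periodic[OF q2] Ck_periodic[OF m_C2]
  by (simp add: v_def v1_def v2_def periodicD)

lemma euler_lattice: "euler d s (x + lattice_point k) = euler d s x + lattice_point k"
  by (simp add: euler_def v_periodic)

lemma v_differentiable:
  assumes s: "0 \<le> s" "s \<le> 1"
  shows "v1 s differentiable at x" "v2 s differentiable at x"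
  unfolding v1_def[abs_def] v2_def[abs_def] using quotient_pd(2)[OF q1 s] quotient_pd(2)[OF q2 s] by auto

lemma norm_v_diff_le: "norm (v s x - v s y) \<le> \<bar>v1 s x - v1 s y\<bar> + \<bar>v2 s x - v2 s y\<bar>"
  using norm_le_l1_cart[of "v s x - v s y"] by (simp add: sum_2)

lemma norm_v_le: "norm (v s x) \<le> \<bar>v1 s x\<bar> + \<bar>v2 s x\<bar>"
  using norm_le_l1_cart[of "v s x"] by (simp add: sum_2)

definition euler' :: "real \<Rightarrow> real \<Rightarrow> real^2 \<Rightarrow> real^2 \<Rightarrow> real^2" where
  "euler' d s x h = h + d *\<^sub>R ((h $ 1 * pd 1 (v1 s) x + h $ 2 * pd 2 (v1 s) x) *\<^sub>R axis 1 1
     + (h $ 1 * pd 1 (v2 s) x + h $ 2 * pd 2 (v2 s) x) *\<^sub>R axis 2 1)"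

lemma euler_has_derivative:
  assumes s: "0 \<le> s" "s \<le> 1"
  shows "(euler d s has_derivative euler' d s x) (at x)"
proof -
  have e: "euler d s = (\<lambda>x. x + d *\<^sub>R (v1 s x *\<^sub>R axis 1 1 + v2 s x *\<^sub>R axis 2 1))"
    by (rule ext) (simp add: euler_def vec_eq_iff forall_2 axis_def)
  show ?thesis unfolding e euler'_def[abs_def]
    by (intro has_derivative_add has_derivative_ident has_derivative_scaleR_right has_derivative_scaleR_left
        has_derivative_pd v_differentiable s)
qed

lemma det_euler':
  "det (matrix (euler' d s x)) = 1 + d * (pd 1 (v1 s) x + pd 2 (v2 s) x)
     + d\<^sup>2 * (pd 1 (v1 s) x * pd 2 (v2 s) x - pd 2 (v1 s) x * pd 1 (v2 s) x)"
  by (simp add: det_2 matrix_def euler'_def axis_def algebra_simps power2_eq_square)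

lemma v_pd_continuous:
  assumes s: "0 \<le> s" "s \<le> 1"
  shows "continuous_on UNIV (pd i (v1 s))" "continuous_on UNIV (pd i (v2 s))"
    "continuous_on UNIV (v1 s)" "continuous_on UNIV (v2 s)"
proof -
  have mz: "m s x \<noteq> 0" for x using m_ge[OF s, of x] c(1) by linarith
  have cq: "continuous_on UNIV (pd i (\<lambda>x. q x / m s x))" if q: "Ck 1 q" for q
  proof -
    have "pd i (\<lambda>x. q x / m s x) = (\<lambda>x. (pd i q x - q x / m s x * pd i (m s) x) / m s x)"
      by (rule ext) (rule quotient_pd(1)[OF q s])
    then show ?thesis
      using mz Ck_continuous[OF q] Ck_continuous[OF Ck_1D(2)[OF q]] Ck_continuous[OF m_C2] Ck_continuous[OF Ck_2D(2)[OF m_C2]]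
      by (auto intro!: continuous_intros)
  qed
  show "continuous_on UNIV (pd i (v1 s))" "continuous_on UNIV (pd i (v2 s))"
    unfolding v1_def[abs_def] v2_def[abs_def] by (intro cq q1 q2)+
  show "continuous_on UNIV (v1 s)" "continuous_on UNIV (v2 s)"
    unfolding v1_def[abs_def] v2_def[abs_def]
    using mz Ck_continuous[OF q1] Ck_continuous[OF q2] Ck_continuous[OF m_C2] by (auto intro!: continuous_intros)
qed

lemma euler_continuous:
  assumes s: "0 \<le> s" "s \<le> 1"
  shows "continuous_on UNIV (euler d s)"
  using euler_has_derivative[OF s] by (meson continuous_at_imp_continuous_on has_derivative_continuous)

text \<open>One Euler step transports \<open>m s\<close> to \<open>m (s + d)\<close> up to a
  relative error of order \<open>d^2\<close>: the first order terms cancel by the continuity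
  equation, and the Taylor remainder is quadratic. The second conclusion supplies the inverse needed
  for the change of variables.\<close>

lemma density_step:
  obtains K d0 where "0 < K" "0 < d0"
    "\<And>s d x. 0 \<le> s \<Longrightarrow> s + d \<le> 1 \<Longrightarrow> 0 < d \<Longrightarrow> d \<le> d0 \<Longrightarrow>
       m s x \<le> (1 + K * d\<^sup>2) * (\<bar>det (matrix (euler' d s x))\<bar> * m (s + d) (euler d s x))"
    "\<And>s d. 0 \<le> s \<Longrightarrow> s + d \<le> 1 \<Longrightarrow> 0 < d \<Longrightarrow> d \<le> d0 \<Longrightarrow>
       \<exists>H. (\<forall>x. H (euler d s x) = x) \<and> (\<forall>x. euler d s (H x) = x) \<and> continuous_on UNIV H"
proof -
  obtain A where A: "0 \<le> A" "\<And>s x. 0 \<le> s \<Longrightarrow> s \<le> 1 \<Longrightarrow> \<bar>m s x\<bar> \<le> A"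
    "\<And>s i x. 0 \<le> s \<Longrightarrow> s \<le> 1 \<Longrightarrow> \<bar>pd i (m s) x\<bar> \<le> A"
    "\<And>s i j x. 0 \<le> s \<Longrightarrow> s \<le> 1 \<Longrightarrow> \<bar>pd j (pd i (m s)) x\<bar> \<le> A"
    "\<And>i x. \<bar>pd i m1 x - pd i m0 x\<bar> \<le> A" "\<And>x. \<bar>m1 x - m0 x\<bar> \<le> A"
    "\<And>s x. 0 \<le> s \<Longrightarrow> s \<le> 1 \<Longrightarrow> \<bar>v1 s x\<bar> \<le> A" "\<And>s x. 0 \<le> s \<Longrightarrow> s \<le> 1 \<Longrightarrow> \<bar>v2 s x\<bar> \<le> A"
    "\<And>s i x. 0 \<le> s \<Longrightarrow> s \<le> 1 \<Longrightarrow> \<bar>pd i (v1 s) x\<bar> \<le> A" "\<And>s i x. 0 \<le> s \<Longrightarrow> s \<le> 1 \<Longrightarrow> \<bar>pd i (v2 s) x\<bar> \<le> A"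
    by (rule uniform_bound) (rule that; assumption)
  \<comment> \<open>A common majorant for the density, for \<open>b\<close>, \<open>g\<close> and
    \<open>d2\<close>, and for the coefficient of \<open>d^2\<close> in \<open>e\<close>.\<close>
  define A' where "A' = 16 * A ^ 3 + 8 * A\<^sup>2 + 4 * A"
  have A': "A \<le> A'" "2 * A\<^sup>2 + A \<le> A'" "2 * A \<le> A'" "2 * A\<^sup>2 \<le> A'" "16 * A ^ 3 + 4 * A\<^sup>2 \<le> A'" "0 \<le> A'"
    unfolding A'_def using A(1) zero_le_power[OF A(1), of 3] zero_le_power[OF A(1), of 2] by linarith+
  define K0 where "K0 = 5 * A'\<^sup>2 + A'"
  have K0: "0 \<le> K0" unfolding K0_def using A'(6) by simp
  define K where "K = 2 * K0 / c + 1"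
  \<comment> \<open>The first bound gives \<open>d <= 1\<close> and makes \<open>d v\<close> a
    contraction with factor 1/2, \<open>v\<close> being \<open>4 A\<close>-Lipschitz; the second
    keeps the error \<open>K0 d^2\<close> below \<open>c / 2\<close>.\<close>
  define d0 where "d0 = min (1 / (8 * A + 1)) (c / (2 * K0 + 2))"
  have K: "0 < K" unfolding K_def using K0 c(1) by (simp add: add_nonneg_pos)
  have d0: "0 < d0" unfolding d0_def using A(1) K0 c(1) by simp
  have d: "d \<le> 1" "d * (4 * A) \<le> 1 / 2" "K0 * d\<^sup>2 \<le> c / 2" if "0 < d" "d \<le> d0" for d
  proof -
    have d1: "d \<le> 1 / (8 * A + 1)" "d \<le> c / (2 * K0 + 2)" using that by (auto simp: d0_def)
    have "1 / (8 * A + 1) \<le> 1" using A(1) by simp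
    with d1 show le: "d \<le> 1" by linarith
    have "d * (8 * A + 1) \<le> 1" using d1(1) A(1) by (simp add: pos_le_divide_eq)
    then show "d * (4 * A) \<le> 1 / 2" using that by (simp add: algebra_simps)
    have "d * (2 * K0 + 2) \<le> c" using d1(2) K0 by (simp add: pos_le_divide_eq)
    then have "K0 * d \<le> c / 2" using that by (simp add: algebra_simps)
    moreover have "K0 * d\<^sup>2 \<le> K0 * d" using le that K0 by (intro mult_left_mono) (auto simp: power2_eq_square mult_left_le)
    ultimately show "K0 * d\<^sup>2 \<le> c / 2" by linarith
  qed
  have nv: "norm (v s x) \<le> 2 * A" if "0 \<le> s" "s \<le> 1" for s x
    using norm_v_le[of s x] A(7)[OF that, of x] A(8)[OF that, of x] by linarith
  show thesis
  proof (rule that[OF K d0])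
    fix s d :: real and x :: "real^2"
    assume s: "0 \<le> s" "s + d \<le> 1" and dd: "0 < d" "d \<le> d0"
    have s1: "s \<le> 1" using s dd by linarith
    note sA = s(1) s1
    define y where "y = euler d s x"
    have yx: "y - x = d *\<^sub>R v s x" by (simp add: y_def euler_def)
    have nyx: "norm (y - x) \<le> d * (2 * A)" using nv[OF sA, of x] dd by (simp add: yx mult_left_mono)
    define b where "b = v1 s x * pd 1 (m s) x + v2 s x * pd 2 (m s) x + (m1 x - m0 x)"
    define g where "g = pd 1 (v1 s) x + pd 2 (v2 s) x"
    define d2 where "d2 = pd 1 (v1 s) x * pd 2 (v2 s) x - pd 2 (v1 s) x * pd 1 (v2 s) x"
    define e where "e = m (s + d) y - m s x - d * b"
    have mm: "\<bar>x * y\<bar> \<le> A\<^sup>2" if "\<bar>x\<bar> \<le> A" "\<bar>y\<bar> \<le> A" for x y :: real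
      unfolding abs_mult power2_eq_square using that A(1) by (intro mult_mono) auto
    have p1: "\<bar>v1 s x * pd 1 (m s) x\<bar> \<le> A\<^sup>2" "\<bar>v2 s x * pd 2 (m s) x\<bar> \<le> A\<^sup>2"
      "\<bar>pd 1 (v1 s) x * pd 2 (v2 s) x\<bar> \<le> A\<^sup>2" "\<bar>pd 2 (v1 s) x * pd 1 (v2 s) x\<bar> \<le> A\<^sup>2"
      by (intro mm A sA)+
    have bA: "\<bar>b\<bar> \<le> A'" unfolding b_def using p1(1,2) A(6)[of x] A'(2) by linarith
    have gA: "\<bar>g\<bar> \<le> A'" unfolding g_def using A(9)[OF sA, of 1 x] A(10)[OF sA, of 2 x] A'(3) by linarith
    have d2A: "\<bar>d2\<bar> \<le> A'" unfolding d2_def using p1(3,4) A'(4) by linarith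
    have aA: "\<bar>m s x\<bar> \<le> A'" using A(2)[OF sA, of x] A'(1) by linarith
    have "e = (m s y - m s x - ((y - x) $ 1 * pd 1 (m s) x + (y - x) $ 2 * pd 2 (m s) x)) + d * ((m1 y - m0 y) - (m1 x - m0 x))"
      unfolding e_def b_def yx by (simp add: m_def algebra_simps)
    moreover have "\<bar>m s y - m s x - ((y - x) $ 1 * pd 1 (m s) x + (y - x) $ 2 * pd 2 (m s) x)\<bar> \<le> 16 * A ^ 3 * d\<^sup>2"
    proof -
      have "\<bar>m s y - m s x - ((y - x) $ 1 * pd 1 (m s) x + (y - x) $ 2 * pd 2 (m s) x)\<bar> \<le> 4 * A * (norm (y - x))\<^sup>2"
        by (rule pd_Taylor[OF m_C2 A(4)[OF sA]])
      also have "\<dots> \<le> 4 * A * (d * (2 * A))\<^sup>2"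
        using nyx A(1) by (intro mult_left_mono power_mono) auto
      also have "\<dots> = 16 * A ^ 3 * d\<^sup>2" by (simp add: power2_eq_square power3_eq_cube)
      finally show ?thesis .
    qed
    moreover have "\<bar>d * ((m1 y - m0 y) - (m1 x - m0 x))\<bar> \<le> 4 * A\<^sup>2 * d\<^sup>2"
    proof -
      have "\<bar>(m1 y - m0 y) - (m1 x - m0 x)\<bar> \<le> 2 * A * norm (y - x)"
        using A(5) by (intro pd_Lipschitz) (auto simp: pd_diff Ck_2D(1)[OF m0] Ck_2D(1)[OF m1] intro!: differentiable_diff)
      also have "\<dots> \<le> 2 * A * (d * (2 * A))" using nyx A(1) by (intro mult_left_mono) auto
      finally have "d * \<bar>(m1 y - m0 y) - (m1 x - m0 x)\<bar> \<le> d * (2 * A * (d * (2 * A)))"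
        using dd by (intro mult_left_mono) auto
      then show ?thesis using dd unfolding abs_mult by (simp add: power2_eq_square mult_ac)
    qed
    ultimately have "\<bar>e\<bar> \<le> (16 * A ^ 3 + 4 * A\<^sup>2) * d\<^sup>2"
      unfolding distrib_right by linarith
    also have "\<dots> \<le> A' * d\<^sup>2" using A'(5) by (intro mult_right_mono) auto
    finally have eA: "\<bar>e\<bar> \<le> A' * d\<^sup>2" .
    have bg: "b + m s x * g = 0" unfolding b_def g_def by (rule continuity_equation[OF sA])
    define P where "P = (m s x + d * b + e) * (1 + d * g + d\<^sup>2 * d2)"
    have step: "m s x - K0 * d\<^sup>2 \<le> P"
      unfolding P_def K0_def by (rule euler_step_algebra[OF _ _ bg aA bA gA d2A eA A'(6)]) (use dd d in auto)
    have P2: "c / 2 \<le> P" using step d(3)[OF dd] m_ge[OF sA, of x] by linarith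
    have "m s x \<le> P + K0 * d\<^sup>2" using step by linarith
    \<comment> \<open>The lower bound \<open>c / 2 <= P\<close> converts the additive error into a
      relative one, which is the kind that multiplies over many steps.\<close>
    also have "K0 * d\<^sup>2 = (2 * K0 / c) * d\<^sup>2 * (c / 2)" using c(1) by simp
    also have "\<dots> \<le> K * d\<^sup>2 * P"
      using P2 c(1) K0 by (intro mult_mono mult_right_mono) (auto simp: K_def)
    also have "P + K * d\<^sup>2 * P = (1 + K * d\<^sup>2) * P" by (simp add: algebra_simps)
    also have "\<dots> \<le> (1 + K * d\<^sup>2) * (\<bar>det (matrix (euler' d s x))\<bar> * m (s + d) (euler d s x))"
    proof (rule mult_left_mono)
      have "P = m (s + d) y * det (matrix (euler' d s x))"
        unfolding P_def e_def g_def d2_def det_euler' by simp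
      also have "\<dots> \<le> m (s + d) y * \<bar>det (matrix (euler' d s x))\<bar>"
        using m_ge[of "s + d" y] s dd c(1) by (intro mult_left_mono) auto
      finally show "P \<le> \<bar>det (matrix (euler' d s x))\<bar> * m (s + d) (euler d s x)" by (simp add: y_def mult.commute)
    qed (use K in simp)
    finally show "m s x \<le> (1 + K * d\<^sup>2) * (\<bar>det (matrix (euler' d s x))\<bar> * m (s + d) (euler d s x))" by simp
  next
    fix s d :: real
    assume s: "0 \<le> s" "s + d \<le> 1" and dd: "0 < d" "d \<le> d0"
    have s1: "s \<le> 1" using s dd by linarith
    note sA = s(1) s1
    have lip: "norm (v s x - v s y) \<le> (4 * A) * norm (x - y)" for x y
      using norm_v_diff_le[of s x y] pd_Lipschitz[OF v_differentiable(1)[OF sA] A(9)[OF sA], of y x]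
        pd_Lipschitz[OF v_differentiable(2)[OF sA] A(10)[OF sA], of y x]
      by (simp add: norm_minus_commute abs_minus_commute)
    obtain H where "\<And>x. H (x + d *\<^sub>R v s x) = x" "\<And>x. H x + d *\<^sub>R v s (H x) = x" "continuous_on UNIV H"
      using near_identity_homeomorphism[of "v s" "4 * A" d, OF lip] dd d(2)[OF dd] A(1) by auto
    then show "\<exists>H. (\<forall>x. H (euler d s x) = x) \<and> (\<forall>x. euler d s (H x) = x) \<and> continuous_on UNIV H"
      unfolding euler_def by blast
  qed
qed

text \<open>\<open>density_step\<close> tested against \<open>F\<close>: the change of variables
  replaces the pulled-back density by \<open>m (s + d)\<close> at the price of the relative defect.
  It is stated for all bounded nonnegative periodic Borel functions, since later both indicators and
  squared speeds are inserted.\<close>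

lemma push_step: "\<exists>K>0. \<exists>d0>0. \<forall>s d F B. 0 \<le> s \<and> s + d \<le> 1 \<and> 0 < d \<and> d \<le> d0 \<and> F \<in> borel_measurable borel \<and> periodic F \<and>
      (\<forall>x. 0 \<le> F x) \<and> (\<forall>x. F x \<le> B) \<longrightarrow>
       (\<integral>x. F (euler d s x) * m s x \<partial>torus) \<le> (1 + K * d\<^sup>2) * (\<integral>x. F x * m (s + d) x \<partial>torus)"
proof -
  obtain K d0 where K: "0 < K" "0 < d0"
    and D: "\<And>s d x. 0 \<le> s \<Longrightarrow> s + d \<le> 1 \<Longrightarrow> 0 < d \<Longrightarrow> d \<le> d0 \<Longrightarrow>
       m s x \<le> (1 + K * d\<^sup>2) * (\<bar>det (matrix (euler' d s x))\<bar> * m (s + d) (euler d s x))"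
    and H: "\<And>s d. 0 \<le> s \<Longrightarrow> s + d \<le> 1 \<Longrightarrow> 0 < d \<Longrightarrow> d \<le> d0 \<Longrightarrow>
       \<exists>H. (\<forall>x. H (euler d s x) = x) \<and> (\<forall>x. euler d s (H x) = x) \<and> continuous_on UNIV H"
    by (rule density_step) (rule that; assumption)
  show ?thesis
  proof (rule exI[of _ K], rule conjI[OF K(1)], rule exI[of _ d0], rule conjI[OF K(2)], intro allI impI)
    fix s d B :: real and F :: "real^2 \<Rightarrow> real"
    assume asm: "0 \<le> s \<and> s + d \<le> 1 \<and> 0 < d \<and> d \<le> d0 \<and> F \<in> borel_measurable borel \<and> periodic F \<and>
      (\<forall>x. 0 \<le> F x) \<and> (\<forall>x. F x \<le> B)"
    then have s: "0 \<le> s" "s + d \<le> 1" and d: "0 < d" "d \<le> d0"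
      and F': "F \<in> borel_measurable borel" "periodic F" "\<forall>x. 0 \<le> F x" "\<forall>x. F x \<le> B" by auto
    note F = F'(1,2) F'(3)[rule_format] F'(4)[rule_format]
    have s1: "s \<le> 1" and sd: "0 \<le> s + d" using s d by auto
    note F(1)[measurable]
    obtain H where H': "\<And>x. H (euler d s x) = x" "\<And>x. euler d s (H x) = x" "continuous_on UNIV H"
      using H[OF s d] by blast
    have mb [measurable]: "m r \<in> borel_measurable borel" for r by (rule continuous_borel[OF Ck_continuous[OF m_C2]])
    have eb [measurable]: "euler d s \<in> borel_measurable borel" by (rule continuous_borel[OF euler_continuous[OF s(1) s1]])
    have db: "(\<lambda>x. det (matrix (euler' d s x))) \<in> borel_measurable borel"
      unfolding det_euler' using v_pd_continuous[OF s(1) s1] by (intro continuous_borel continuous_intros) auto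
    obtain C where C: "\<And>x. \<bar>m (s + d) x\<bar> \<le> C" using Ck_bounded[OF m_C2] by blast
    obtain C' where C': "\<And>x. \<bar>m s x\<bar> \<le> C'" using Ck_bounded[OF m_C2] by blast
    have m0': "0 \<le> m r x" if "0 \<le> r" "r \<le> 1" for r x using m_ge[OF that, of x] c(1) by linarith
    let ?G = "\<lambda>x. F x * m (s + d) x"
    have G: "(\<lambda>x. F x * m (s + d) x) \<in> borel_measurable borel" "periodic ?G"
      "\<And>x. 0 \<le> ?G x" "\<And>x. ?G x \<le> B * C"
    proof -
      show "?G \<in> borel_measurable borel" by measurable
      show "periodic ?G" using F(2) Ck_periodic[OF m_C2] by (simp add: periodic_def)
      show "0 \<le> ?G x" for x using F(3) m0'[OF sd s(2)] by simp
      have "0 \<le> B" using F(3,4) order_trans by blast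
      then show "?G x \<le> B * C" for x using F(3,4) C[of x] m0'[OF sd s(2), of x] by (intro mult_mono) auto
    qed
    note cv = torus_change_of_variables[OF euler_has_derivative[OF s(1) s1] H' euler_lattice G db]
    have "(\<integral>x. F (euler d s x) * m s x \<partial>torus) \<le>
      (\<integral>x. (1 + K * d\<^sup>2) * (\<bar>det (matrix (euler' d s x))\<bar> * (F (euler d s x) * m (s + d) (euler d s x))) \<partial>torus)"
    proof (rule integral_mono)
      show "integrable torus (\<lambda>x. F (euler d s x) * m s x)"
      proof (rule torus_integrable_bounded)
        show "norm (F (euler d s x) * m s x) \<le> B * C'" for x
          unfolding real_norm_def abs_mult using F(3,4)[of "euler d s x"] C'[of x] by (intro mult_mono) auto
      qed measurable
      show "integrable torus (\<lambda>x. (1 + K * d\<^sup>2) * (\<bar>det (matrix (euler' d s x))\<bar> * (F (euler d s x) * m (s + d) (euler d s x))))"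
        by (intro integrable_mult_right cv(2))
      show "F (euler d s x) * m s x \<le> (1 + K * d\<^sup>2) * (\<bar>det (matrix (euler' d s x))\<bar> * (F (euler d s x) * m (s + d) (euler d s x)))" for x
        using mult_left_mono[OF D[OF s d, of x] F(3)[of "euler d s x"]] by (simp add: mult_ac)
    qed
    also have "\<dots> = (1 + K * d\<^sup>2) * (\<integral>x. F x * m (s + d) x \<partial>torus)"
      by (simp only: integral_mult_right_zero cv(1))
    finally show "(\<integral>x. F (euler d s x) * m s x \<partial>torus) \<le> (1 + K * d\<^sup>2) * (\<integral>x. F x * m (s + d) x \<partial>torus)" .
  qed
qed

section \<open>Iterated Euler steps and the transport cost\<close>

primrec iter :: "real \<Rightarrow> nat \<Rightarrow> real^2 \<Rightarrow> real^2" where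
  "iter d 0 x = x"
| "iter d (Suc k) x = euler d (real k * d) (iter d k x)"

lemma iter_continuous:
  assumes "0 \<le> d" "real k * d \<le> 1"
  shows "continuous_on UNIV (iter d k)"
  using assms(2)
proof (induction k)
  case (Suc k)
  have kd: "0 \<le> real k * d" "real k * d \<le> 1" using Suc.prems assms(1) by (auto simp: algebra_simps)
  show ?case
    using continuous_on_compose2[OF euler_continuous[OF kd] Suc.IH[OF kd(2)]] by simp
qed simp

lemma iter_displacement: "iter d k x - x = (\<Sum>i<k. d *\<^sub>R v (real i * d) (iter d i x))"
  by (induction k) (simp_all add: euler_def algebra_simps)

text \<open>A discrete form of the Benamou-Brenier upper bound. The kinetic energy density
  \<open>|v|^2 m\<close> equals \<open>|q|^2 / m s\<close> and is at most \<open>|q|^2 / c\<close>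
  at every intermediate time; the composed map is nearly a transport map, and the mass it misses
  disappears as \<open>N\<close> grows.\<close>

lemma Moser_W2:
  assumes mass: "(\<integral>x. m0 x \<partial>torus) = 1" "(\<integral>x. m1 x \<partial>torus) = 1"
  shows "W2 (torus_density m0) (torus_density m1) \<le> sqrt ((\<integral>x. (q1 x)\<^sup>2 + (q2 x)\<^sup>2 \<partial>torus) / c)"
proof -
  define Q where "Q = (\<integral>x. (q1 x)\<^sup>2 + (q2 x)\<^sup>2 \<partial>torus) / c"
  have qC: "Ck 0 (\<lambda>x. (q1 x)\<^sup>2 + (q2 x)\<^sup>2)" using Ck_1D(3)[OF q1] Ck_1D(3)[OF q2] by (intro Ck_intros)
  have Q0: "0 \<le> Q" unfolding Q_def using c(1) by (intro divide_nonneg_pos integral_nonneg_AE) auto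
  obtain K d0 where K: "0 < K" and d0: "0 < d0"
    and push': "\<forall>s d F B. 0 \<le> s \<and> s + d \<le> 1 \<and> 0 < d \<and> d \<le> d0 \<and> F \<in> borel_measurable borel \<and> periodic F \<and>
      (\<forall>x. 0 \<le> F x) \<and> (\<forall>x. F x \<le> B) \<longrightarrow>
       (\<integral>x. F (euler d s x) * m s x \<partial>torus) \<le> (1 + K * d\<^sup>2) * (\<integral>x. F x * m (s + d) x \<partial>torus)"
    using push_step by (elim exE conjE)
  have push: "(\<integral>x. F (euler d s x) * m s x \<partial>torus) \<le> (1 + K * d\<^sup>2) * (\<integral>x. F x * m (s + d) x \<partial>torus)"
    if "0 \<le> s" "s + d \<le> 1" "0 < d" "d \<le> d0" "F \<in> borel_measurable borel" "periodic F" "\<And>x. 0 \<le> F x" "\<And>x. F x \<le> B"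
    for s d F B
    by (rule push'[rule_format]) (use that in blast)
  have bound: "W2 (torus_density m0) (torus_density m1) \<le> sqrt (Q + 2 * K / real N)"
    if N: "0 < N" "1 / d0 \<le> real N" for N
  proof -
    define d where "d = 1 / real N"
    have d: "0 < d" "d \<le> d0" "real N * d = 1" using N d0 by (auto simp: d_def field_simps)
    have kd: "0 \<le> real k * d" "real k * d \<le> 1" if "k \<le> N" for k
      using that N d by (auto simp: d_def)
    have it: "(\<integral>x. F (iter d k x) * m0 x \<partial>torus) \<le> (1 + K * d\<^sup>2) ^ k * (\<integral>x. F x * m (real k * d) x \<partial>torus)"
      if "k \<le> N" "F \<in> borel_measurable borel" "periodic F" "\<And>x. 0 \<le> F x" "\<And>x. F x \<le> B" for k F B
      using that
    proof (induction k arbitrary: F)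
      case 0
      then show ?case by (simp add: m_ends)
    next
      case (Suc k)
      have k: "0 \<le> real k * d" "real k * d \<le> 1" using kd[of k] Suc.prems(1) by auto
      have k1: "real k * d + d \<le> 1" using kd(2)[OF Suc.prems(1)] by (simp add: algebra_simps)
      have "(\<integral>x. F (iter d (Suc k) x) * m0 x \<partial>torus) \<le> (1 + K * d\<^sup>2) ^ k * (\<integral>x. F (euler d (real k * d) x) * m (real k * d) x \<partial>torus)"
        unfolding iter.simps
      proof (rule Suc.IH[where F = "\<lambda>x. F (euler d (real k * d) x)"])
        show "(\<lambda>x. F (euler d (real k * d) x)) \<in> borel_measurable borel"
          by (rule measurable_compose[OF continuous_borel[OF euler_continuous[OF k]] Suc.prems(2)])
        show "periodic (\<lambda>x. F (euler d (real k * d) x))"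
          using Suc.prems(3) by (simp add: periodic_iff euler_lattice)
      qed (use Suc.prems in auto)
      also have "\<dots> \<le> (1 + K * d\<^sup>2) ^ k * ((1 + K * d\<^sup>2) * (\<integral>x. F x * m (real k * d + d) x \<partial>torus))"
        using K by (intro mult_left_mono push[OF k(1) k1 d(1,2) Suc.prems(2,3,4,5)]) auto
      finally show ?case by (simp add: algebra_simps)
    qed
    \<comment> \<open>The reciprocal of the accumulated defect: it makes \<open>it\<close> the
      domination required by \<open>W2_le_map\<close> and cancels the same factor in the
      cost.\<close>
    define p where "p = 1 / (1 + K * d\<^sup>2) ^ N"
    have Kd: "0 < K * d\<^sup>2" using K d by simp
    then have "1 < (1 + K * d\<^sup>2) ^ N" using N(1) by (intro one_less_power) auto
    then have p: "0 < p" "p < 1" unfolding p_def by auto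
    have pinv: "p * (1 + K * d\<^sup>2) ^ N = 1" unfolding p_def using Kd by simp
    have m00: "0 \<le> m0 x" "0 \<le> m1 x" for x using c(1) c(2)[of x] c(3)[of x] by auto
    let ?w = "\<lambda>i x. (v1 (real i * d) x)\<^sup>2 + (v2 (real i * d) x)\<^sup>2"
    have wc: "continuous_on UNIV (?w i)" if "i < N" for i
      using v_pd_continuous(3,4)[OF kd[of i]] that by (intro continuous_intros) auto
    have wi: "continuous_on UNIV (\<lambda>x. ?w i (iter d i x) * m0 x)" if "i < N" for i
    proof -
      have "continuous_on UNIV (iter d i)" using iter_continuous[of d i] d(1) kd[of i] that by auto
      from continuous_on_compose2[OF wc[OF that] this]
      have "continuous_on UNIV (\<lambda>x. ?w i (iter d i x))" by simp
      then show ?thesis by (intro continuous_on_mult Ck_continuous[OF m0])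
    qed
    have w_le: "(\<integral>x. ?w i (iter d i x) * m0 x \<partial>torus) \<le> (1 + K * d\<^sup>2) ^ N * Q" if i: "i < N" for i
    proof -
      have per: "periodic (?w i)"
        using v_periodic[of "real i * d"] by (simp add: periodic_iff v_def vec_eq_iff forall_2)
      obtain B where B: "\<And>x. norm (?w i x) \<le> B" using bounded_continuous_periodic[OF wc[OF i] per] by blast
      have "(\<integral>x. ?w i (iter d i x) * m0 x \<partial>torus) \<le> (1 + K * d\<^sup>2) ^ i * (\<integral>x. ?w i x * m (real i * d) x \<partial>torus)"
      proof (rule it[where F = "?w i" and B = B])
        show "?w i x \<le> B" for x using B[of x] by (simp add: abs_le_iff)
      qed (use i per in \<open>auto intro: continuous_borel wc\<close>)
      also have "\<dots> \<le> (1 + K * d\<^sup>2) ^ N * Q"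
      proof (rule mult_mono)
        show "(1 + K * d\<^sup>2) ^ i \<le> (1 + K * d\<^sup>2) ^ N" using i Kd by (intro power_increasing) auto
        have "(\<integral>x. ?w i x * m (real i * d) x \<partial>torus) \<le> (\<integral>x. ((q1 x)\<^sup>2 + (q2 x)\<^sup>2) / c \<partial>torus)"
        proof (rule integral_mono)
          show "integrable torus (\<lambda>x. ?w i x * m (real i * d) x)"
            by (intro torus_integrable_continuous continuous_intros wc[OF i] Ck_continuous[OF m_C2])
          show "integrable torus (\<lambda>x. ((q1 x)\<^sup>2 + (q2 x)\<^sup>2) / c)"
            using Ck_integrable[OF qC] by simp
          fix x
          have mx: "c \<le> m (real i * d) x" "0 < m (real i * d) x" using m_ge[OF kd, of i x] i c(1) by auto
          have "?w i x * m (real i * d) x = ((q1 x)\<^sup>2 + (q2 x)\<^sup>2) / m (real i * d) x"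
            using mx by (simp add: v1_def v2_def power_divide add_divide_distrib[symmetric] power2_eq_square)
          also have "\<dots> \<le> ((q1 x)\<^sup>2 + (q2 x)\<^sup>2) / c" using mx c(1) by (intro divide_left_mono) auto
          finally show "?w i x * m (real i * d) x \<le> ((q1 x)\<^sup>2 + (q2 x)\<^sup>2) / c" .
        qed
        then show "(\<integral>x. ?w i x * m (real i * d) x \<partial>torus) \<le> Q" by (simp add: Q_def)
        show "0 \<le> (\<integral>x. ?w i x * m (real i * d) x \<partial>torus)"
          using m_ge[OF kd, of i] i c(1) by (intro integral_nonneg_AE AE_I2 mult_nonneg_nonneg) (auto intro: order_trans less_imp_le)
      qed (use Kd in simp)
      finally show ?thesis .
    qed
    have "(\<integral>x. (dist x (iter d N x))\<^sup>2 * m0 x \<partial>torus) \<le> (\<integral>x. (\<Sum>i<N. d * (?w i (iter d i x) * m0 x)) \<partial>torus)"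
    proof (rule integral_mono)
      show "integrable torus (\<lambda>x. (dist x (iter d N x))\<^sup>2 * m0 x)"
        by (intro torus_integrable_continuous continuous_intros iter_continuous Ck_continuous[OF m0]) (use d in auto)
      show "integrable torus (\<lambda>x. \<Sum>i<N. d * (?w i (iter d i x) * m0 x))"
        by (intro Bochner_Integration.integrable_sum integrable_mult_right torus_integrable_continuous wi) auto
      fix x
      have "dist x (iter d N x) = norm (\<Sum>i<N. d *\<^sub>R v (real i * d) (iter d i x))"
        unfolding iter_displacement[symmetric] by (simp add: dist_norm norm_minus_commute)
      also have "\<dots> \<le> (\<Sum>i<N. norm (d *\<^sub>R v (real i * d) (iter d i x)))" by (rule norm_sum)
      finally have "(dist x (iter d N x))\<^sup>2 \<le> (\<Sum>i<N. norm (d *\<^sub>R v (real i * d) (iter d i x)))\<^sup>2"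
        by (intro power_mono) auto
      \<comment> \<open>Cauchy-Schwarz over the steps: as \<open>N d^2 = d\<close>, the squared
        displacement is at most the time average of the squared speeds.\<close>
      also have "\<dots> \<le> (\<Sum>i<N. (norm (d *\<^sub>R v (real i * d) (iter d i x)))\<^sup>2) * card {..<N}"
        by (rule sum_squared_le_sum_of_squares)
      also have "\<dots> = (\<Sum>i<N. d * ?w i (iter d i x))"
      proof -
        have "(norm (v s y))\<^sup>2 = (v1 s y)\<^sup>2 + (v2 s y)\<^sup>2" for s y
          by (simp add: norm_vec_def L2_set_def sum_2)
        then show ?thesis using d by (simp add: power_mult_distrib sum_distrib_right) (simp add: d_def power2_eq_square)
      qed
      finally have "(dist x (iter d N x))\<^sup>2 * m0 x \<le> (\<Sum>i<N. d * ?w i (iter d i x)) * m0 x"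
        using m00 by (intro mult_right_mono) auto
      then show "(dist x (iter d N x))\<^sup>2 * m0 x \<le> (\<Sum>i<N. d * (?w i (iter d i x) * m0 x))"
        by (simp only: sum_distrib_right mult.assoc)
    qed
    also have "\<dots> = (\<Sum>i<N. d * (\<integral>x. ?w i (iter d i x) * m0 x \<partial>torus))"
      by (subst Bochner_Integration.integral_sum)
         (auto intro!: integrable_mult_right torus_integrable_continuous wi)
    also have "\<dots> \<le> (\<Sum>i<N. d * ((1 + K * d\<^sup>2) ^ N * Q))"
      using d by (intro sum_mono mult_left_mono w_le) auto
    also have "\<dots> = (1 + K * d\<^sup>2) ^ N * Q" using d(3) by (simp add: mult.assoc[symmetric])
    finally have cost: "(\<integral>x. (dist x (iter d N x))\<^sup>2 * m0 x \<partial>torus) \<le> (1 + K * d\<^sup>2) ^ N * Q" .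
    have W: "W2 (torus_density m0) (torus_density m1) \<le> sqrt (p * ((1 + K * d\<^sup>2) ^ N * Q) + 2 * (1 - p))"
    proof (rule W2_le_map[OF m0 m00(1) mass(1) m1 m00(2) mass(2) iter_continuous p _ cost])
      fix F :: "real^2 \<Rightarrow> real"
      assume F: "F \<in> borel_measurable borel" "periodic F" "\<And>x. 0 \<le> F x" "\<And>x. F x \<le> 1"
      have "p * (\<integral>x. F (iter d N x) * m0 x \<partial>torus) \<le> p * ((1 + K * d\<^sup>2) ^ N * (\<integral>x. F x * m (real N * d) x \<partial>torus))"
        using p by (intro mult_left_mono it[OF order_refl F]) auto
      also have "\<dots> = (\<integral>x. F x * m1 x \<partial>torus)"
        by (simp add: mult.assoc[symmetric] pinv d(3) m_ends)
      finally show "p * (\<integral>x. F (iter d N x) * m0 x \<partial>torus) \<le> (\<integral>x. F x * m1 x \<partial>torus)" .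
    qed (use d in auto)
    \<comment> \<open>Compounding \<open>N\<close> defects of size \<open>K / N^2\<close> costs at
      most \<open>exp (K / N)\<close>, so the missing mass \<open>1 - p\<close> is at most
      \<open>K / N\<close>.\<close>
    have "(1 + K * d\<^sup>2) ^ N \<le> exp (K * d\<^sup>2) ^ N" using Kd by (intro power_mono) auto
    also have "\<dots> = exp (K / real N)" using N by (simp add: exp_of_nat_mult[symmetric] d_def power2_eq_square)
    finally have "1 / exp (K / real N) \<le> p" unfolding p_def using Kd by (intro divide_left_mono) auto
    moreover have "1 - K / real N \<le> exp (- (K / real N))" using exp_ge_add_one_self[of "- (K / real N)"] by simp
    ultimately have "2 * (1 - p) \<le> 2 * K / real N" by (simp add: exp_minus inverse_eq_divide)
    moreover have "p * ((1 + K * d\<^sup>2) ^ N * Q) = Q" by (simp add: mult.assoc[symmetric] pinv)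
    ultimately have "p * ((1 + K * d\<^sup>2) ^ N * Q) + 2 * (1 - p) \<le> Q + 2 * K / real N" by linarith
    from order_trans[OF W real_sqrt_le_mono[OF this]] show ?thesis .
  qed
  have "(W2 (torus_density m0) (torus_density m1))\<^sup>2 \<le> Q"
  proof (rule field_le_epsilon)
    fix e :: real assume e: "0 < e"
    obtain N where N: "real N > max (1 / d0) (2 * K / e)" using reals_Archimedean2 by blast
    then have N': "0 < N" "1 / d0 \<le> real N" "2 * K / real N \<le> e"
    proof -
      have "0 < 1 / d0" using d0 by simp
      with N have "0 < real N" by linarith
      with N show "0 < N" "1 / d0 \<le> real N" by auto
      with N e show "2 * K / real N \<le> e" by (auto simp: field_simps)
    qed
    have W0: "0 \<le> W2 (torus_density m0) (torus_density m1)" by (simp add: W2_def)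
    have "(W2 (torus_density m0) (torus_density m1))\<^sup>2 \<le> (sqrt (Q + 2 * K / real N))\<^sup>2"
      by (rule power_mono[OF bound[OF N'(1,2)] W0])
    also have "\<dots> = Q + 2 * K / real N" using Q0 K by (intro real_sqrt_pow2 add_nonneg_nonneg) auto
    also have "\<dots> \<le> Q + e" using N'(3) by simp
    finally show "(W2 (torus_density m0) (torus_density m1))\<^sup>2 \<le> Q + e" .
  qed
  then show ?thesis unfolding Q_def[symmetric] by (rule real_le_rsqrt)
qed

end

section \<open>Smooth evolutions and transport\<close>

lemma smooth_on_derivative:
  assumes "smooth_on S f"
  obtains D where "\<And>x. x \<in> S \<Longrightarrow> (f has_derivative D x) (at x within S)" "\<And>v. smooth_on S (\<lambda>x. D x v)"
  using assms by (cases rule: smooth_on.cases) blast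

lemma smooth_on_cong:
  assumes "smooth_on S f" "\<And>x. x \<in> S \<Longrightarrow> f x = g x"
  shows "smooth_on S g"
proof -
  obtain D where D: "\<And>x. x \<in> S \<Longrightarrow> (f has_derivative D x) (at x within S)" "\<And>v. smooth_on S (\<lambda>x. D x v)"
    using smooth_on_derivative[OF assms(1)] by blast
  have "(g has_derivative D x) (at x within S)" if "x \<in> S" for x
    using D(1)[OF that] by (rule has_derivative_transform[OF that, rotated]) (simp add: assms(2))
  then show ?thesis using D(2) by (rule smooth_on.intros)
qed

lemma pd_periodic:
  assumes "periodic f" "\<And>x. f differentiable at x"
  shows "periodic (pd i f)"
  unfolding periodic_iff
proof (intro allI)
  fix x k
  have "((\<lambda>y. f (y + lattice_point k)) has_derivative frechet_derivative f (at (x + lattice_point k))) (at x)"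
    by (rule has_derivative_compose[OF _ frechet_pd[OF assms(2)], of "\<lambda>y. y + lattice_point k" "\<lambda>h. h" x UNIV])
       (auto intro!: derivative_eq_intros)
  then have "(f has_derivative frechet_derivative f (at (x + lattice_point k))) (at x)"
    by (simp add: periodicD[OF assms(1)])
  from pd_eq[OF this] show "pd i f (x + lattice_point k) = pd i f x"
    by (simp add: pd_def gradient_def)
qed

text \<open>A time slice is a full plane inside the slab, so the derivative within the slab
  restricts to an ordinary spatial derivative. Evaluated in a spatial direction it is again smooth
  on the slab, so the class is closed under \<open>pd\<close> and all orders follow by
  iteration.\<close>

lemma evolution_derivatives:
  assumes f: "smooth_torus_evolution T f"
  shows "t \<in> {0..T} \<Longrightarrow> f t differentiable at x" "smooth_torus_evolution T (\<lambda>t. pd i (f t))"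
    "continuous_on ({0..T} \<times> UNIV) (\<lambda>(t, x). f t x)"
proof -
  let ?S = "{0..T} \<times> (UNIV :: (real^2) set)"
  obtain D where D: "\<And>z. z \<in> ?S \<Longrightarrow> ((\<lambda>(t, x). f t x) has_derivative D z) (at z within ?S)" "\<And>v. smooth_on ?S (\<lambda>z. D z v)"
    using f smooth_on_derivative unfolding smooth_torus_evolution_def by blast
  show "continuous_on ?S (\<lambda>(t, x). f t x)"
    using D(1) by (auto simp: continuous_on_eq_continuous_within intro: has_derivative_continuous)
  have dx: "(f t has_derivative (\<lambda>h. D (t, x) (0, h))) (at x)" if t: "t \<in> {0..T}" for t x
  proof -
    have "((\<lambda>y. (\<lambda>(t, x). f t x) (t, y)) has_derivative (\<lambda>h. D (t, x) (0, h))) (at x within UNIV)"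
    proof (rule has_derivative_in_compose[where g = "\<lambda>(t, x). f t x" and f = "\<lambda>y. (t, y)" and f' = "\<lambda>h. (0, h)"])
      show "((\<lambda>y. (t, y)) has_derivative (\<lambda>h. (0, h))) (at x within UNIV)"
        by (auto intro!: derivative_eq_intros)
      show "((\<lambda>(t, x). f t x) has_derivative D (t, x)) (at (t, x) within range (\<lambda>y. (t, y)))"
        by (rule has_derivative_subset[OF D(1)]) (use t in auto)
    qed
    then show ?thesis by simp
  qed
  then show d: "f t differentiable at x" if "t \<in> {0..T}" for t x
    using that by (auto simp: differentiable_def)
  show "smooth_torus_evolution T (\<lambda>t. pd i (f t))"
    unfolding smooth_torus_evolution_def
  proof
    show "\<forall>t\<in>{0..T}. periodic (pd i (f t))"
      using f d by (auto simp: smooth_torus_evolution_def intro!: pd_periodic)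
    show "smooth_on ?S (\<lambda>(t, x). pd i (f t) x)"
      by (rule smooth_on_cong[OF D(2)[of "(0, axis i 1)"]]) (auto simp: pd_eq[OF dx])
  qed
qed

lemma evolution_Ck:
  assumes "smooth_torus_evolution T f" "t \<in> {0..T}"
  shows "Ck n (f t)"
  using assms(1)
proof (induction n arbitrary: f)
  case 0
  have "continuous_on UNIV (f t)"
    using evolution_derivatives(1)[OF 0 assms(2)]
    by (meson continuous_at_imp_continuous_on differentiable_imp_continuous_within)
  then show ?case using 0 assms(2) by (simp add: Ck.simps smooth_torus_evolution_def)
next
  case (Suc n)
  have "Ck n (pd i (f t))" for i
    by (rule Suc.IH[OF evolution_derivatives(2)[OF Suc.prems]])
  then show ?case
    using evolution_derivatives(1)[OF Suc.prems assms(2)] Suc.prems assms(2)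
    by (simp add: Ck.simps smooth_torus_evolution_def)
qed

lemma continuous_on_slab:
  assumes "continuous_on ({a..b} \<times> UNIV) (\<lambda>(t, x). f t x)"
  shows "continuous_on ({a..b} \<times> UNIV) (\<lambda>z. f (fst z) (snd z))"
  using assms by (simp add: case_prod_unfold)

lemma bounded_on_slab:
  fixes f :: "real \<Rightarrow> real^2 \<Rightarrow> 'b::real_normed_vector"
  assumes c: "continuous_on ({a..b} \<times> UNIV) (\<lambda>(t, x). f t x)" and p: "\<And>t. t \<in> {a..b} \<Longrightarrow> periodic (f t)"
  obtains B where "0 \<le> B" "\<And>t x. t \<in> {a..b} \<Longrightarrow> norm (f t x) \<le> B"
proof -
  have "compact ((\<lambda>(t, x). f t x) ` ({a..b} \<times> cbox 0 1))"
    by (intro compact_continuous_image continuous_on_subset[OF c] compact_Times) auto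
  from compact_imp_bounded[OF this] obtain B where B: "0 < B" "\<forall>y\<in>(\<lambda>(t, x). f t x) ` ({a..b} \<times> cbox 0 1). norm y \<le> B"
    unfolding bounded_pos by (elim exE conjE)
  have "norm (f t x) \<le> B" if t: "t \<in> {a..b}" for t x
  proof -
    obtain k where "x + lattice_point k \<in> unit_cell" using ex1_lattice_point by blast
    then have "x + lattice_point k \<in> cbox 0 1" using unit_cell_bounds(2) by blast
    then have "norm (f t (x + lattice_point k)) \<le> B" using B(2) t by force
    then show ?thesis by (simp add: periodicD[OF p[OF t]])
  qed
  with B(1) show thesis by (intro that[of B]) auto
qed

section \<open>Integrals of brackets and conserved quantities\<close>

lemma bracket_eq: "bracket f g x = br f g x"
  by (simp add: bracket_def perp_gradient_def br_def inner_vec_def sum_2 gradient_nth)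

lemma Ck_br: "Ck (Suc n) a \<Longrightarrow> Ck (Suc n) b \<Longrightarrow> Ck n (br a b)"
  unfolding br_def by (intro Ck_intros Ck_pd)

lemma Ck_br_0: "Ck 1 a \<Longrightarrow> Ck 1 b \<Longrightarrow> Ck 0 (br a b)"
  using Ck_br[of 0 a b] by simp

lemma torus_integral_simps:
  assumes "Ck 0 f" "Ck 0 g"
  shows "(\<integral>x. f x + g x \<partial>torus) = (\<integral>x. f x \<partial>torus) + (\<integral>x. g x \<partial>torus)"
    and "(\<integral>x. f x - g x \<partial>torus) = (\<integral>x. f x \<partial>torus) - (\<integral>x. g x \<partial>torus)"
  using Ck_integrable[OF assms(1)] Ck_integrable[OF assms(2)] by auto

text \<open>Integration by parts puts both derivatives on \<open>a\<close>, where the mixed ones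
  cancel; hence the unequal regularity of \<open>a\<close> and \<open>b\<close>.\<close>

lemma integral_br:
  assumes a: "Ck 2 a" and b: "Ck 1 b"
  shows "(\<integral>x. br a b x \<partial>torus) = 0"
proof -
  note ab = Ck_2D(2)[OF a] b
  have "(\<integral>x. br a b x \<partial>torus) = (\<integral>x. pd 1 a x * pd 2 b x \<partial>torus) - (\<integral>x. pd 2 a x * pd 1 b x \<partial>torus)"
    unfolding br_def by (intro torus_integral_simps Ck_mult Ck_1D(2,3) ab)
  also have "\<dots> = - (\<integral>x. pd 2 (pd 1 a) x * b x \<partial>torus) + (\<integral>x. pd 1 (pd 2 a) x * b x \<partial>torus)"
    by (simp add: integral_pd_mult[OF ab])
  also have "(\<lambda>x. pd 2 (pd 1 a) x * b x) = (\<lambda>x. pd 1 (pd 2 a) x * b x)"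
    by (simp add: pd_commute[OF a, of 2 1])
  finally show ?thesis by simp
qed

lemma br_mult: "Ck 1 b \<Longrightarrow> Ck 1 c \<Longrightarrow> br a (\<lambda>x. b x * c x) x = b x * br a c x + c x * br a b x"
  by (simp add: br_def pd_mult Ck_1D algebra_simps)

text \<open>The bracket with \<open>a\<close> is a derivation whose values have integral zero, hence
  it is skew-adjoint.\<close>

lemma integral_br_antisym:
  assumes a: "Ck 2 a" and b: "Ck 1 b" and c: "Ck 1 c"
  shows "(\<integral>x. c x * br a b x \<partial>torus) = - (\<integral>x. b x * br a c x \<partial>torus)"
proof -
  have "0 = (\<integral>x. br a (\<lambda>x. b x * c x) x \<partial>torus)" by (simp add: integral_br[OF a Ck_mult[OF b c]])
  also have "\<dots> = (\<integral>x. b x * br a c x + c x * br a b x \<partial>torus)" by (simp add: br_mult[OF b c])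
  also have "\<dots> = (\<integral>x. b x * br a c x \<partial>torus) + (\<integral>x. c x * br a b x \<partial>torus)"
    using Ck_1D(3)[OF b] Ck_1D(3)[OF c] by (intro torus_integral_simps Ck_mult Ck_br_0 Ck_2D(3) a b c)
  finally show ?thesis by simp
qed

lemma conservation:
  assumes \<psi>: "smooth_torus_evolution T \<psi>" and \<rho>: "smooth_torus_evolution T \<rho>" and tr: "transported T \<psi> \<rho>"
    and F: "\<And>y. (F has_real_derivative F' y) (at y)" "continuous_on UNIV F'" and t: "t \<in> {0..T}"
  shows "(\<integral>x. F (\<rho> t x) \<partial>torus) = (\<integral>x. F (\<rho> 0 x) \<partial>torus)"
proof -
  have cF: "continuous_on UNIV F"
    using F(1) by (meson DERIV_isCont continuous_at_imp_continuous_on)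
  have "((\<lambda>s. \<integral>x. F (\<rho> s x) \<partial>torus) has_real_derivative 0) (at s within {0..T})" if s: "s \<in> {0..T}" for s
  proof -
    have D: "((\<lambda>s. F (\<rho> s x)) has_real_derivative F' (\<rho> s x) * - br (\<psi> s) (\<rho> s) x) (at s within {0..T})" if "s \<in> {0..T}" for s x
    proof -
      have "((\<lambda>s. \<rho> s x) has_real_derivative - br (\<psi> s) (\<rho> s) x) (at s within {0..T})"
        using tr that by (simp add: transported_def bracket_eq)
      from DERIV_chain2[OF F(1) this] show ?thesis .
    qed
    have c: "continuous_on ({0..T} \<times> UNIV) (\<lambda>z. \<rho> (fst z) (snd z))"
      "continuous_on ({0..T} \<times> UNIV) (\<lambda>z. pd i (\<rho> (fst z)) (snd z))"
      "continuous_on ({0..T} \<times> UNIV) (\<lambda>z. pd i (\<psi> (fst z)) (snd z))" for i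
      using \<rho> \<psi> by (auto intro!: continuous_on_slab evolution_derivatives)
    have cF': "continuous_on ({0..T} \<times> UNIV) (\<lambda>z. F' (\<rho> (fst z) (snd z)))"
      by (rule continuous_on_compose2[OF F(2) c(1)]) simp
    have cont: "continuous_on ({0..T} \<times> UNIV) (\<lambda>(s, x). F' (\<rho> s x) * - br (\<psi> s) (\<rho> s) x)"
      unfolding case_prod_unfold br_def by (intro continuous_on_mult continuous_on_minus continuous_on_diff c cF')
    have "((\<lambda>s. \<integral>x. F (\<rho> s x) \<partial>torus) has_real_derivative (\<integral>x. F' (\<rho> s x) * - br (\<psi> s) (\<rho> s) x \<partial>torus)) (at s within {0..T})"
      by (rule torus_leibniz[OF D cont _ s])
         (auto intro!: continuous_on_compose2[OF cF] Ck_continuous[OF evolution_Ck[OF \<rho>]])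
    moreover have "(\<integral>x. F' (\<rho> s x) * - br (\<psi> s) (\<rho> s) x \<partial>torus) = 0"
    proof -
      have r1: "Ck 1 (\<rho> s)" and p2: "Ck 2 (\<psi> s)" by (intro evolution_Ck[OF _ s] \<rho> \<psi>)+
      have "F' (\<rho> s x) * - br (\<psi> s) (\<rho> s) x = - br (\<psi> s) (\<lambda>x. F (\<rho> s x)) x" for x
        by (simp add: br_def Ck_compose(2)[OF r1 F] algebra_simps)
      then show ?thesis using integral_br[OF p2 Ck_compose(1)[OF r1 F]] by simp
    qed
    ultimately show ?thesis by simp
  qed
  from has_field_derivative_zero_constant[OF convex_real_interval(5) this]
  obtain c where "\<forall>s\<in>{0..T}. (\<integral>x. F (\<rho> s x) \<partial>torus) = c" ..
  then show ?thesis using t by auto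
qed

lemma positive_part_square_derivative:
  "((\<lambda>u::real. (max 0 u)\<^sup>2) has_real_derivative 2 * max 0 u) (at u)"
proof -
  consider "u < 0" | "u = 0" | "u > 0" by linarith
  then show ?thesis
  proof cases
    case 1
    have "((\<lambda>u::real. 0) has_real_derivative 0) (at u)" by simp
    then have "((\<lambda>u::real. (max 0 u)\<^sup>2) has_real_derivative 0) (at u)"
      by (rule has_field_derivative_transform_within_open[where S = "{..<0}"]) (use 1 in auto)
    then show ?thesis using 1 by simp
  next
    case 2
    have "((\<lambda>h::real. ((max 0 (0 + h))\<^sup>2 - (max 0 0)\<^sup>2) / h) \<longlongrightarrow> 0) (at 0)"
    proof (rule Lim_null_comparison[where g = "\<lambda>h. \<bar>h\<bar>"])
      show "\<forall>\<^sub>F h in at 0. norm (((max 0 (0 + h))\<^sup>2 - (max 0 0)\<^sup>2) / h) \<le> \<bar>h :: real\<bar>"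
        by (rule always_eventually) (auto simp: max_def power2_eq_square)
      show "((\<lambda>h::real. \<bar>h\<bar>) \<longlongrightarrow> 0) (at 0)" by (auto intro!: tendsto_eq_intros)
    qed
    then show ?thesis using 2 by (simp add: DERIV_def)
  next
    case 3
    have "((\<lambda>u::real. u\<^sup>2) has_real_derivative 2 * u) (at u)" by (auto intro!: derivative_eq_intros)
    then have "((\<lambda>u::real. (max 0 u)\<^sup>2) has_real_derivative 2 * u) (at u)"
      by (rule has_field_derivative_transform_within_open[where S = "{0<..}"]) (use 3 in auto)
    then show ?thesis using 3 by simp
  qed
qed

text \<open>Maximum principle without characteristics: \<open>F\<close> is a \<open>C^1\<close>
  function that vanishes exactly on the values of size at most \<open>M\<close>. Its integral along
  \<open>\<rho>\<close> is conserved and initially zero, so the integrand vanishes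
  everywhere.\<close>

lemma transported_bound:
  assumes \<psi>: "smooth_torus_evolution T \<psi>" and \<rho>: "smooth_torus_evolution T \<rho>" and tr: "transported T \<psi> \<rho>"
    and M: "\<And>x. \<bar>\<rho> 0 x\<bar> \<le> M" and t: "t \<in> {0..T}"
  shows "\<bar>\<rho> t x\<bar> \<le> M"
proof -
  define F where "F y = (max 0 (y\<^sup>2 - M\<^sup>2))\<^sup>2" for y :: real
  have M0: "0 \<le> M" using M[of 0] by linarith
  have D: "(F has_real_derivative 2 * max 0 (y\<^sup>2 - M\<^sup>2) * (2 * y)) (at y)" for y
    unfolding F_def
    by (rule DERIV_chain2[OF positive_part_square_derivative]) (auto intro!: derivative_eq_intros)
  have "F (\<rho> 0 x) = 0" for x
    using power_mono[OF M[of x] abs_ge_zero, of 2] by (simp add: F_def)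
  then have 0: "(\<integral>x. F (\<rho> t x) \<partial>torus) = 0"
    using conservation[OF \<psi> \<rho> tr D _ t] by (simp add: continuous_intros)
  have c: "Ck 1 (\<lambda>x. F (\<rho> t x))"
    by (rule Ck_compose(1)[OF evolution_Ck[OF \<rho> t] D]) (intro continuous_intros)
  have "F (\<rho> t x) = 0"
    by (rule torus_integral_nonneg_eq_0[OF Ck_continuous[OF c] Ck_periodic[OF c] _ 0]) (simp add: F_def)
  then have "\<bar>\<rho> t x\<bar>\<^sup>2 \<le> M\<^sup>2" by (simp add: F_def max_def split: if_splits)
  then show ?thesis using M0 by (rule power2_le_imp_le)
qed

text \<open>For continuous periodic functions the essential supremum is a true upper bound: the
  positive part of the excess is continuous and its integral vanishes.\<close>

lemma Linf_norm:
  fixes f :: "real^2 \<Rightarrow> 'b::real_normed_vector"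
  assumes c: "continuous_on UNIV f" and p: "periodic f"
  shows "norm (f x) \<le> Linf_norm f" "(\<And>x. norm (f x) \<le> B) \<Longrightarrow> Linf_norm f \<le> B"
proof -
  let ?g = "\<lambda>x. ereal (norm (f x))"
  have gb: "?g \<in> borel_measurable torus"
    by (intro measurable_torus continuous_borel continuous_on_ereal continuous_intros c) auto
  have up: "esssup torus ?g \<le> ereal B" if "\<And>x. norm (f x) \<le> B" for B
    by (rule esssup_I[OF gb]) (use that in auto)
  obtain B where B: "\<And>x. norm (f x) \<le> B" using bounded_continuous_periodic[OF c p] by blast
  have ae: "AE x in torus. ?g x \<le> esssup torus ?g" by (rule esssup_AE)
  have ge: "0 \<le> esssup torus ?g"
  proof (rule ccontr)
    assume n: "\<not> 0 \<le> esssup torus ?g"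
    from ae have "AE x in torus. False"
      by eventually_elim (use n in \<open>metis ereal_less_eq(5) norm_ge_zero order_trans\<close>)
    then show False by (simp add: torus.AE_False)
  qed
  obtain r where r: "esssup torus ?g = ereal r"
    using ge up[OF B] by (cases "esssup torus ?g") auto
  have L: "Linf_norm f = r" by (simp add: Linf_norm_def r)
  show "Linf_norm f \<le> B" if "\<And>x. norm (f x) \<le> B" for B
    using up[OF that] by (simp add: L r)
  have "AE x in torus. max 0 (norm (f x) - r) = 0" using ae by eventually_elim (simp add: r)
  then have 0: "(\<integral>x. max 0 (norm (f x) - r) \<partial>torus) = 0"
    by (intro integral_eq_zero_AE)
  have "max 0 (norm (f x) - r) = 0"
    using p by (intro torus_integral_nonneg_eq_0[OF _ _ _ 0] continuous_intros c) (auto simp: periodic_def)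
  then show "norm (f x) \<le> Linf_norm f" by (simp add: L max_def split: if_splits)
qed

section \<open>Green's formula and the estimates entering the energy inequality\<close>

lemma green:
  assumes a: "Ck 1 a" and b: "Ck 2 b"
  shows "(\<integral>x. pd 1 a x * pd 1 b x + pd 2 a x * pd 2 b x \<partial>torus) = - (\<integral>x. a x * lap b x \<partial>torus)"
proof -
  note c = Ck_1D(2,3)[OF a] Ck_2D(5,6)[OF b]
  have "(\<integral>x. pd 1 a x * pd 1 b x + pd 2 a x * pd 2 b x \<partial>torus) =
     (\<integral>x. pd 1 a x * pd 1 b x \<partial>torus) + (\<integral>x. pd 2 a x * pd 2 b x \<partial>torus)"
    by (intro torus_integral_simps Ck_mult c)
  also have "\<dots> = - (\<integral>x. a x * pd 1 (pd 1 b) x \<partial>torus) - (\<integral>x. a x * pd 2 (pd 2 b) x \<partial>torus)"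
    by (simp add: integral_pd_mult[OF a Ck_2D(2)[OF b]])
  also have "\<dots> = - (\<integral>x. a x * pd 1 (pd 1 b) x + a x * pd 2 (pd 2 b) x \<partial>torus)"
    by (subst torus_integral_simps(1)) (auto intro!: Ck_mult c)
  finally show ?thesis by (simp add: lap_def distrib_left)
qed

lemma gnorm_sq_green: "Ck 2 f \<Longrightarrow> (gnorm f)\<^sup>2 = - (\<integral>x. f x * lap f x \<partial>torus)"
  by (simp only: gnorm_sq) (simp only: power2_eq_square green Ck_2D)

text \<open>By Lagrange's identity the bracket is pointwise at most the product of the lengths of
  the two gradients; Cauchy-Schwarz does the rest.\<close>

lemma integral_br_le:
  assumes r: "Ck 0 r" "\<And>x. \<bar>r x\<bar> \<le> M" and a: "Ck 1 a" and b: "Ck 1 b"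
  shows "(\<integral>x. r x * br a b x \<partial>torus) \<le> M * (gnorm a * gnorm b)"
proof -
  let ?n = "\<lambda>a x. sqrt ((pd 1 a x)\<^sup>2 + (pd 2 a x)\<^sup>2)"
  have M0: "0 \<le> M" using r(2)[of 0] by linarith
  have n: "continuous_on UNIV (?n a)" if "Ck 1 a" for a
    using Ck_continuous[OF Ck_1D(2)[OF that]] by (intro continuous_intros)
  have le: "r x * br a b x \<le> M * (?n a x * ?n b x)" for x
  proof -
    have "(br a b x)\<^sup>2 \<le> (br a b x)\<^sup>2 + (pd 1 a x * pd 1 b x + pd 2 a x * pd 2 b x)\<^sup>2" by simp
    also have "\<dots> = ((pd 1 a x)\<^sup>2 + (pd 2 a x)\<^sup>2) * ((pd 1 b x)\<^sup>2 + (pd 2 b x)\<^sup>2)"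
      by (simp add: br_def power2_eq_square algebra_simps)
    finally have "\<bar>br a b x\<bar> \<le> ?n a x * ?n b x"
      unfolding real_sqrt_mult[symmetric] by (intro real_le_rsqrt) simp
    then have "\<bar>r x\<bar> * \<bar>br a b x\<bar> \<le> M * (?n a x * ?n b x)" using r(2) M0 by (intro mult_mono) auto
    then show ?thesis by (simp only: abs_mult[symmetric] abs_le_iff)
  qed
  have "(\<integral>x. r x * br a b x \<partial>torus) \<le> (\<integral>x. M * (?n a x * ?n b x) \<partial>torus)"
    by (intro integral_mono le torus_integrable_continuous continuous_on_mult[OF continuous_on_const]
        continuous_on_mult n a b Ck_continuous[OF r(1)] Ck_continuous[OF Ck_br_0[OF a b]])
  also have "\<dots> = M * (\<integral>x. ?n a x * ?n b x \<partial>torus)" by simp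
  also have "\<dots> \<le> M * (sqrt (\<integral>x. (?n a x)\<^sup>2 \<partial>torus) * sqrt (\<integral>x. (?n b x)\<^sup>2 \<partial>torus))"
    by (intro mult_left_mono torus_Cauchy_Schwarz n a b M0)
  finally show ?thesis by (simp add: gnorm_def)
qed

text \<open>The form is the Frobenius product of \<open>J\<close> with the rank-one matrix of the
  vector \<open>(a, b)\<close>, whose Frobenius norm is the squared length of that vector.\<close>

lemma quadratic_form_le:
  fixes J :: "real^2^2"
  shows "\<bar>J $ 1 $ 1 * (a * a) + J $ 1 $ 2 * (a * b) + J $ 2 $ 1 * (a * b) + J $ 2 $ 2 * (b * b)\<bar> \<le> norm J * (a\<^sup>2 + b\<^sup>2)"
proof -
  define K :: "real^2^2" where "K = vector [vector [a * a, a * b], vector [a * b, b * b]]"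
  have "norm K = sqrt ((a * a)\<^sup>2 + (a * b)\<^sup>2 + ((a * b)\<^sup>2 + (b * b)\<^sup>2))"
    by (simp add: norm_vec_def L2_set_def sum_2 K_def)
  also have "(a * a)\<^sup>2 + (a * b)\<^sup>2 + ((a * b)\<^sup>2 + (b * b)\<^sup>2) = (a\<^sup>2 + b\<^sup>2)\<^sup>2"
    by (simp add: power2_eq_square algebra_simps)
  finally have K: "norm K = a\<^sup>2 + b\<^sup>2" by simp
  have "\<bar>J \<bullet> K\<bar> \<le> norm J * norm K" by (rule Cauchy_Schwarz_ineq2)
  then show ?thesis unfolding K by (simp add: inner_vec_def sum_2 K_def)
qed

lemma jacobian_perp_gradient:
  assumes f: "Ck 2 f"
  shows "jacobian (perp_gradient f) (at x) $ 1 $ j = - pd j (pd 2 f) x"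
    "jacobian (perp_gradient f) (at x) $ 2 $ j = pd j (pd 1 f) x"
proof -
  note d = Ck_2D(7)[OF f]
  have e: "perp_gradient f = (\<lambda>x. (- pd 2 f x) *\<^sub>R axis 1 1 + pd 1 f x *\<^sub>R axis 2 1)"
    by (rule ext) (simp add: perp_gradient_def vec_eq_iff forall_2 axis_def gradient_nth)
  have D: "(perp_gradient f has_derivative (\<lambda>h. (- frechet_derivative (pd 2 f) (at x) h) *\<^sub>R axis 1 1
      + frechet_derivative (pd 1 f) (at x) h *\<^sub>R axis 2 1)) (at x)"
    unfolding e by (intro has_derivative_add has_derivative_scaleR_left has_derivative_minus frechet_pd d)
  show "jacobian (perp_gradient f) (at x) $ 1 $ j = - pd j (pd 2 f) x"
    "jacobian (perp_gradient f) (at x) $ 2 $ j = pd j (pd 1 f) x"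
    unfolding jacobian_def frechet_derivative_at[OF D, symmetric]
    by (simp_all add: matrix_def axis_def pd_def[of _ "pd _ f"] gradient_def)
qed

lemma hessian_nth:
  assumes f: "Ck 2 f"
  shows "hessian f x $ i $ j = pd j (pd i f) x"
proof -
  note d = Ck_2D(7)[OF f]
  have e: "gradient f = (\<lambda>x. pd 1 f x *\<^sub>R axis 1 1 + pd 2 f x *\<^sub>R axis 2 1)"
    by (rule ext) (simp add: vec_eq_iff forall_2 axis_def gradient_nth)
  have D: "(gradient f has_derivative (\<lambda>h. frechet_derivative (pd 1 f) (at x) h *\<^sub>R axis 1 1
      + frechet_derivative (pd 2 f) (at x) h *\<^sub>R axis 2 1)) (at x)"
    unfolding e by (intro has_derivative_add has_derivative_scaleR_left frechet_pd d)
  show ?thesis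
    unfolding hessian_def jacobian_def frechet_derivative_at[OF D, symmetric]
    using exhaust_2[of i] by (auto simp: matrix_def axis_def pd_def[of _ "pd _ f"] gradient_def)
qed

lemma laplacian_eq: "Ck 2 f \<Longrightarrow> laplacian f x = lap f x"
  by (simp add: laplacian_def trace_def sum_2 hessian_nth lap_def)

text \<open>Differentiating the transport term either hits the velocity, which leaves a quadratic
  form in the gradient of \<open>h\<close> with the velocity gradient as its matrix, or transports
  half the squared gradient of \<open>h\<close>, which integrates to zero. No second derivative of
  \<open>h\<close> survives.\<close>

lemma transport_energy_le:
  assumes p: "Ck 3 p" and h: "Ck 2 h" and L: "\<And>x. norm (jacobian (perp_gradient p) (at x)) \<le> L"
  shows "- (\<integral>x. lap h x * br p h x \<partial>torus) \<le> L * (gnorm h)\<^sup>2"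
proof -
  have p3: "Ck (Suc 2) p" using p by (simp add: numeral_eq_Suc)
  have p2: "Ck 2 p" by (rule Ck_Suc_imp[OF p3])
  have pp: "Ck 2 (pd i p)" for i by (rule Ck_pd[OF p3])
  have B: "Ck 1 (br p h)" unfolding br_def by (intro Ck_intros Ck_2D(2,3) p2 h pp)
  define G where "G x = 1 / 2 * (pd 1 h x * pd 1 h x + pd 2 h x * pd 2 h x)" for x
  have G: "Ck 1 G" unfolding G_def by (intro Ck_intros Ck_2D(2) h)
  define q where "q x = - pd 1 (pd 2 p) x * (pd 1 h x * pd 1 h x) - pd 2 (pd 2 p) x * (pd 1 h x * pd 2 h x)
     + pd 1 (pd 1 p) x * (pd 1 h x * pd 2 h x) + pd 2 (pd 1 p) x * (pd 2 h x * pd 2 h x)" for x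
  have q0: "Ck 0 q" unfolding q_def by (intro Ck_intros Ck_2D(5,6) p2 h)
  note d = Ck_2D(1,7)[OF h] Ck_2D(7)[OF p2]
  have pG: "pd i G x = pd 1 h x * pd i (pd 1 h) x + pd 2 h x * pd i (pd 2 h) x" for i x
    unfolding G_def by (simp only: pd_cmult pd_add pd_mult differentiable_mult differentiable_add d) (simp add: field_simps)
  have pB: "pd i (br p h) x = pd 1 p x * pd i (pd 2 h) x + pd i (pd 1 p) x * pd 2 h x
     - (pd 2 p x * pd i (pd 1 h) x + pd i (pd 2 p) x * pd 1 h x)" for i x
    unfolding br_def using d by (simp add: pd_diff pd_mult differentiable_mult)
  \<comment> \<open>Here \<open>q\<close> collects the terms in which the velocity is
    differentiated, and \<open>G\<close> is half the squared gradient of \<open>h\<close>.\<close>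
  have eq: "pd 1 (br p h) x * pd 1 h x + pd 2 (br p h) x * pd 2 h x = q x + br p G x" for x
    unfolding pB br_def[of p G] pG q_def pd_commute[OF h, of 2 1] by (simp add: algebra_simps)
  have "- (\<integral>x. lap h x * br p h x \<partial>torus) = (\<integral>x. pd 1 (br p h) x * pd 1 h x + pd 2 (br p h) x * pd 2 h x \<partial>torus)"
    unfolding green[OF B h] by (simp add: mult.commute)
  also have "\<dots> = (\<integral>x. q x \<partial>torus) + (\<integral>x. br p G x \<partial>torus)"
    unfolding eq using Ck_br_0[OF Ck_2D(3)[OF p2] G] by (intro torus_integral_simps q0)
  also have "\<dots> = (\<integral>x. q x \<partial>torus)" by (simp add: integral_br[OF p2 G])
  also have "\<dots> \<le> (\<integral>x. L * ((pd 1 h x)\<^sup>2 + (pd 2 h x)\<^sup>2) \<partial>torus)"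
  proof (rule integral_mono[OF Ck_integrable[OF q0]])
    show "integrable torus (\<lambda>x. L * ((pd 1 h x)\<^sup>2 + (pd 2 h x)\<^sup>2))"
      by (rule Ck_integrable[of 0]) (intro Ck_intros Ck_2D(5) h)
    show "q x \<le> L * ((pd 1 h x)\<^sup>2 + (pd 2 h x)\<^sup>2)" for x
    proof -
      have "q x \<le> norm (jacobian (perp_gradient p) (at x)) * ((pd 1 h x)\<^sup>2 + (pd 2 h x)\<^sup>2)"
        using quadratic_form_le[of "jacobian (perp_gradient p) (at x)" "pd 1 h x" "pd 2 h x"]
        unfolding jacobian_perp_gradient[OF p2] q_def abs_le_iff by simp
      also have "\<dots> \<le> L * ((pd 1 h x)\<^sup>2 + (pd 2 h x)\<^sup>2)" by (intro mult_right_mono L) auto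
      finally show ?thesis .
    qed
  qed
  also have "\<dots> = L * (gnorm h)\<^sup>2" by (simp add: gnorm_sq)
  finally show ?thesis .
qed

text \<open>The natural unknown is the square root of the energy, which need not be differentiable
  where the energy vanishes, in particular at time 0. Adding \<open>k^2\<close> regularises it, and
  \<open>k\<close> tends to 0 at the end.\<close>

lemma Gronwall_sqrt:
  fixes E E' L :: "real \<Rightarrow> real"
  assumes D: "\<And>t. t \<in> {0..T} \<Longrightarrow> (E has_real_derivative E' t) (at t within {0..T})"
    and E: "\<And>t. t \<in> {0..T} \<Longrightarrow> 0 \<le> E t" "E 0 = 0"
    and le: "\<And>t. t \<in> {0..T} \<Longrightarrow> E' t \<le> 2 * L t * E t + 2 * a * sqrt (E t)"
    and L: "continuous_on {0..T} L" "\<And>t. t \<in> {0..T} \<Longrightarrow> 0 \<le> L t" and a: "0 \<le> a" and t: "t \<in> {0..T}"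
  shows "sqrt (E t) \<le> a * t * exp (integral {0..t} L)"
proof -
  define I where "I s = integral {0..s} L" for s
  have DI: "(I has_real_derivative L s) (at s within {0..T})" if "s \<in> {0..T}" for s
    unfolding I_def by (rule integral_has_real_derivative[OF L(1) that])
  have bound: "sqrt (E t) \<le> (k + a * t) * exp (I t)" if k: "0 < k" for k
  proof -
    \<comment> \<open>With the integrating factor and the accumulated forcing removed this is
      nonincreasing, and it starts at \<open>k\<close>; the forcing is bounded by dropping a factor
      \<open>exp (- I s)\<close> that is at most 1.\<close>
    define y where "y s = sqrt (E s + k\<^sup>2) * exp (- I s) - a * s" for s
    have pos: "0 < E s + k\<^sup>2" if "s \<in> {0..T}" for s using E(1)[OF that] k by (simp add: add_nonneg_pos)
    have Dy: "(y has_real_derivative (E' s / (2 * sqrt (E s + k\<^sup>2)) - sqrt (E s + k\<^sup>2) * L s) * exp (- I s) - a) (at s within {0..T})"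
      if s: "s \<in> {0..T}" for s
      unfolding y_def using pos[OF s]
      by (auto intro!: derivative_eq_intros D[OF s] DI[OF s] simp: field_simps)
    have neg: "(E' s / (2 * sqrt (E s + k\<^sup>2)) - sqrt (E s + k\<^sup>2) * L s) * exp (- I s) - a \<le> 0" if s: "s \<in> {0..T}" for s
    proof -
      let ?z = "sqrt (E s + k\<^sup>2)"
      have z: "0 < ?z" "sqrt (E s) \<le> ?z" "?z * ?z = E s + k\<^sup>2" using pos[OF s] by auto
      have "E' s \<le> 2 * L s * E s + 2 * a * sqrt (E s)" by (rule le[OF s])
      also have "\<dots> \<le> 2 * L s * (?z * ?z) + 2 * a * ?z"
        using z L(2)[OF s] a by (intro add_mono mult_left_mono) auto
      finally have "E' s \<le> (2 * ?z) * (?z * L s + a)" by (simp add: algebra_simps)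
      then have "E' s / (2 * ?z) \<le> ?z * L s + a" using z(1) by (simp add: pos_divide_le_eq mult.commute)
      then have 1: "E' s / (2 * ?z) - ?z * L s \<le> a" by linarith
      have I0: "0 \<le> I s" unfolding I_def
        by (rule integral_nonneg) (use L s in \<open>auto intro!: integrable_continuous_real intro: continuous_on_subset\<close>)
      have "(E' s / (2 * ?z) - ?z * L s) * exp (- I s) \<le> a * exp (- I s)" by (intro mult_right_mono 1) auto
      also have "\<dots> \<le> a * 1" using a I0 by (intro mult_left_mono) auto
      finally show ?thesis by simp
    qed
    have "y t \<le> y 0"
    proof (rule DERIV_nonpos_imp_decreasing_open[where f = y and a = 0 and b = t])
      show "0 \<le> t" using t by simp
      show "continuous_on {0..t} y"
      proof (rule continuous_on_subset[of "{0..T}"])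
        show "continuous_on {0..T} y"
          unfolding continuous_on_eq_continuous_within using DERIV_continuous[OF Dy] by blast
      qed (use t in auto)
      fix s assume "0 < s" "s < t"
      then have s: "s \<in> {0..T}" "s \<in> interior {0..T}" using t by auto
      show "\<exists>d. (y has_real_derivative d) (at s) \<and> d \<le> 0"
        using Dy[OF s(1)] neg[OF s(1)] at_within_interior[OF s(2)] by metis
    qed
    also have "y 0 = k" using k E(2) by (simp add: y_def I_def)
    finally have "sqrt (E t + k\<^sup>2) * exp (- I t) \<le> k + a * t" by (simp add: y_def)
    then have "sqrt (E t + k\<^sup>2) \<le> (k + a * t) * exp (I t)" by (simp add: exp_minus field_simps)
    moreover have "sqrt (E t) \<le> sqrt (E t + k\<^sup>2)" by simp
    ultimately show ?thesis by linarith
  qed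
  have "sqrt (E t) \<le> a * t * exp (I t)"
  proof (rule field_le_epsilon)
    fix e :: real assume "0 < e"
    then show "sqrt (E t) \<le> a * t * exp (I t) + e"
      using bound[of "e / exp (I t)"] by (simp add: distrib_right add.commute)
  qed
  then show ?thesis by (simp add: I_def)
qed

lemma evolution_continuous:
  assumes "smooth_torus_evolution T f"
  shows "continuous_on ({0..T} \<times> UNIV) (\<lambda>z. f (fst z) (snd z))"
    "continuous_on ({0..T} \<times> UNIV) (\<lambda>z. pd i (f (fst z)) (snd z))"
    "continuous_on ({0..T} \<times> UNIV) (\<lambda>z. pd j (pd i (f (fst z))) (snd z))"
  using assms by (auto intro!: continuous_on_slab evolution_derivatives)

text \<open>Uniform continuity on the compact slab over the closed square, extended by periodicity.
  It makes the Lipschitz bound of the Euler velocity a continuous function of time, as Gronwall's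
  argument and the final integral require.\<close>

lemma continuous_on_Linf_norm:
  fixes f :: "real \<Rightarrow> real^2 \<Rightarrow> 'b::real_normed_vector"
  assumes c: "continuous_on ({a..b} \<times> UNIV) (\<lambda>(t, x). f t x)" and p: "\<And>t. t \<in> {a..b} \<Longrightarrow> periodic (f t)"
  shows "continuous_on {a..b} (\<lambda>t. Linf_norm (f t))"
proof -
  have ct: "continuous_on UNIV (f t)" if "t \<in> {a..b}" for t
    using continuous_on_compose2[OF c continuous_on_Pair[OF continuous_on_const continuous_on_id], of t UNIV] that
    by (auto simp: image_subset_iff)
  have uc: "uniformly_continuous_on ({a..b} \<times> cbox 0 1) (\<lambda>(t, x). f t x)"
    by (intro compact_uniformly_continuous continuous_on_subset[OF c] compact_Times) auto
  show ?thesis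
    unfolding continuous_on_iff
  proof (intro ballI allI impI)
    fix t e :: real assume t: "t \<in> {a..b}" and e: "0 < e"
    then have "0 < e / 2" by simp
    then obtain d where d: "0 < d" "\<And>z z'. z \<in> {a..b} \<times> cbox 0 1 \<Longrightarrow> z' \<in> {a..b} \<times> cbox 0 1 \<Longrightarrow> dist z' z < d \<Longrightarrow>
        dist ((\<lambda>(t, x). f t x) z') ((\<lambda>(t, x). f t x) z) < e / 2"
      using uc unfolding uniformly_continuous_on_def by metis
    have close: "norm (f s x - f r x) \<le> e / 2" if sr: "s \<in> {a..b}" "r \<in> {a..b}" "dist s r < d" for s r x
    proof -
      obtain k where "x + lattice_point k \<in> unit_cell" using ex1_lattice_point by blast
      then have x: "x + lattice_point k \<in> cbox 0 1" using unit_cell_bounds(2) by blast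
      have "dist (f s (x + lattice_point k)) (f r (x + lattice_point k)) < e / 2"
        using d(2)[of "(r, x + lattice_point k)" "(s, x + lattice_point k)"] sr x by (simp add: dist_Pair_Pair)
      then show ?thesis by (simp add: periodicD[OF p[OF sr(1)]] periodicD[OF p[OF sr(2)]] dist_norm)
    qed
    have le: "Linf_norm (f s) \<le> Linf_norm (f r) + e / 2" if sr: "s \<in> {a..b}" "r \<in> {a..b}" "dist s r < d" for s r
    proof (rule Linf_norm(2)[OF ct[OF sr(1)] p[OF sr(1)]])
      fix x
      have "norm (f s x) \<le> norm (f r x) + norm (f s x - f r x)" by (metis norm_triangle_sub)
      also have "\<dots> \<le> Linf_norm (f r) + e / 2"
        by (intro add_mono Linf_norm(1) ct p sr close)
      finally show "norm (f s x) \<le> Linf_norm (f r) + e / 2" .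
    qed
    show "\<exists>d>0. \<forall>s\<in>{a..b}. dist s t < d \<longrightarrow> dist (Linf_norm (f s)) (Linf_norm (f t)) < e"
    proof (intro exI[of _ d] conjI d(1) ballI impI)
      fix s assume s: "s \<in> {a..b}" "dist s t < d"
      from le[OF s(1) t s(2)] le[OF t s(1)] s(2) e
      show "dist (Linf_norm (f s)) (Linf_norm (f t)) < e" by (auto simp: dist_real_def abs_less_iff dist_commute)
    qed
  qed
qed

section \<open>The energy estimate\<close>

locale two_flows =
  fixes T \<epsilon> :: real and \<rho>b \<phi>b \<rho> \<psi> :: "real \<Rightarrow> real^2 \<Rightarrow> real"
  assumes T: "0 < T" and eps: "0 < \<epsilon>"
    and Euler: "smooth_Euler_solution T \<rho>b \<phi>b" and MA: "smooth_Monge_Ampere_solution T \<epsilon> \<rho> \<psi>"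
    and init: "\<rho>b 0 = \<rho> 0" and small: "\<And>t. t \<in> {0..T} \<Longrightarrow> \<epsilon> * Linf_norm (hessian (\<psi> t)) \<le> 1"
begin

lemma evo: "smooth_torus_evolution T \<rho>" "smooth_torus_evolution T \<psi>"
    "smooth_torus_evolution T \<rho>b" "smooth_torus_evolution T \<phi>b"
  and tr: "transported T \<psi> \<rho>" "transported T \<phi>b \<rho>b"
  using Euler MA by (auto simp: smooth_Euler_solution_def smooth_Monge_Ampere_solution_def)

lemma Ck_evo:
  assumes "t \<in> {0..T}"
  shows "Ck n (\<rho> t)" "Ck n (\<psi> t)" "Ck n (\<rho>b t)" "Ck n (\<phi>b t)"
  by (intro evolution_Ck[OF _ assms] evo)+

lemma Poisson_b: "t \<in> {0..T} \<Longrightarrow> lap (\<phi>b t) = \<rho>b t"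
proof -
  assume t: "t \<in> {0..T}"
  have "laplacian (\<phi>b t) x = \<rho>b t x" for x
    using Euler t by (simp add: smooth_Euler_solution_def)
  then show ?thesis by (simp add: laplacian_eq[OF Ck_evo(4)[OF t]] fun_eq_iff)
qed

lemma mean_zero_integral: "t \<in> {0..T} \<Longrightarrow> (\<integral>x. \<rho> t x \<partial>torus) = 0" "t \<in> {0..T} \<Longrightarrow> (\<integral>x. \<rho>b t x \<partial>torus) = 0"
  using Euler MA by (auto simp: smooth_Euler_solution_def smooth_Monge_Ampere_solution_def mean_zero_def)

text \<open>The Hessian determinant of \<open>\<psi>\<close>, written as a bracket of first
  derivatives so that \<open>Wente\<close> applies to it.\<close>

definition jac :: "real \<Rightarrow> real^2 \<Rightarrow> real" where
  "jac t = br (pd 1 (\<psi> t)) (pd 2 (\<psi> t))"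

text \<open>In two dimensions the determinant expands into 1, the trace and the Hessian determinant,
  so the equation is a Poisson equation with a correction of order
  \<open>\<epsilon>\<close>.\<close>

lemma Monge_Ampere: "t \<in> {0..T} \<Longrightarrow> lap (\<psi> t) x = \<rho> t x - \<epsilon> * jac t x"
proof -
  assume t: "t \<in> {0..T}"
  have "det (mat 1 + \<epsilon> *\<^sub>R hessian (\<psi> t) x) = 1 + \<epsilon> * \<rho> t x"
    using MA t by (simp add: smooth_Monge_Ampere_solution_def)
  also have "det (mat 1 + \<epsilon> *\<^sub>R hessian (\<psi> t) x) = 1 + \<epsilon> * (lap (\<psi> t) x + \<epsilon> * jac t x)"
    by (simp add: det_2 mat_def hessian_nth[OF Ck_evo(2)[OF t]] lap_def jac_def br_def algebra_simps)
  finally show ?thesis using eps by simp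
qed

definition w :: "real \<Rightarrow> real^2 \<Rightarrow> real" where "w t x = \<rho> t x - \<rho>b t x"

lemma w_Ck: "t \<in> {0..T} \<Longrightarrow> Ck n (w t)"
  unfolding w_def by (intro Ck_diff Ck_evo)

lemma w_mean: "t \<in> {0..T} \<Longrightarrow> (\<integral>x. w t x \<partial>torus) = 0"
  unfolding w_def by (subst torus_integral_simps(2)) (auto intro!: Ck_evo simp: mean_zero_integral)

text \<open>The choice is made at each time separately, so nothing is known in advance about the
  dependence on \<open>t\<close>; \<open>energy_deriv\<close> works around this.\<close>

definition h :: "real \<Rightarrow> real^2 \<Rightarrow> real" where
  "h t = (SOME h. Ck 2 h \<and> (\<integral>x. h x \<partial>torus) = 0 \<and> lap h = w t)"

lemma h:
  assumes t: "t \<in> {0..T}"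
  shows "Ck 2 (h t)" "(\<integral>x. h t x \<partial>torus) = 0" "lap (h t) = w t"
proof -
  have "\<exists>h. Ck 2 h \<and> (\<integral>x. h x \<partial>torus) = 0 \<and> lap h = w t"
    using Poisson_solution[OF w_Ck[OF t] w_mean[OF t]] by metis
  from someI_ex[OF this] show "Ck 2 (h t)" "(\<integral>x. h t x \<partial>torus) = 0" "lap (h t) = w t"
    unfolding h_def by auto
qed

text \<open>The energy is the squared homogeneous \<open>H\<^sup>-\<^sup>1\<close> norm of \<open>w\<close>.\<close>

definition energy :: "real \<Rightarrow> real" where "energy t = (gnorm (h t))\<^sup>2"

lemma energy_eq: "t \<in> {0..T} \<Longrightarrow> energy t = - (\<integral>x. h t x * w t x \<partial>torus)"
  by (simp add: energy_def gnorm_sq_green h)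

lemma energy_0: "energy 0 = 0"
proof -
  have "0 \<in> {0..T}" using T by simp
  from energy_eq[OF this] show ?thesis by (simp add: w_def init)
qed

definition wt :: "real \<Rightarrow> real^2 \<Rightarrow> real" where
  "wt t x = - br (\<psi> t) (\<rho> t) x + br (\<phi>b t) (\<rho>b t) x"

lemma w_deriv: "t \<in> {0..T} \<Longrightarrow> ((\<lambda>s. w s x) has_real_derivative wt t x) (at t within {0..T})"
  using tr unfolding w_def wt_def transported_def bracket_eq
  by (auto intro!: derivative_eq_intros)

lemma wt_continuous: "continuous_on ({0..T} \<times> UNIV) (\<lambda>(t, x). wt t x)"
  unfolding wt_def br_def case_prod_unfold by (intro continuous_intros evolution_continuous evo)

lemma wt_Ck: "t \<in> {0..T} \<Longrightarrow> Ck 0 (wt t)"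
  unfolding wt_def by (intro Ck_add Ck_minus Ck_br_0 Ck_evo)

lemma w_Lipschitz:
  obtains C where "0 \<le> C" "\<And>s t x. s \<in> {0..T} \<Longrightarrow> t \<in> {0..T} \<Longrightarrow> \<bar>w s x - w t x\<bar> \<le> C * \<bar>s - t\<bar>"
proof -
  obtain C where C: "0 \<le> C" "\<And>t x. t \<in> {0..T} \<Longrightarrow> norm (wt t x) \<le> C"
    using bounded_on_slab[OF wt_continuous Ck_periodic[OF wt_Ck]] by blast
  have "\<bar>w s x - w t x\<bar> \<le> C * \<bar>s - t\<bar>" if "s \<in> {0..T}" "t \<in> {0..T}" for s t x
    using field_differentiable_bound[of "{0..T}" "\<lambda>s. w s x" "\<lambda>s. wt s x" C, OF _ w_deriv C(2) that] by simp
  with C(1) show thesis by (rule that)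
qed

lemma h_w_sym:
  assumes "s \<in> {0..T}" "t \<in> {0..T}"
  shows "(\<integral>x. h s x * w t x \<partial>torus) = (\<integral>x. h t x * w s x \<partial>torus)"
proof -
  have "- (\<integral>x. h s x * w t x \<partial>torus) = (\<integral>x. pd 1 (h s) x * pd 1 (h t) x + pd 2 (h s) x * pd 2 (h t) x \<partial>torus)"
    using green[OF Ck_2D(3)[OF h(1)] h(1), of s t] assms by (simp add: h(3))
  also have "\<dots> = - (\<integral>x. h t x * w s x \<partial>torus)"
    using green[OF Ck_2D(3)[OF h(1)] h(1), of t s] assms by (simp add: h(3) mult.commute)
  finally show ?thesis by simp
qed

lemma energy_deriv:
  assumes t: "t \<in> {0..T}"
  shows "(energy has_real_derivative - 2 * (\<integral>x. h t x * wt t x \<partial>torus)) (at t within {0..T})"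
proof -
  obtain C where C: "0 \<le> C" "\<And>s t x. s \<in> {0..T} \<Longrightarrow> t \<in> {0..T} \<Longrightarrow> \<bar>w s x - w t x\<bar> \<le> C * \<bar>s - t\<bar>"
    by (rule w_Lipschitz) (rule that; assumption)
  define A where "A s = (\<integral>x. h t x * w s x \<partial>torus)" for s
  define R where "R s = (\<integral>x. (h s x - h t x) * (w s x - w t x) \<partial>torus)" for s
  note ht = Ck_2D(4)[OF h(1)]
  have A: "(A has_real_derivative (\<integral>x. h t x * wt t x \<partial>torus)) (at t within {0..T})"
    unfolding A_def
  proof (rule torus_leibniz[where F = "\<lambda>s x. h t x * w s x" and F' = "\<lambda>s x. h t x * wt s x", OF _ _ _ t])
    show "((\<lambda>s. h t x * w s x) has_real_derivative h t x * wt s x) (at s within {0..T})" if "s \<in> {0..T}" for s x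
      by (rule DERIV_cmult[OF w_deriv[OF that]])
    have "continuous_on ({0..T} \<times> UNIV) (\<lambda>z. h t (snd z))"
      by (rule continuous_on_compose2[OF Ck_continuous[OF ht[OF t]]]) (auto intro: continuous_intros)
    then show "continuous_on ({0..T} \<times> UNIV) (\<lambda>(s, x). h t x * wt s x)"
      using wt_continuous unfolding case_prod_unfold by (rule continuous_on_mult)
    show "continuous_on UNIV (\<lambda>x. h t x * w s x)" if "s \<in> {0..T}" for s
      by (intro continuous_on_mult Ck_continuous[OF ht[OF t]] Ck_continuous[OF w_Ck[OF that]])
  qed
  \<comment> \<open>\<open>R\<close> is quadratic in the increment of \<open>w\<close>: the Poincare
    inequality controls the increment of \<open>h\<close> by that of \<open>w\<close>, which is
    Lipschitz in time. Hence \<open>R\<close> has derivative zero at \<open>t\<close>.\<close>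
  have Rb: "\<bar>R s\<bar> \<le> C\<^sup>2 * \<bar>s - t\<bar>\<^sup>2" if s: "s \<in> {0..T}" for s
  proof -
    define dh where "dh x = h s x - h t x" for x
    define dw where "dw x = w s x - w t x" for x
    have dh: "Ck 2 dh" unfolding dh_def by (intro Ck_diff h s t)
    have dw: "Ck 0 dw" unfolding dw_def by (intro Ck_diff w_Ck s t)
    have "pd i dh = (\<lambda>x. pd i (h s) x - pd i (h t) x)" for i
      unfolding dh_def using Ck_2D(1)[OF h(1)] s t by (auto simp: pd_diff)
    then have "pd i (pd i dh) x = pd i (pd i (h s)) x - pd i (pd i (h t)) x" for i x
      by (simp add: pd_diff Ck_2D(7)[OF h(1)[OF s]] Ck_2D(7)[OF h(1)[OF t]])
    then have l: "lap dh = dw"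
      by (simp add: lap_def[of dh] dw_def fun_eq_iff) (simp add: lap_def flip: h(3)[OF s] h(3)[OF t])
    have z: "(\<integral>x. dh x \<partial>torus) = 0"
      unfolding dh_def using ht s t by (subst torus_integral_simps(2)) (auto simp: h)
    have dw2: "(\<integral>x. (dw x)\<^sup>2 \<partial>torus) \<le> C\<^sup>2 * \<bar>s - t\<bar>\<^sup>2"
    proof -
      have "(\<integral>x. (dw x)\<^sup>2 \<partial>torus) \<le> (\<integral>x. (C * \<bar>s - t\<bar>)\<^sup>2 \<partial>torus)"
      proof (rule integral_mono)
        show "(dw x)\<^sup>2 \<le> (C * \<bar>s - t\<bar>)\<^sup>2" for x
          using power_mono[OF C(2)[OF s t, of x] abs_ge_zero, of 2] by (simp add: dw_def)
      qed (auto intro: Ck_integrable[OF Ck_power[OF dw]])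
      then show ?thesis by (simp add: power_mult_distrib torus.prob_space[simplified])
    qed
    have "2 * \<bar>R s\<bar> \<le> (\<integral>x. (dh x)\<^sup>2 \<partial>torus) + (\<integral>x. (dw x)\<^sup>2 \<partial>torus)"
    proof -
      have i: "integrable torus (\<lambda>x. dh x * dw x)" by (intro Ck_integrable[OF Ck_mult[OF Ck_2D(4)[OF dh] dw]])
      have s2: "Ck 0 (\<lambda>x. (dh x)\<^sup>2)" "Ck 0 (\<lambda>x. (dw x)\<^sup>2)" by (intro Ck_power Ck_2D(4) dh dw)+
      have "2 * \<bar>R s\<bar> \<le> 2 * (\<integral>x. \<bar>dh x * dw x\<bar> \<partial>torus)"
        unfolding R_def dh_def[symmetric] dw_def[symmetric] by (intro mult_left_mono integral_abs_bound) auto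
      also have "\<dots> = (\<integral>x. 2 * \<bar>dh x * dw x\<bar> \<partial>torus)" by simp
      also have "\<dots> \<le> (\<integral>x. (dh x)\<^sup>2 + (dw x)\<^sup>2 \<partial>torus)"
      proof (rule integral_mono)
        show "2 * \<bar>dh x * dw x\<bar> \<le> (dh x)\<^sup>2 + (dw x)\<^sup>2" for x
          using sum_squares_bound[of "\<bar>dh x\<bar>" "\<bar>dw x\<bar>"] by (simp add: abs_mult)
      qed (auto intro!: integrable_abs i Bochner_Integration.integrable_add Ck_integrable[OF s2(1)] Ck_integrable[OF s2(2)])
      also have "\<dots> = (\<integral>x. (dh x)\<^sup>2 \<partial>torus) + (\<integral>x. (dw x)\<^sup>2 \<partial>torus)"
        by (rule torus_integral_simps(1)[OF s2])
      finally show ?thesis .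
    qed
    also have "\<dots> \<le> 2 * (C\<^sup>2 * \<bar>s - t\<bar>\<^sup>2)"
      using Poincare_lap[OF dh z] dw2 unfolding l by linarith
    finally show ?thesis by simp
  qed
  have R: "(R has_real_derivative 0) (at t within {0..T})"
    unfolding has_field_derivative_iff
  proof (rule Lim_null_comparison[where g = "\<lambda>s. C\<^sup>2 * \<bar>s - t\<bar>"])
    have R0: "R t = 0" by (simp add: R_def)
    show "\<forall>\<^sub>F s in at t within {0..T}. norm ((R s - R t) / (s - t)) \<le> C\<^sup>2 * \<bar>s - t\<bar>"
      unfolding eventually_at
    proof (intro exI[of _ 1] conjI ballI impI)
      fix s assume s: "s \<in> {0..T}" "s \<noteq> t \<and> dist s t < 1"
      then show "norm ((R s - R t) / (s - t)) \<le> C\<^sup>2 * \<bar>s - t\<bar>"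
        using Rb[OF s(1)] by (simp add: R0 abs_divide divide_le_eq power2_eq_square mult.assoc)
    qed simp
    show "((\<lambda>s. C\<^sup>2 * \<bar>s - t\<bar>) \<longlongrightarrow> 0) (at t within {0..T})"
      by (auto intro!: tendsto_eq_intros)
  qed
  have eq: "energy s = energy t - 2 * (A s - A t) - R s" if s: "s \<in> {0..T}" for s
  proof -
    note c = ht[OF s] ht[OF t] w_Ck[OF s, of 0] w_Ck[OF t, of 0]
    have "R s = (\<integral>x. (h s x * w s x - h s x * w t x) - (h t x * w s x - h t x * w t x) \<partial>torus)"
      unfolding R_def by (intro Bochner_Integration.integral_cong) (auto simp: algebra_simps)
    also have "\<dots> = (\<integral>x. h s x * w s x \<partial>torus) - (\<integral>x. h s x * w t x \<partial>torus) - ((\<integral>x. h t x * w s x \<partial>torus) - (\<integral>x. h t x * w t x \<partial>torus))"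
      using c by (simp add: torus_integral_simps(2) Ck_mult Ck_diff)
    finally show ?thesis using h_w_sym[OF s t] by (simp add: energy_eq[OF s] energy_eq[OF t] A_def)
  qed
  have "((\<lambda>s. energy t - 2 * (A s - A t) - R s) has_real_derivative - 2 * (\<integral>x. h t x * wt t x \<partial>torus)) (at t within {0..T})"
    by (auto intro!: derivative_eq_intros A R)
  then show ?thesis
    by (rule has_field_derivative_transform_within[OF _ zero_less_one t]) (simp add: eq)
qed

section \<open>The scaled error of the potential and its bound by Wente's inequality\<close>

definition g :: "real \<Rightarrow> real^2 \<Rightarrow> real" where
  "g t x = (1 / \<epsilon>) * (h t x - (\<psi> t x - \<phi>b t x))"

lemma g_Ck: "t \<in> {0..T} \<Longrightarrow> Ck 2 (g t)"
  unfolding g_def by (intro Ck_cmult Ck_diff h Ck_evo)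

lemma pd_g:
  assumes t: "t \<in> {0..T}"
  shows "pd i (g t) = (\<lambda>x. (1 / \<epsilon>) * (pd i (h t) x - (pd i (\<psi> t) x - pd i (\<phi>b t) x)))"
proof
  fix x
  note d = Ck_2D(1)[OF h(1)[OF t], of x] Ck_1D(1)[OF Ck_evo(2)[OF t], of x] Ck_1D(1)[OF Ck_evo(4)[OF t], of x]
  show "pd i (g t) x = (1 / \<epsilon>) * (pd i (h t) x - (pd i (\<psi> t) x - pd i (\<phi>b t) x))"
    unfolding g_def by (simp only: pd_cmult pd_diff differentiable_diff d)
qed

lemma lap_g:
  assumes t: "t \<in> {0..T}"
  shows "lap (g t) x = jac t x"
proof -
  note d = Ck_2D(7)[OF h(1)[OF t], of _ x] Ck_2D(7)[OF Ck_evo(2)[OF t], of _ x] Ck_2D(7)[OF Ck_evo(4)[OF t], of _ x]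
  have "pd i (pd i (g t)) x = (1 / \<epsilon>) * (pd i (pd i (h t)) x - (pd i (pd i (\<psi> t)) x - pd i (pd i (\<phi>b t)) x))" for i
    unfolding pd_g[OF t] by (simp only: pd_cmult pd_diff differentiable_diff d)
  then have "lap (g t) x = (1 / \<epsilon>) * (lap (h t) x - (lap (\<psi> t) x - lap (\<phi>b t) x))"
    unfolding lap_def by (simp add: algebra_simps)
  also have "\<dots> = (1 / \<epsilon>) * (w t x - (\<rho> t x - \<epsilon> * jac t x - \<rho>b t x))"
    by (simp add: h(3)[OF t] Monge_Ampere[OF t] Poisson_b[OF t])
  also have "\<dots> = jac t x" using eps by (simp add: w_def)
  finally show ?thesis .
qed

text \<open>The determinant is at most half the squared Frobenius norm, and the smallness assumption
  absorbs \<open>\<epsilon>\<close> together with one factor of the norm. The threshold 1 leaves the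
  constant 1/4, small enough for the absorption in \<open>gnorm_psi\<close>.\<close>

lemma hessian_pointwise:
  assumes t: "t \<in> {0..T}"
  shows "(\<epsilon> * jac t x)\<^sup>2 \<le> 1 / 4 * ((pd 1 (pd 1 (\<psi> t)) x)\<^sup>2 + (pd 2 (pd 1 (\<psi> t)) x)\<^sup>2 + ((pd 1 (pd 2 (\<psi> t)) x)\<^sup>2 + (pd 2 (pd 2 (\<psi> t)) x)\<^sup>2))"
proof -
  let ?N = "(pd 1 (pd 1 (\<psi> t)) x)\<^sup>2 + (pd 2 (pd 1 (\<psi> t)) x)\<^sup>2 + ((pd 1 (pd 2 (\<psi> t)) x)\<^sup>2 + (pd 2 (pd 2 (\<psi> t)) x)\<^sup>2)"
  have p2: "Ck 2 (\<psi> t)" by (rule Ck_evo[OF t])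
  have nn: "norm (hessian (\<psi> t) y) = sqrt ((pd 1 (pd 1 (\<psi> t)) y)\<^sup>2 + (pd 2 (pd 1 (\<psi> t)) y)\<^sup>2 + ((pd 1 (pd 2 (\<psi> t)) y)\<^sup>2 + (pd 2 (pd 2 (\<psi> t)) y)\<^sup>2))" for y
    by (simp add: norm_vec_def L2_set_def sum_2 hessian_nth[OF p2])
  have H: "hessian (\<psi> t) = (\<lambda>x. \<chi> i j. pd j (pd i (\<psi> t)) x)"
    by (simp add: fun_eq_iff vec_eq_iff hessian_nth[OF p2])
  have c: "continuous_on UNIV (hessian (\<psi> t))"
    unfolding H by (intro continuous_on_vec_lambda Ck_continuous[OF Ck_2D(6)[OF p2]])
  have p: "periodic (hessian (\<psi> t))"
    unfolding H using Ck_periodic[OF Ck_2D(6)[OF p2]] by (simp add: periodic_def)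
  have "\<epsilon> * sqrt ?N \<le> \<epsilon> * Linf_norm (hessian (\<psi> t))"
    unfolding nn[symmetric] using eps by (intro mult_left_mono Linf_norm(1) c p) auto
  also have "\<dots> \<le> 1" by (rule small[OF t])
  finally have e1: "\<epsilon> * sqrt ?N \<le> 1" .
  have N0: "0 \<le> ?N" by simp
  have j: "\<bar>jac t x\<bar> \<le> ?N / 2"
    unfolding jac_def br_def
    using sum_squares_bound[of "\<bar>pd 1 (pd 1 (\<psi> t)) x\<bar>" "\<bar>pd 2 (pd 2 (\<psi> t)) x\<bar>"] sum_squares_bound[of "\<bar>pd 2 (pd 1 (\<psi> t)) x\<bar>" "\<bar>pd 1 (pd 2 (\<psi> t)) x\<bar>"]
      abs_triangle_ineq4[of "pd 1 (pd 1 (\<psi> t)) x * pd 2 (pd 2 (\<psi> t)) x" "pd 2 (pd 1 (\<psi> t)) x * pd 1 (pd 2 (\<psi> t)) x"]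
    by (simp add: abs_mult)
  have "\<bar>\<epsilon> * jac t x\<bar> \<le> \<epsilon> * (?N / 2)" using j eps by (simp add: abs_mult)
  also have "\<dots> = (\<epsilon> * sqrt ?N) * (sqrt ?N / 2)" using real_sqrt_mult_self[of ?N] N0 by simp
  also have "\<dots> \<le> 1 * (sqrt ?N / 2)" by (intro mult_right_mono e1) (simp add: N0)
  finally have "\<bar>\<epsilon> * jac t x\<bar>\<^sup>2 \<le> (sqrt ?N / 2)\<^sup>2" by (intro power_mono) auto
  also have "\<dots> = 1 / 4 * ?N" using N0 by (simp add: power_divide)
  finally show ?thesis by simp
qed

lemma rho_L2: "t \<in> {0..T} \<Longrightarrow> (\<integral>x. (\<rho> t x)\<^sup>2 \<partial>torus) = (L2_norm (\<rho> 0))\<^sup>2"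
proof -
  assume t: "t \<in> {0..T}"
  have "(\<integral>x. (\<rho> t x)\<^sup>2 \<partial>torus) = (\<integral>x. (\<rho> 0 x)\<^sup>2 \<partial>torus)"
    by (rule conservation[OF evo(2,1) tr(1) _ _ t, of "\<lambda>y. y\<^sup>2" "\<lambda>y. 2 * y"])
       (auto intro!: derivative_eq_intros continuous_intros)
  also have "\<dots> = (L2_norm (\<rho> 0))\<^sup>2"
    unfolding L2_norm_def by (rule real_sqrt_pow2[symmetric]) (auto intro!: integral_nonneg_AE)
  finally show ?thesis .
qed

text \<open>The left side is the \<open>L^2\<close> norm squared of the Laplacian. From
  \<open>(a - b)^2 <= 2 a^2 + 2 b^2\<close> and \<open>hessian_pointwise\<close> it is at most
  \<open>2 N^2\<close> plus half of itself, where \<open>N\<close> is the \<open>L^2\<close> norm of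
  the initial density.\<close>

lemma gnorm_psi:
  assumes t: "t \<in> {0..T}"
  shows "(gnorm (pd 1 (\<psi> t)))\<^sup>2 + (gnorm (pd 2 (\<psi> t)))\<^sup>2 \<le> 4 * (L2_norm (\<rho> 0))\<^sup>2"
proof -
  have p2: "Ck 2 (\<psi> t)" by (rule Ck_evo[OF t])
  note c2 = Ck_power[OF Ck_2D(6)[OF p2], of _ _ 2]
  let ?N = "\<lambda>x. (pd 1 (pd 1 (\<psi> t)) x)\<^sup>2 + (pd 2 (pd 1 (\<psi> t)) x)\<^sup>2 + ((pd 1 (pd 2 (\<psi> t)) x)\<^sup>2 + (pd 2 (pd 2 (\<psi> t)) x)\<^sup>2)"
  define X where "X = (\<integral>x. (lap (\<psi> t) x)\<^sup>2 \<partial>torus)"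
  have g2: "(gnorm (pd 1 (\<psi> t)))\<^sup>2 + (gnorm (pd 2 (\<psi> t)))\<^sup>2 = X"
    unfolding gnorm_sq X_def integral_hessian_sq[OF p2, symmetric]
    by (simp add: torus_integral_simps(1)[OF c2 c2])
  have NX: "(\<integral>x. ?N x \<partial>torus) = X"
    unfolding X_def integral_hessian_sq[OF p2, symmetric]
    by (simp add: torus_integral_simps(1)[OF Ck_add[OF c2 c2] Ck_add[OF c2 c2]] torus_integral_simps(1)[OF c2 c2])
  have NC: "Ck 0 ?N" by (intro Ck_add c2)
  have r2: "Ck 0 (\<lambda>x. (\<rho> t x)\<^sup>2)" by (intro Ck_power Ck_evo t)
  have "X \<le> (\<integral>x. 2 * (\<rho> t x)\<^sup>2 + 1 / 2 * ?N x \<partial>torus)"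
    unfolding X_def
  proof (rule integral_mono)
    show "integrable torus (\<lambda>x. (lap (\<psi> t) x)\<^sup>2)" by (rule Ck_integrable[OF Ck_power[OF Ck_lap[OF p2]]])
    show "integrable torus (\<lambda>x. 2 * (\<rho> t x)\<^sup>2 + 1 / 2 * ?N x)"
      by (rule Ck_integrable[of 0]) (intro Ck_add[OF Ck_cmult Ck_cmult] r2 NC)
    fix x
    have "(\<rho> t x - \<epsilon> * jac t x)\<^sup>2 \<le> 2 * (\<rho> t x)\<^sup>2 + 2 * (\<epsilon> * jac t x)\<^sup>2"
      using zero_le_power2[of "\<rho> t x + \<epsilon> * jac t x"] unfolding power2_diff power2_sum by linarith
    also have "\<dots> \<le> 2 * (\<rho> t x)\<^sup>2 + 1 / 2 * ?N x" using hessian_pointwise[OF t, of x] by simp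
    finally show "(lap (\<psi> t) x)\<^sup>2 \<le> 2 * (\<rho> t x)\<^sup>2 + 1 / 2 * ?N x" unfolding Monge_Ampere[OF t] .
  qed
  also have "\<dots> = 2 * (L2_norm (\<rho> 0))\<^sup>2 + 1 / 2 * X"
    by (simp only: torus_integral_simps(1)[OF Ck_cmult[OF r2] Ck_cmult[OF NC]] integral_mult_right_zero rho_L2[OF t] NX)
  finally show ?thesis unfolding g2 by linarith
qed

text \<open>Wente's inequality is tested with \<open>g\<close> itself and one factor cancels. The 18
  is Wente's 9 times 2, as the two gradient norms of \<open>\<psi>\<close> have product at most
  \<open>2 N^2\<close>, \<open>N\<close> being the \<open>L^2\<close> norm of the initial
  density.\<close>

lemma gnorm_g:
  assumes t: "t \<in> {0..T}"
  shows "gnorm (g t) \<le> 18 * (L2_norm (\<rho> 0))\<^sup>2"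
proof -
  let ?a = "gnorm (pd 1 (\<psi> t))" and ?b = "gnorm (pd 2 (\<psi> t))"
  have p2: "Ck 2 (\<psi> t)" by (rule Ck_evo[OF t])
  have "2 * ?a * ?b \<le> 4 * (L2_norm (\<rho> 0))\<^sup>2"
    using sum_squares_bound[of ?a ?b] gnorm_psi[OF t] by linarith
  then have ab: "9 * ?a * ?b \<le> 18 * (L2_norm (\<rho> 0))\<^sup>2" by simp
  have "(gnorm (g t))\<^sup>2 = - (\<integral>x. jac t x * g t x \<partial>torus)"
    using gnorm_sq_green[OF g_Ck[OF t]] by (simp add: lap_g[OF t] mult.commute)
  also have "\<dots> \<le> 9 * ?a * ?b * gnorm (g t)"
    using Wente[OF Ck_2D(2)[OF p2, of 1] Ck_2D(2)[OF p2, of 2] Ck_2D(3)[OF g_Ck[OF t]]]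
    by (simp add: jac_def abs_le_iff)
  finally have "gnorm (g t) * gnorm (g t) \<le> (9 * ?a * ?b) * gnorm (g t)" by (simp add: power2_eq_square)
  then have "gnorm (g t) \<le> 9 * ?a * ?b"
    using gnorm_nonneg[of "g t"] by (cases "gnorm (g t) = 0") (auto simp: mult_le_cancel_right)
  with ab show ?thesis by linarith
qed

definition L :: "real \<Rightarrow> real" where
  "L t = Linf_norm (\<lambda>x. jacobian (perp_gradient (\<phi>b t)) (at x))"

lemma jac_phi:
  assumes t: "t \<in> {0..T}"
  shows "jacobian (perp_gradient (\<phi>b t)) (at x) =
    (\<chi> i j. if i = 1 then - pd j (pd 2 (\<phi>b t)) x else pd j (pd 1 (\<phi>b t)) x)"
  using jacobian_perp_gradient[OF Ck_evo(4)[OF t]] by (simp add: vec_eq_iff forall_2)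

lemma jac_phi_periodic: "t \<in> {0..T} \<Longrightarrow> periodic (\<lambda>x. jacobian (perp_gradient (\<phi>b t)) (at x))"
proof -
  assume t: "t \<in> {0..T}"
  have "pd i (pd j (\<phi>b t)) (x + lattice_point k) = pd i (pd j (\<phi>b t)) x" for i j x k
    by (rule periodicD[OF Ck_periodic[OF Ck_2D(6)[OF Ck_evo(4)[OF t]]]])
  then show ?thesis by (simp add: jac_phi[OF t] periodic_iff fun_eq_iff vec_eq_iff)
qed

lemma jac_phi_continuous: "continuous_on ({0..T} \<times> UNIV) (\<lambda>(t, x). jacobian (perp_gradient (\<phi>b t)) (at x))"
proof -
  have "continuous_on ({0..T} \<times> UNIV) (\<lambda>z. (\<chi> i j. if i = (1::2) then - pd j (pd 2 (\<phi>b (fst z))) (snd z) else pd j (pd 1 (\<phi>b (fst z))) (snd z)))"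
  proof (intro continuous_on_vec_lambda)
    fix i j :: 2
    show "continuous_on ({0..T} \<times> UNIV) (\<lambda>z. if i = 1 then - pd j (pd 2 (\<phi>b (fst z))) (snd z) else pd j (pd 1 (\<phi>b (fst z))) (snd z))"
      by (cases "i = 1") (auto intro!: continuous_on_minus evolution_continuous(3) evo)
  qed
  then show ?thesis
    by (rule continuous_on_eq) (auto simp: jac_phi fun_eq_iff vec_eq_iff)
qed

lemma L: "continuous_on {0..T} L" "t \<in> {0..T} \<Longrightarrow> norm (jacobian (perp_gradient (\<phi>b t)) (at x)) \<le> L t" "t \<in> {0..T} \<Longrightarrow> 0 \<le> L t"
proof -
  show "continuous_on {0..T} L"
    unfolding L_def by (rule continuous_on_Linf_norm[OF jac_phi_continuous jac_phi_periodic])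
  show *: "norm (jacobian (perp_gradient (\<phi>b t)) (at x)) \<le> L t" if t: "t \<in> {0..T}" for t x
  proof -
    have "continuous_on UNIV (\<lambda>x. jacobian (perp_gradient (\<phi>b t)) (at x))"
      using continuous_on_compose2[OF jac_phi_continuous continuous_on_Pair[OF continuous_on_const continuous_on_id], of t UNIV] t
      by (auto simp: image_subset_iff)
    then show ?thesis unfolding L_def by (rule Linf_norm(1)[OF _ jac_phi_periodic[OF t]])
  qed
  show "0 \<le> L t" if "t \<in> {0..T}" using *[OF that, of 0] norm_ge_zero order_trans by blast
qed

lemma rho_bound: "t \<in> {0..T} \<Longrightarrow> \<bar>\<rho> t x\<bar> \<le> Linf_norm (\<rho> 0)"
proof (rule transported_bound[OF evo(2,1) tr(1)])
  fix x
  have c: "Ck 0 (\<rho> 0)" using T by (intro Ck_evo) simp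
  show "\<bar>\<rho> 0 x\<bar> \<le> Linf_norm (\<rho> 0)"
    using Linf_norm(1)[OF Ck_continuous[OF c] Ck_periodic[OF c], of x] by simp
qed

text \<open>Insert \<open>\<psi> - \<phi>b = h - \<epsilon> g\<close> and
  \<open>\<rho>b = \<rho> - w\<close> into the two brackets: first the potentials are exchanged
  against \<open>\<rho>\<close>, then the densities against \<open>\<phi>b\<close>.\<close>

lemma br_difference:
  assumes t: "t \<in> {0..T}"
  shows "wt t x = - (br (h t) (\<rho> t) x - \<epsilon> * br (g t) (\<rho> t) x + br (\<phi>b t) (w t) x)"
proof -
  have "pd i (w t) x = pd i (\<rho> t) x - pd i (\<rho>b t) x" for i
    unfolding w_def by (rule pd_diff) (auto intro!: Ck_1D(1) Ck_evo t)
  note pw = this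
  have "\<epsilon> * br (g t) (\<rho> t) x = (pd 1 (h t) x - (pd 1 (\<psi> t) x - pd 1 (\<phi>b t) x)) * pd 2 (\<rho> t) x
      - (pd 2 (h t) x - (pd 2 (\<psi> t) x - pd 2 (\<phi>b t) x)) * pd 1 (\<rho> t) x"
    using eps by (simp add: br_def pd_g[OF t] field_simps)
  then show ?thesis by (simp only: wt_def) (simp add: br_def pw algebra_simps)
qed

lemma energy_inequality:
  assumes t: "t \<in> {0..T}"
  shows "- 2 * (\<integral>x. h t x * wt t x \<partial>torus) \<le>
    2 * L t * energy t + 2 * (\<epsilon> * Linf_norm (\<rho> 0) * (18 * (L2_norm (\<rho> 0))\<^sup>2)) * sqrt (energy t)"
proof -
  note h2 = h(1)[OF t] and g2 = g_Ck[OF t] and r = Ck_evo(1)[OF t] and p = Ck_evo(4)[OF t] and w = w_Ck[OF t]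
  have c: "Ck 0 (\<lambda>x. h t x * br (h t) (\<rho> t) x)" "Ck 0 (\<lambda>x. h t x * br (g t) (\<rho> t) x)" "Ck 0 (\<lambda>x. h t x * br (\<phi>b t) (w t) x)"
    by (intro Ck_mult Ck_br_0 Ck_2D(3,4) h2 g2 r p w)+
  have "- (\<integral>x. h t x * wt t x \<partial>torus) = (\<integral>x. h t x * br (h t) (\<rho> t) x - \<epsilon> * (h t x * br (g t) (\<rho> t) x) + h t x * br (\<phi>b t) (w t) x \<partial>torus)"
    unfolding br_difference[OF t] integral_minus[symmetric]
    by (intro Bochner_Integration.integral_cong) (auto simp: algebra_simps)
  also have "\<dots> = (\<integral>x. h t x * br (h t) (\<rho> t) x \<partial>torus) - \<epsilon> * (\<integral>x. h t x * br (g t) (\<rho> t) x \<partial>torus) + (\<integral>x. h t x * br (\<phi>b t) (w t) x \<partial>torus)"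
    by (simp only: torus_integral_simps(1)[OF Ck_diff[OF c(1) Ck_cmult[OF c(2)]] c(3)] torus_integral_simps(2)[OF c(1) Ck_cmult[OF c(2)]] integral_mult_right_zero)
  also have "(\<integral>x. h t x * br (h t) (\<rho> t) x \<partial>torus) = 0"
    using integral_br_antisym[OF h2 r Ck_2D(3)[OF h2]] by (simp add: br_def)
  \<comment> \<open>Skew-adjointness removes the derivative from \<open>\<rho>\<close>, so only its
    sup norm enters; in the next step it likewise removes the derivative from
    \<open>w\<close>.\<close>
  also have "(\<integral>x. h t x * br (g t) (\<rho> t) x \<partial>torus) = - (\<integral>x. \<rho> t x * br (g t) (h t) x \<partial>torus)"
    by (rule integral_br_antisym[OF g2 r Ck_2D(3)[OF h2]])
  also have "(\<integral>x. h t x * br (\<phi>b t) (w t) x \<partial>torus) = - (\<integral>x. lap (h t) x * br (\<phi>b t) (h t) x \<partial>torus)"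
    unfolding h(3)[OF t] by (rule integral_br_antisym[OF p w Ck_2D(3)[OF h2]])
  also have "0 - \<epsilon> * - (\<integral>x. \<rho> t x * br (g t) (h t) x \<partial>torus) + - (\<integral>x. lap (h t) x * br (\<phi>b t) (h t) x \<partial>torus)
     \<le> \<epsilon> * (Linf_norm (\<rho> 0) * (18 * (L2_norm (\<rho> 0))\<^sup>2 * gnorm (h t))) + L t * (gnorm (h t))\<^sup>2"
  proof -
    have "(\<integral>x. \<rho> t x * br (g t) (h t) x \<partial>torus) \<le> Linf_norm (\<rho> 0) * (gnorm (g t) * gnorm (h t))"
      by (intro integral_br_le r rho_bound t Ck_2D(3) g2 h2)
    also have "\<dots> \<le> Linf_norm (\<rho> 0) * (18 * (L2_norm (\<rho> 0))\<^sup>2 * gnorm (h t))"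
      using rho_bound[OF t, of 0] by (intro mult_left_mono mult_right_mono gnorm_g t) auto
    finally have "\<epsilon> * (\<integral>x. \<rho> t x * br (g t) (h t) x \<partial>torus) \<le> \<epsilon> * (Linf_norm (\<rho> 0) * (18 * (L2_norm (\<rho> 0))\<^sup>2 * gnorm (h t)))"
      using eps by (intro mult_left_mono) auto
    moreover have "- (\<integral>x. lap (h t) x * br (\<phi>b t) (h t) x \<partial>torus) \<le> L t * (gnorm (h t))\<^sup>2"
      by (rule transport_energy_le[OF p h2 L(2)[OF t]])
    ultimately show ?thesis by linarith
  qed
  finally have "- (\<integral>x. h t x * wt t x \<partial>torus) \<le> \<epsilon> * (Linf_norm (\<rho> 0) * (18 * (L2_norm (\<rho> 0))\<^sup>2 * gnorm (h t))) + L t * (gnorm (h t))\<^sup>2" .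
  then show ?thesis by (simp add: energy_def algebra_simps)
qed

lemma gnorm_h_bound:
  assumes t: "t \<in> {0..T}"
  shows "gnorm (h t) \<le> \<epsilon> * Linf_norm (\<rho> 0) * (18 * (L2_norm (\<rho> 0))\<^sup>2) * t * exp (integral {0..t} L)"
proof -
  have M: "0 \<le> Linf_norm (\<rho> 0)" using rho_bound[OF t, of 0] by linarith
  have "sqrt (energy t) \<le> \<epsilon> * Linf_norm (\<rho> 0) * (18 * (L2_norm (\<rho> 0))\<^sup>2) * t * exp (integral {0..t} L)"
    by (rule Gronwall_sqrt[OF energy_deriv _ energy_0 energy_inequality L(1,3) _ t])
       (use eps M in \<open>auto simp: energy_def\<close>)
  then show ?thesis by (simp add: energy_def)
qed

text \<open>The flux \<open>\<epsilon>\<close> times the gradient of \<open>h\<close> has divergence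
  equal to the difference of the densities, so \<open>Moser_W2\<close> bounds the distance by
  \<open>\<epsilon> * gnorm h / sqrt c\<close>. The second power of \<open>\<epsilon>\<close> comes
  from \<open>gnorm_h_bound\<close>.\<close>

lemma W2_bound:
  assumes c: "0 < c" "\<And>t x. t \<in> {0..T} \<Longrightarrow> c \<le> 1 + \<epsilon> * \<rho> t x" "\<And>t x. t \<in> {0..T} \<Longrightarrow> c \<le> 1 + \<epsilon> * \<rho>b t x"
    and t: "t \<in> {0..T}"
  shows "W2 (torus_density (\<lambda>x. 1 + \<epsilon> * \<rho> t x)) (torus_density (\<lambda>x. 1 + \<epsilon> * \<rho>b t x)) \<le>
    18 * (Linf_norm (\<rho> 0) + L2_norm (\<rho> 0)) ^ 3 * T * exp (\<integral>t\<in>{0..T}. L t \<partial>lborel) / sqrt c * \<epsilon>\<^sup>2"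
proof -
  note h2 = h(1)[OF t]
  let ?q = "\<lambda>i x. \<epsilon> * pd i (h t) x"
  interpret M: Moser "\<lambda>x. 1 + \<epsilon> * \<rho> t x" "\<lambda>x. 1 + \<epsilon> * \<rho>b t x" "?q 1" "?q 2" c
  proof
    show "Ck 2 (\<lambda>x. 1 + \<epsilon> * \<rho> t x)" "Ck 2 (\<lambda>x. 1 + \<epsilon> * \<rho>b t x)" by (intro Ck_intros Ck_evo t)+
    show "Ck 1 (?q 1)" "Ck 1 (?q 2)" by (intro Ck_intros Ck_2D(2) h2)+
    show "pd 1 (?q 1) x + pd 2 (?q 2) x = 1 + \<epsilon> * \<rho> t x - (1 + \<epsilon> * \<rho>b t x)" for x
    proof -
      have "pd 1 (?q 1) x + pd 2 (?q 2) x = \<epsilon> * lap (h t) x"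
        by (simp add: pd_cmult Ck_2D(7)[OF h2] lap_def distrib_left)
      then show ?thesis by (simp add: h(3)[OF t] w_def algebra_simps)
    qed
  qed (use c t in auto)
  have mass: "(\<integral>x. 1 + \<epsilon> * r x \<partial>torus) = 1" if "Ck 0 r" "(\<integral>x. r x \<partial>torus) = 0" for r
    using torus_integral_simps(1)[OF Ck_const Ck_cmult[OF that(1)]] that(2) by (simp add: torus.prob_space[simplified])
  have "W2 (torus_density (\<lambda>x. 1 + \<epsilon> * \<rho> t x)) (torus_density (\<lambda>x. 1 + \<epsilon> * \<rho>b t x)) \<le>
     sqrt ((\<integral>x. (?q 1 x)\<^sup>2 + (?q 2 x)\<^sup>2 \<partial>torus) / c)"
    by (intro M.Moser_W2 mass Ck_evo mean_zero_integral t)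
  also have "(\<integral>x. (?q 1 x)\<^sup>2 + (?q 2 x)\<^sup>2 \<partial>torus) = (\<epsilon> * gnorm (h t))\<^sup>2"
    unfolding power_mult_distrib gnorm_sq integral_mult_right_zero[symmetric] distrib_left ..
  also have "sqrt ((\<epsilon> * gnorm (h t))\<^sup>2 / c) = \<epsilon> * gnorm (h t) / sqrt c"
    using eps by (simp add: real_sqrt_divide)
  also have "\<dots> \<le> \<epsilon> * (\<epsilon> * (18 * (Linf_norm (\<rho> 0) + L2_norm (\<rho> 0)) ^ 3) * T * exp (\<integral>t\<in>{0..T}. L t \<partial>lborel)) / sqrt c"
  proof -
    let ?M = "Linf_norm (\<rho> 0)" and ?N = "L2_norm (\<rho> 0)"
    have M: "0 \<le> ?M" using rho_bound[OF t, of 0] by linarith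
    have N: "0 \<le> ?N" unfolding L2_norm_def by (auto intro!: integral_nonneg_AE)
    \<comment> \<open>The constant may depend on the initial density only through the sum of its two
      norms.\<close>
    have "?M * ?N\<^sup>2 \<le> (?M + ?N) * (?M + ?N)\<^sup>2" using M N by (intro mult_mono power_mono) auto
    then have MN: "?M * (18 * ?N\<^sup>2) \<le> 18 * (?M + ?N) ^ 3" by (simp add: power3_eq_cube power2_eq_square mult_ac)
    have int: "L integrable_on {0..s}" if "s \<in> {0..T}" for s
      using that by (intro integrable_continuous_real continuous_on_subset[OF L(1)]) auto
    have "integral {0..t} L \<le> integral {0..T} L"
      using t by (intro integral_subset_le int) (auto simp: L(3))
    also have "\<dots> = (\<integral>t\<in>{0..T}. L t \<partial>lborel)"
      by (rule set_borel_integral_eq_integral(2)[symmetric, OF borel_integrable_atLeastAtMost'[OF L(1)]])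
    finally have I: "exp (integral {0..t} L) \<le> exp (\<integral>t\<in>{0..T}. L t \<partial>lborel)" by simp
    have "gnorm (h t) \<le> \<epsilon> * (?M * (18 * ?N\<^sup>2)) * t * exp (integral {0..t} L)"
      using gnorm_h_bound[OF t] by (simp add: mult.assoc)
    also have "\<dots> \<le> \<epsilon> * (18 * (?M + ?N) ^ 3) * T * exp (\<integral>t\<in>{0..T}. L t \<partial>lborel)"
      using eps M N t by (intro mult_mono[OF mult_mono[OF mult_left_mono[OF MN]] I]) auto
    finally show ?thesis using eps c(1) by (intro divide_right_mono mult_left_mono) auto
  qed
  finally show ?thesis by (simp add: power2_eq_square mult_ac)
qed

end

text \<open>Both witnesses are explicit. The threshold is 1, which is what the absorption in
  \<open>gnorm_psi\<close> uses. In the constant, 18 and the cube come from Wente's inequality and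
  the conserved norms, \<open>T * exp I\<close> from Gronwall, and \<open>1 / sqrt c\<close> from
  dividing the flux by the density.\<close>

theorem corollary8p3:
  shows "\<exists>\<eta>0>0. \<exists>C :: real \<Rightarrow> real \<Rightarrow> real \<Rightarrow> real \<Rightarrow> real.
    \<forall>(T::real) (c0::real) (\<rho>bar :: real \<Rightarrow> real^2 \<Rightarrow> real) (\<phi>bar :: real \<Rightarrow> real^2 \<Rightarrow> real)
      (\<rho>0 :: real^2 \<Rightarrow> real) (\<epsilon>::real)
      (\<rho> :: real \<Rightarrow> real^2 \<Rightarrow> real) (\<psi> :: real \<Rightarrow> real^2 \<Rightarrow> real).
      T > 0 \<longrightarrow> c0 > 0 \<longrightarrow> \<epsilon> > 0 \<longrightarrow>
      smooth_Euler_solution T \<rho>bar \<phi>bar \<longrightarrow>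
      smooth_Monge_Ampere_solution T \<epsilon> \<rho> \<psi> \<longrightarrow>
      \<rho> 0 = \<rho>0 \<longrightarrow> \<rho>bar 0 = \<rho>0 \<longrightarrow>
      (\<forall>t\<in>{0..T}. \<epsilon> * Linf_norm (hessian (\<psi> t)) \<le> \<eta>0) \<longrightarrow>
      (\<forall>t\<in>{0..T}. \<forall>x. 1 + \<epsilon> * \<rho> t x \<ge> c0 \<and> 1 + \<epsilon> * \<rho>bar t x \<ge> c0) \<longrightarrow>
      (SUP t\<in>{0..T}. ereal (W2 (torus_density (\<lambda>x. 1 + \<epsilon> * \<rho> t x))
                               (torus_density (\<lambda>x. 1 + \<epsilon> * \<rho>bar t x))))
        \<le> ereal (C T c0 (Linf_norm \<rho>0 + L2_norm \<rho>0)
                   (\<integral>t\<in>{0..T}. Linf_norm (\<lambda>x. jacobian (perp_gradient (\<phi>bar t)) (at x)) \<partial>lborel)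
                 * \<epsilon>\<^sup>2)"
proof (rule exI[of _ 1], rule conjI[OF zero_less_one], rule exI[of _ "\<lambda>T c N I. 18 * N ^ 3 * T * exp I / sqrt c"], intro allI impI)
  fix T c0 \<epsilon> :: real and \<rho>bar \<phi>bar \<rho> \<psi> :: "real \<Rightarrow> real^2 \<Rightarrow> real" and \<rho>0 :: "real^2 \<Rightarrow> real"
  assume A: "T > 0" "c0 > 0" "\<epsilon> > 0" "smooth_Euler_solution T \<rho>bar \<phi>bar" "smooth_Monge_Ampere_solution T \<epsilon> \<rho> \<psi>"
    "\<rho> 0 = \<rho>0" "\<rho>bar 0 = \<rho>0"
    and small: "\<forall>t\<in>{0..T}. \<epsilon> * Linf_norm (hessian (\<psi> t)) \<le> 1"
    and c0: "\<forall>t\<in>{0..T}. \<forall>x. 1 + \<epsilon> * \<rho> t x \<ge> c0 \<and> 1 + \<epsilon> * \<rho>bar t x \<ge> c0"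
  interpret two_flows T \<epsilon> \<rho>bar \<phi>bar \<rho> \<psi>
    by unfold_locales (use A small in auto)
  show "(SUP t\<in>{0..T}. ereal (W2 (torus_density (\<lambda>x. 1 + \<epsilon> * \<rho> t x)) (torus_density (\<lambda>x. 1 + \<epsilon> * \<rho>bar t x))))
        \<le> ereal (18 * (Linf_norm \<rho>0 + L2_norm \<rho>0) ^ 3 * T
            * exp (\<integral>t\<in>{0..T}. Linf_norm (\<lambda>x. jacobian (perp_gradient (\<phi>bar t)) (at x)) \<partial>lborel) / sqrt c0 * \<epsilon>\<^sup>2)"
  proof (rule SUP_least)
    fix t assume t: "t \<in> {0..T}"
    show "ereal (W2 (torus_density (\<lambda>x. 1 + \<epsilon> * \<rho> t x)) (torus_density (\<lambda>x. 1 + \<epsilon> * \<rho>bar t x)))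
        \<le> ereal (18 * (Linf_norm \<rho>0 + L2_norm \<rho>0) ^ 3 * T
            * exp (\<integral>t\<in>{0..T}. Linf_norm (\<lambda>x. jacobian (perp_gradient (\<phi>bar t)) (at x)) \<partial>lborel) / sqrt c0 * \<epsilon>\<^sup>2)"
      using W2_bound[OF A(2) _ _ t] c0 A(6) by (simp add: L_def)
  qed
qed

end
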